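(* Let $d\ge2$, let $\Omega\subset\mathbb{R}^d$ be a bounded simply connected Lipschitz domain, let $D$ be a simply connected Lipschitz domain compactly contained in $\Omega$, and let $a<b<0$ be the numbers fixed in the context. For $\epsilon>0$ let $$Q_\epsilon=\{k\in\mathbb{C}:\operatorname{dist}(k,[a,b])>\epsilon\}.$$ For any $\epsilon>0$ there is a constant $C=C_\epsilon$ such that $$\|u_k\|_{H^1(\Omega)}\le C\|g\|_{H^{-1/2}(\partial\Omega)}$$ for all $k\in Q_\epsilon$ and $g\in H^{-1/2}_0(\partial\Omega)$, where $u_k$ is the solution of $\nabla\cdot(\gamma_k\nabla u)=0$ in $\Omega$, $\partial_\nu u|_{\partial\Omega}=g$, $\int_{\partial\Omega}u\,d\sigma=0$, with $\gamma_k=\chi(\Omega\setminus D)+k\chi(D)$.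
   Context: $\chi(E)$ is the characteristic function of $E$; $\partial_\nu$ is the outward normal derivative; $H^{-1/2}_0(\partial\Omega)$ is the set of $g\in H^{-1/2}(\partial\Omega)$ with $\langle g,1\rangle=0$. A solution $u\in H^1(\Omega)$ is understood to be harmonic in $D$ and in $\Omega\setminus\overline D$ and to satisfy $u|_+=u|_-$, $\partial_\nu u|_+=k\,\partial_\nu u|_-$ on $\partial D$ ($+,-$: limits from outside and inside $D$). The numbers $-\infty<a<b<0$ (depending on $\Omega$ and $D$) are fixed such that (i) for every $k\in\mathbb{C}\setminus[a,b]$ and every $g\in H^{-1/2}_0(\partial\Omega)$ the boundary value problem has a unique solution $u_k\in H^1(\Omega)$, and $\|u_k\|_{H^1(\Omega)}\le C_k\|g\|_{H^{-1/2}(\partial\Omega)}$ with $C_k$ independent of $g$; and (ii) there is a constant $C$ independent of $k$ and $g$ with $\|u_k\|_{H^1(\Omega)}\le C\|g\|_{H^{-1/2}(\partial\Omega)}$ for all $k$ with $|k|>-a$ or $|k|<-b$. Such numbers exist. *)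

theory Defs
  imports "HOL-Analysis.Analysis"
begin

section \<open>Domains\<close>

text \<open>
  Near every boundary point the set is the region strictly above the graph of a Lipschitz
  function. The direction of the vertical axis is a unit vector \<open>e\<close>, and the
  hyperplane orthogonal to \<open>e\<close> plays the role of the horizontal coordinates.
\<close>

definition lipschitz_boundary :: "(real ^ 'n) set \<Rightarrow> bool" where
  "lipschitz_boundary U \<longleftrightarrow>
    (\<forall>p \<in> frontier U. \<exists>e r L \<psi>. norm e = 1 \<and> 0 < r \<and>
       L-lipschitz_on {y. y \<bullet> e = 0} (\<psi> :: real ^ 'n \<Rightarrow> real) \<and>
       U \<inter> ball p r = {x \<in> ball p r. \<psi> (x - (x \<bullet> e) *\<^sub>R e) < x \<bullet> e})"

definition lipschitz_domain :: "(real ^ 'n) set \<Rightarrow> bool" where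
  "lipschitz_domain U \<longleftrightarrow> open U \<and> connected U \<and> U \<noteq> {} \<and> lipschitz_boundary U"

section \<open>Smooth functions\<close>

text \<open>\<open>C_on m U f\<close>: \<open>f\<close> is \<open>m\<close> times continuously differentiable on the open set \<open>U\<close>.\<close>

primrec C_on :: "nat \<Rightarrow> (real ^ 'n) set \<Rightarrow> (real ^ 'n \<Rightarrow> complex) \<Rightarrow> bool" where
  "C_on 0 U f \<longleftrightarrow> continuous_on U f"
| "C_on (Suc m) U f \<longleftrightarrow>
    (\<exists>f'. (\<forall>x \<in> U. (f has_derivative f' x) (at x)) \<and> (\<forall>v. C_on m U (\<lambda>x. f' x v)))"

definition smooth :: "(real ^ 'n \<Rightarrow> complex) \<Rightarrow> bool" where
  "smooth f \<longleftrightarrow> (\<forall>m. C_on m UNIV f)"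

definition partial :: "'n \<Rightarrow> (real ^ 'n \<Rightarrow> complex) \<Rightarrow> real ^ 'n \<Rightarrow> complex" where
  "partial i f x = frechet_derivative f (at x) (axis i 1)"

definition test_fun :: "(real ^ 'n) set \<Rightarrow> (real ^ 'n \<Rightarrow> complex) \<Rightarrow> bool" where
  "test_fun U \<phi> \<longleftrightarrow> smooth \<phi> \<and> (\<exists>K. compact K \<and> K \<subseteq> U \<and> (\<forall>x. x \<notin> K \<longrightarrow> \<phi> x = 0))"

section \<open>Square-integrable functions and the Sobolev space \<open>H\<^sup>1\<close>\<close>

text \<open>
  Elements of function spaces are represented by functions; those that agree almost
  everywhere are identified only through the (semi)norms.
\<close>

definition L2 :: "'a measure \<Rightarrow> ('a \<Rightarrow> 'b :: euclidean_space) set" where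
  "L2 M = {f \<in> borel_measurable M. integrable M (\<lambda>x. (norm (f x))\<^sup>2)}"

definition L2_norm :: "'a measure \<Rightarrow> ('a \<Rightarrow> 'b :: euclidean_space) \<Rightarrow> real" where
  "L2_norm M f = sqrt (LINT x|M. (norm (f x))\<^sup>2)"

definition has_weak_gradient ::
  "(real ^ 'n) set \<Rightarrow> (real ^ 'n \<Rightarrow> complex) \<Rightarrow> (real ^ 'n \<Rightarrow> complex ^ 'n) \<Rightarrow> bool" where
  "has_weak_gradient U u G \<longleftrightarrow> G \<in> L2 (lebesgue_on U) \<and>
    (\<forall>\<phi> i. test_fun U \<phi> \<longrightarrow>
      (LINT x|lebesgue_on U. u x * partial i \<phi> x) = - (LINT x|lebesgue_on U. G x $ i * \<phi> x))"

definition H1 :: "(real ^ 'n) set \<Rightarrow> (real ^ 'n \<Rightarrow> complex) set" where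
  "H1 U = {u \<in> L2 (lebesgue_on U). \<exists>G. has_weak_gradient U u G}"

text \<open>The weak gradient is unique up to a null set, so the choice is immaterial below.\<close>

definition wgrad :: "(real ^ 'n) set \<Rightarrow> (real ^ 'n \<Rightarrow> complex) \<Rightarrow> real ^ 'n \<Rightarrow> complex ^ 'n" where
  "wgrad U u = (SOME G. has_weak_gradient U u G)"

definition H1_norm :: "(real ^ 'n) set \<Rightarrow> (real ^ 'n \<Rightarrow> complex) \<Rightarrow> real" where
  "H1_norm U u =
    sqrt ((L2_norm (lebesgue_on U) u)\<^sup>2 + (L2_norm (lebesgue_on U) (wgrad U u))\<^sup>2)"

text \<open>The bilinear product, without complex conjugation.\<close>

definition cdot :: "complex ^ 'n \<Rightarrow> complex ^ 'n \<Rightarrow> complex" where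
  "cdot v w = (\<Sum>i\<in>UNIV. v $ i * w $ i)"

section \<open>Surface measure\<close>

text \<open>
  The \<open>s\<close>-dimensional Hausdorff measure on Borel sets, for \<open>s \<ge> 1\<close> (for \<open>s = 0\<close> empty
  covering sets would wrongly count as \<open>0 ^ 0 = 1\<close>), normalised to agree with
  \<open>s\<close>-dimensional Lebesgue measure. Covering sets are required to be bounded because
  \<^const>\<open>diameter\<close> is meaningless otherwise.
\<close>

definition hausdorff_pre :: "nat \<Rightarrow> real \<Rightarrow> 'a :: metric_space set \<Rightarrow> ennreal" where
  "hausdorff_pre s \<delta> A =
    (INF C \<in> {C :: nat \<Rightarrow> 'a set. A \<subseteq> (\<Union>j. C j) \<and> (\<forall>j. bounded (C j) \<and> diameter (C j) \<le> \<delta>)}.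
       \<Sum>j. ennreal (unit_ball_vol (real s) * (diameter (C j) / 2) ^ s))"

definition hausdorff_outer :: "nat \<Rightarrow> 'a :: metric_space set \<Rightarrow> ennreal" where
  "hausdorff_outer s A = (SUP \<delta> \<in> {0<..}. hausdorff_pre s \<delta> A)"

definition hausdorff_measure :: "nat \<Rightarrow> 'a :: metric_space measure" where
  "hausdorff_measure s = measure_of UNIV (sets borel) (hausdorff_outer s)"

definition surface :: "(real ^ 'n) set \<Rightarrow> (real ^ 'n) measure" where
  "surface S = restrict_space (hausdorff_measure (CARD('n) - 1)) S"

section \<open>Traces and boundary spaces\<close>

text \<open>
  \<open>has_trace U S u f\<close>: on the boundary part \<open>S\<close> of \<open>U\<close>, the function \<open>u \<in> H\<^sup>1(U)\<close> has the
  trace \<open>f \<in> L\<^sup>2(S)\<close>. This is the continuous extension of the restriction map from the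
  functions that are smooth up to the boundary, which are dense in \<open>H\<^sup>1(U)\<close> for bounded
  \<open>U\<close> with Lipschitz boundary.
\<close>

definition has_trace ::
  "(real ^ 'n) set \<Rightarrow> (real ^ 'n) set \<Rightarrow> (real ^ 'n \<Rightarrow> complex) \<Rightarrow> (real ^ 'n \<Rightarrow> complex) \<Rightarrow> bool" where
  "has_trace U S u f \<longleftrightarrow> u \<in> H1 U \<and> f \<in> L2 (surface S) \<and>
    (\<exists>\<phi> :: nat \<Rightarrow> real ^ 'n \<Rightarrow> complex. (\<forall>j. smooth (\<phi> j)) \<and>
       (\<lambda>j. H1_norm U (\<lambda>x. u x - \<phi> j x)) \<longlonglongrightarrow> 0 \<and>
       (\<lambda>j. L2_norm (surface S) (\<lambda>x. f x - \<phi> j x)) \<longlonglongrightarrow> 0)"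

text \<open>\<open>H\<^sup>1\<^sup>/\<^sup>2(\<partial>U)\<close> is the space of traces of \<open>H\<^sup>1(U)\<close> with the quotient norm.\<close>

definition H_half :: "(real ^ 'n) set \<Rightarrow> (real ^ 'n \<Rightarrow> complex) set" where
  "H_half U = {f. \<exists>v. has_trace U (frontier U) v f}"

definition H_half_norm :: "(real ^ 'n) set \<Rightarrow> (real ^ 'n \<Rightarrow> complex) \<Rightarrow> real" where
  "H_half_norm U f = Inf {H1_norm U v | v. has_trace U (frontier U) v f}"

text \<open>
  \<open>H\<^sup>-\<^sup>1\<^sup>/\<^sup>2(\<partial>U)\<close> is the dual space of \<open>H\<^sup>1\<^sup>/\<^sup>2(\<partial>U)\<close>; the value \<open>g f\<close> is the bilinear duality
  pairing of \<open>g\<close> and \<open>f\<close>. Boundedness makes \<open>g\<close> insensitive to changes of \<open>f\<close> on null sets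
  of the boundary and off the boundary.
\<close>

definition H_mhalf :: "(real ^ 'n) set \<Rightarrow> ((real ^ 'n \<Rightarrow> complex) \<Rightarrow> complex) set" where
  "H_mhalf U = {g.
     (\<forall>f \<in> H_half U. \<forall>h \<in> H_half U. g (\<lambda>x. f x + h x) = g f + g h) \<and>
     (\<forall>c. \<forall>f \<in> H_half U. g (\<lambda>x. c * f x) = c * g f) \<and>
     (\<exists>M. \<forall>f \<in> H_half U. cmod (g f) \<le> M * H_half_norm U f)}"

definition H_mhalf_norm :: "(real ^ 'n) set \<Rightarrow> ((real ^ 'n \<Rightarrow> complex) \<Rightarrow> complex) \<Rightarrow> real" where
  "H_mhalf_norm U g = Sup {cmod (g f) | f. f \<in> H_half U \<and> H_half_norm U f \<le> 1}"

definition H_mhalf0 :: "(real ^ 'n) set \<Rightarrow> ((real ^ 'n \<Rightarrow> complex) \<Rightarrow> complex) set" where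
  "H_mhalf0 U = {g \<in> H_mhalf U. g (\<lambda>x. 1) = 0}"

section \<open>The transmission problem\<close>

text \<open>
  An element of \<open>H\<^sup>1(U)\<close> is harmonic if it has a representative that is \<open>C\<^sup>2\<close> with vanishing
  Laplacian.
\<close>

definition harmonic :: "(real ^ 'n) set \<Rightarrow> (real ^ 'n \<Rightarrow> complex) \<Rightarrow> bool" where
  "harmonic U u \<longleftrightarrow> (\<exists>h. (AE x in lebesgue_on U. u x = h x) \<and> C_on 2 U h \<and>
     (\<forall>x \<in> U. (\<Sum>i\<in>UNIV. partial i (partial i h) x) = 0))"

text \<open>
  For \<open>u \<in> H\<^sup>1(U)\<close> harmonic in \<open>U\<close>, the normal derivative (outward from \<open>U\<close>) on a relatively
  open and closed part \<open>S\<close> of the boundary is the functional given by Green's formula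
  \<open>\<langle>\<partial>\<^sub>\<nu>u, f\<rangle> = \<integral>\<^sub>U \<nabla>u \<cdot> \<nabla>v\<close>, where \<open>v \<in> H\<^sup>1(U)\<close> has trace \<open>f\<close> on \<open>S\<close> and \<open>0\<close> on the rest of
  the boundary.
\<close>

definition has_normal_derivative ::
  "(real ^ 'n) set \<Rightarrow> (real ^ 'n) set \<Rightarrow> (real ^ 'n \<Rightarrow> complex)
    \<Rightarrow> ((real ^ 'n \<Rightarrow> complex) \<Rightarrow> complex) \<Rightarrow> bool" where
  "has_normal_derivative U S u g \<longleftrightarrow>
    (\<forall>f v. has_trace U (frontier U) v (\<lambda>x. if x \<in> S then f x else 0) \<longrightarrow>
       g f = (LINT x|lebesgue_on U. cdot (wgrad U u x) (wgrad U v x)))"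

definition conductivity ::
  "(real ^ 'n) set \<Rightarrow> (real ^ 'n) set \<Rightarrow> complex \<Rightarrow> real ^ 'n \<Rightarrow> complex" where
  "conductivity \<Omega> D k x = indicator (\<Omega> - D) x + k * indicator D x"

definition divergence_equation ::
  "(real ^ 'n) set \<Rightarrow> (real ^ 'n \<Rightarrow> complex) \<Rightarrow> (real ^ 'n \<Rightarrow> complex) \<Rightarrow> bool" where
  "divergence_equation \<Omega> \<gamma> u \<longleftrightarrow>
    (\<forall>\<phi>. test_fun \<Omega> \<phi> \<longrightarrow>
       (LINT x|lebesgue_on \<Omega>. \<gamma> x * cdot (wgrad \<Omega> u x) (\<chi> i. partial i \<phi> x)) = 0)"

text \<open>
  Transmission across \<open>\<partial>D\<close>. Both one-sided normal derivatives are taken with respect to the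
  normal pointing out of \<open>D\<close>, which points into \<open>\<Omega> - closure D\<close>; hence the sign in the exterior
  one.
\<close>

definition transmission ::
  "(real ^ 'n) set \<Rightarrow> (real ^ 'n) set \<Rightarrow> complex \<Rightarrow> (real ^ 'n \<Rightarrow> complex) \<Rightarrow> bool" where
  "transmission \<Omega> D k u \<longleftrightarrow>
    (\<exists>f. has_trace (\<Omega> - closure D) (frontier D) u f \<and> has_trace D (frontier D) u f) \<and>
    (\<exists>gp \<in> H_mhalf D. \<exists>gm \<in> H_mhalf D.
       has_normal_derivative (\<Omega> - closure D) (frontier D) u (\<lambda>f. - gp f) \<and>
       has_normal_derivative D (frontier D) u gm \<and>
       (\<forall>f \<in> H_half D. gp f = k * gm f))"

text \<open>
  For \<open>k = 0\<close> the divergence equation alone says nothing inside \<open>D\<close>; harmonicity in \<open>D\<close> and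
  the transmission conditions are what determines the solution.
\<close>

definition is_solution ::
  "(real ^ 'n) set \<Rightarrow> (real ^ 'n) set \<Rightarrow> complex \<Rightarrow> ((real ^ 'n \<Rightarrow> complex) \<Rightarrow> complex)
    \<Rightarrow> (real ^ 'n \<Rightarrow> complex) \<Rightarrow> bool" where
  "is_solution \<Omega> D k g u \<longleftrightarrow>
     u \<in> H1 \<Omega> \<and>
     divergence_equation \<Omega> (conductivity \<Omega> D k) u \<and>
     harmonic D u \<and> harmonic (\<Omega> - closure D) u \<and>
     transmission \<Omega> D k u \<and>
     has_normal_derivative (\<Omega> - closure D) (frontier \<Omega>) u g \<and>
     (\<exists>f. has_trace \<Omega> (frontier \<Omega>) u f \<and> (LINT x|surface (frontier \<Omega>). f x) = 0)"

definition Q_set :: "real \<Rightarrow> real \<Rightarrow> real \<Rightarrow> complex set" where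
  "Q_set a b \<epsilon> = {k. infdist k (complex_of_real ` {a..b}) > \<epsilon>}"

end

theory Submission
  imports Defs "HOL-Computational_Algebra.Polynomial"
begin

text \<open>
  Outside the annulus \<open>- b \<le> \<bar>k\<bar> \<le> - a\<close> the bound is assumed. Inside it, a point of \<open>Q\<^sub>\<epsilon>\<close> stays at a
  positive distance from the negative real axis, so testing the equation with the conjugate of
  \<open>u\<close> gives \<open>c \<parallel>\<nabla>u\<parallel>\<^sup>2 \<le> \<bar>\<integral>\<gamma>\<^sub>k \<bar>\<nabla>u\<bar>\<^sup>2\<bar> = \<bar>\<langle>g, u\<rangle>\<bar> \<le> \<parallel>g\<parallel> \<parallel>u\<parallel>\<close> with \<open>c\<close> independent of \<open>k\<close>. The Poincare
  inequality for functions with mean-zero trace then bounds \<open>\<parallel>u\<parallel>\<close> by \<open>\<parallel>\<nabla>u\<parallel>\<close>. The latter is proved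
  without compactness: double integrals of \<open>\<bar>\<phi> x - \<phi> y\<bar>\<^sup>2\<close>, also with \<open>x\<close> on the boundary, are
  bounded by integrating the gradient along segments inside the domain and chaining.
\<close>

section \<open>Smooth functions\<close>

text \<open>Well-posedness gives a constant for each single k, so the bound in the annulus must be
  explicit in k: with s and t the energies of u outside and inside D, it rests on s + t <= (1 + (1 +
  |k|) / delta) |s + k t|. The Poincare constant contains 1 / sigma, sigma being the surface measure
  of the boundary, for which only upper bounds are at hand. The inequality is therefore first proved
  multiplied by sigma^2, in a form that survives sigma = 0. That sigma > 0 follows at the very end:
  otherwise adding 1 to the solution for k = 1, g = 0 would give a second one. The bounds on double
  integrals are organised as a relation \<open>linked\<close> between measures, symmetric and
  transitive through any measure of positive mass. Local geometry, connectedness and finite covers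
  of compact sets then suffice; no compact embedding of function spaces enters. Weak gradients are
  arbitrary choices, so they are compared almost everywhere, by the fundamental lemma of the
  calculus of variations with explicit bump functions.\<close>

lemma C_on_SucD: "C_on (Suc m) U f \<Longrightarrow> C_on m U f"
proof (induction m arbitrary: f)
  case 0
  then obtain f' where "\<forall>x \<in> U. (f has_derivative f' x) (at x)" by auto
  then show ?case
    by (auto intro!: continuous_at_imp_continuous_on has_derivative_continuous)
next
  case (Suc m)
  then obtain f' where f': "\<forall>x \<in> U. (f has_derivative f' x) (at x)"
    "\<And>v. C_on (Suc m) U (\<lambda>x. f' x v)" by (auto simp del: C_on.simps simp: C_on.simps(2)[of "Suc m"])
  then show ?case using Suc.IH by (subst C_on.simps) blast
qed

lemma C_on_const: "C_on m U (\<lambda>x. c)"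
proof (induction m arbitrary: c)
  case (Suc m)
  then show ?case
    by (subst C_on.simps) (auto intro!: exI[of _ "\<lambda>x v. 0"])
qed simp

lemma C_on_add: "C_on m U f \<Longrightarrow> C_on m U g \<Longrightarrow> C_on m U (\<lambda>x. f x + g x)"
proof (induction m arbitrary: f g)
  case 0 then show ?case by (auto intro: continuous_intros)
next
  case (Suc m)
  then obtain f' g' where "\<forall>x \<in> U. (f has_derivative f' x) (at x)" "\<And>v. C_on m U (\<lambda>x. f' x v)"
    "\<forall>x \<in> U. (g has_derivative g' x) (at x)" "\<And>v. C_on m U (\<lambda>x. g' x v)" by auto
  then show ?case using Suc.IH
    by (subst C_on.simps) (auto intro!: exI[of _ "\<lambda>x v. f' x v + g' x v"] has_derivative_add)
qed

lemma C_on_mult: "C_on m U f \<Longrightarrow> C_on m U g \<Longrightarrow> C_on m U (\<lambda>x. f x * g x)"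
proof (induction m arbitrary: f g)
  case 0 then show ?case by (auto intro: continuous_intros)
next
  case (Suc m)
  \<comment> \<open>The product rule leaves the undifferentiated factors in the derivative, so their
    own regularity of order \<open>m\<close> is needed.\<close>
  have fg: "C_on m U f" "C_on m U g" using Suc.prems C_on_SucD by blast+
  obtain f' g' where "\<forall>x \<in> U. (f has_derivative f' x) (at x)" "\<And>v. C_on m U (\<lambda>x. f' x v)"
    "\<forall>x \<in> U. (g has_derivative g' x) (at x)" "\<And>v. C_on m U (\<lambda>x. g' x v)" using Suc.prems by auto
  then show ?case using Suc.IH fg
    by (subst C_on.simps)
       (intro exI[of _ "\<lambda>x v. f x * g' x v + f' x v * g x"] conjI allI ballI has_derivative_mult C_on_add;
        blast)
qed

lemma C_on_linear_compose:
  assumes "bounded_linear L" shows "C_on m U f \<Longrightarrow> C_on m U (\<lambda>x. L (f x))"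
proof (induction m arbitrary: f)
  case 0 then show ?case
    using bounded_linear.continuous_on[OF assms] by auto
next
  case (Suc m)
  then obtain f' where "\<forall>x \<in> U. (f has_derivative f' x) (at x)" "\<And>v. C_on m U (\<lambda>x. f' x v)" by auto
  then show ?case using Suc.IH
    by (subst C_on.simps)
       (intro exI[of _ "\<lambda>x v. L (f' x v)"] conjI allI ballI bounded_linear.has_derivative[OF assms]; blast)
qed

lemma C_on_linear:
  assumes "bounded_linear L" shows "C_on m U L"
proof (cases m)
  case 0 then show ?thesis using linear_continuous_on[OF assms] by simp
next
  case (Suc m)
  show ?thesis unfolding Suc
    using bounded_linear_imp_has_derivative[OF assms] C_on_const[of m U]
    by (subst C_on.simps) (auto intro!: exI[of _ "\<lambda>x. L"])
qed

lemma C_on_prod: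
  "finite I \<Longrightarrow> (\<And>i. i \<in> I \<Longrightarrow> C_on m U (f i)) \<Longrightarrow> C_on m U (\<lambda>x. \<Prod>i\<in>I. f i x)"
  by (induction I rule: finite_induct) (auto simp: C_on_const C_on_mult)

lemma C_on_sum:
  "finite I \<Longrightarrow> (\<And>i. i \<in> I \<Longrightarrow> C_on m U (f i)) \<Longrightarrow> C_on m U (\<lambda>x. \<Sum>i\<in>I. f i x)"
  by (induction I rule: finite_induct) (auto simp: C_on_const C_on_add)

text \<open>Polynomials in \<open>1 / x\<close> are allowed as factors so that the family is closed under differentiation.\<close>

definition flat :: "real poly \<Rightarrow> real \<Rightarrow> real" where
  "flat p x = (if x > 0 then poly p (1 / x) * exp (- 1 / x) else 0)"

text \<open>With y = 1 / x this is the decay of y^i / exp y at infinity, taken monomial by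
  monomial.\<close>

lemma flat_tendsto_0: "((\<lambda>x. poly p (1 / x) * exp (- 1 / x)) \<longlongrightarrow> 0) (at_right (0::real))"
proof -
  have "((\<lambda>y::real. \<Sum>i\<le>degree p. coeff p i * (y ^ i / exp y)) \<longlongrightarrow> (\<Sum>i\<le>degree p. coeff p i * 0)) at_top"
    by (intro tendsto_sum tendsto_mult tendsto_const tendsto_power_div_exp_0)
  then have "((\<lambda>y. poly p y * exp (- y)) \<longlongrightarrow> 0) at_top"
    by (simp add: poly_altdef sum_distrib_right exp_minus divide_inverse mult.assoc)
  from filterlim_compose[OF this filterlim_inverse_at_top_right]
  show ?thesis by (simp add: divide_inverse)
qed

text \<open>The chain rule produces the factor (1 / x)^2, which is \<open>[:0,0,1:]\<close>
  evaluated at 1 / x, and \<open>p - pderiv p\<close> collects the derivatives of the exponential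
  and of \<open>p\<close>. At 0 the division by h is absorbed into the polynomial
  \<open>[:0,1:] * p\<close>, so the difference quotient tends to 0 as well.\<close>

lemma flat_has_derivative:
  "(flat p has_field_derivative flat ([:0,0,1:] * (p - pderiv p)) x) (at x)"
proof -
  consider "x > 0" | "x < 0" | "x = 0" by linarith
  then show ?thesis
  proof cases
    case 1
    have "((\<lambda>x. poly p (1 / x) * exp (- 1 / x)) has_field_derivative
        flat ([:0,0,1:] * (p - pderiv p)) x) (at x)"
      using 1 by (auto intro!: derivative_eq_intros DERIV_chain2[OF poly_DERIV]
          simp: flat_def field_simps power2_eq_square)
    then show ?thesis
      by (rule has_field_derivative_transform_within[where d=x]) (use 1 in \<open>auto simp: flat_def dist_real_def\<close>)
  next
    case 2
    have "((\<lambda>x. 0) has_field_derivative 0) (at x)" by simp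
    then have "(flat p has_field_derivative 0) (at x)"
      by (rule has_field_derivative_transform_within[where d="-x"]) (use 2 in \<open>auto simp: flat_def dist_real_def\<close>)
    then show ?thesis using 2 by (simp add: flat_def)
  next
    case 3
    have "((\<lambda>h. flat p h / h) \<longlongrightarrow> 0) (at 0)"
    proof (rule filterlim_split_at)
      show "((\<lambda>h. flat p h / h) \<longlongrightarrow> 0) (at_left 0)"
        by (rule tendsto_eventually) (auto simp: eventually_at_filter flat_def)
      have "((\<lambda>x. poly ([:0,1:]*p) (1 / x) * exp (- 1 / x)) \<longlongrightarrow> 0) (at_right (0::real))"
        by (rule flat_tendsto_0)
      then show "((\<lambda>h. flat p h / h) \<longlongrightarrow> 0) (at_right 0)"
        by (rule Lim_transform_eventually) (auto simp: eventually_at_filter flat_def)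
    qed
    then show ?thesis using 3 by (simp add: DERIV_def flat_def)
  qed
qed

text \<open>The induction runs over all \<open>p\<close> at once because differentiation changes the
  polynomial. The real function \<open>r\<close> appears as a complex one since \<open>C_on\<close>
  speaks of complex functions only.\<close>

lemma C_on_flat:
  fixes r :: "real ^ 'n \<Rightarrow> real"
  shows "C_on m UNIV (\<lambda>x. complex_of_real (r x)) \<Longrightarrow> C_on m UNIV (\<lambda>x. complex_of_real (flat p (r x)))"
proof (induction m arbitrary: p)
  case 0
  have "continuous_on UNIV r"
    using continuous_on_Re[of UNIV "\<lambda>x. complex_of_real (r x)"] 0 by simp
  moreover have "continuous_on UNIV (flat p)"
    by (intro continuous_at_imp_continuous_on ballI DERIV_isCont) (rule flat_has_derivative)
  ultimately have "continuous_on UNIV (\<lambda>x. flat p (r x))"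
    by (metis continuous_on_compose2 subset_UNIV)
  then show ?case by (auto intro: continuous_intros)
next
  case (Suc m)
  let ?q = "[:0,0,1:] * (p - pderiv p)"
  obtain D where D: "\<And>x. ((\<lambda>x. complex_of_real (r x)) has_derivative D x) (at x)" "\<And>v. C_on m UNIV (\<lambda>x. D x v)"
    using Suc.prems by auto
  have rD: "(r has_derivative (\<lambda>v. Re (D x v))) (at x)" for x
    using bounded_linear.has_derivative[OF bounded_linear_Re D(1)[of x]] by simp
  \<comment> \<open>The derivative of a real-valued map is real, by uniqueness of the
    derivative.\<close>
  have DRe: "D x v = complex_of_real (Re (D x v))" for x v
    using has_derivative_unique[OF D(1)[of x] bounded_linear.has_derivative[OF bounded_linear_of_real rD[of x]]]
    by metis
  have m: "C_on m UNIV (\<lambda>x. complex_of_real (r x))" using Suc.prems by (rule C_on_SucD)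
  have "((\<lambda>x. complex_of_real (flat p (r x))) has_derivative (\<lambda>v. complex_of_real (flat ?q (r x)) * D x v)) (at x)" for x
  proof -
    have "((\<lambda>x. flat p (r x)) has_derivative (\<lambda>v. flat ?q (r x) * Re (D x v))) (at x)"
      using has_derivative_compose[OF rD flat_has_derivative[unfolded has_field_derivative_def]] by blast
    from bounded_linear.has_derivative[OF bounded_linear_of_real this]
    show ?thesis by (subst DRe) simp
  qed
  moreover have "C_on m UNIV (\<lambda>x. complex_of_real (flat ?q (r x)) * D x v)" for v
    by (intro C_on_mult Suc.IH m D)
  ultimately show ?case by (subst C_on.simps) (auto intro!: exI)
qed

section \<open>Closure properties of smooth functions and rules for partial derivatives\<close>

lemma smooth_const: "smooth (\<lambda>x. c)" by (simp add: smooth_def C_on_const)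
lemma smooth_add: "smooth f \<Longrightarrow> smooth g \<Longrightarrow> smooth (\<lambda>x. f x + g x)" by (simp add: smooth_def C_on_add)
lemma smooth_mult: "smooth f \<Longrightarrow> smooth g \<Longrightarrow> smooth (\<lambda>x. f x * g x)" by (simp add: smooth_def C_on_mult)
lemma smooth_prod: "finite I \<Longrightarrow> (\<And>i. i \<in> I \<Longrightarrow> smooth (f i)) \<Longrightarrow> smooth (\<lambda>x. \<Prod>i\<in>I. f i x)"
  by (simp add: smooth_def C_on_prod)
lemma smooth_sum: "finite I \<Longrightarrow> (\<And>i. i \<in> I \<Longrightarrow> smooth (f i)) \<Longrightarrow> smooth (\<lambda>x. \<Sum>i\<in>I. f i x)"
  by (simp add: smooth_def C_on_sum)
lemma smooth_cnj: "smooth f \<Longrightarrow> smooth (\<lambda>x. cnj (f x))"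
  by (simp add: smooth_def C_on_linear_compose bounded_linear_cnj)
lemma smooth_flat: "smooth (\<lambda>x. complex_of_real (r x)) \<Longrightarrow> smooth (\<lambda>x. complex_of_real (flat p (r x)))"
  by (simp add: smooth_def C_on_flat)
lemma smooth_diff: "smooth f \<Longrightarrow> smooth g \<Longrightarrow> smooth (\<lambda>x. f x - g x)"
  using smooth_add[of f "\<lambda>x. (-1) * g x"] smooth_mult[OF smooth_const, of g "-1"] by simp
lemma smooth_coord: "smooth (\<lambda>x :: real ^ 'n. complex_of_real (x $ i))"
  unfolding smooth_def
  by (intro allI C_on_linear bounded_linear_compose[OF bounded_linear_of_real]) (rule bounded_linear_vec_nth)

lemma smooth_has_derivative: "smooth f \<Longrightarrow> (f has_derivative frechet_derivative f (at x)) (at x)"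
proof -
  assume "smooth f"
  then have "C_on (Suc 0) UNIV f" unfolding smooth_def by blast
  then show ?thesis
    by (auto simp: frechet_derivative_works[symmetric] differentiable_def)
qed

lemma smooth_continuous: "smooth f \<Longrightarrow> continuous_on A f"
  unfolding smooth_def by (metis C_on.simps(1) continuous_on_subset subset_UNIV)

lemma smooth_frechet: "smooth f \<Longrightarrow> smooth (\<lambda>x. frechet_derivative f (at x) v)"
  unfolding smooth_def
proof
  fix m assume "\<forall>m. C_on m UNIV f"
  then have "C_on (Suc m) UNIV f" by blast
  then obtain f' where f': "\<And>x. (f has_derivative f' x) (at x)" "\<And>v. C_on m UNIV (\<lambda>x. f' x v)" by auto
  then have "f' x = frechet_derivative f (at x)" for x by (metis frechet_derivative_at)
  then show "C_on m UNIV (\<lambda>x. frechet_derivative f (at x) v)" using f' by simp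
qed

lemma smooth_partial: "smooth f \<Longrightarrow> smooth (partial i f)"
  using smooth_frechet[of f "axis i 1"] by (simp add: partial_def[abs_def])

lemma partial_unique: "(f has_derivative f') (at x) \<Longrightarrow> partial i f x = f' (axis i 1)"
  by (simp add: partial_def frechet_derivative_at[symmetric])

lemma partial_mult:
  assumes "smooth f" "smooth g"
  shows "partial i (\<lambda>x. f x * g x) x = partial i f x * g x + f x * partial i g x"
  using partial_unique[OF has_derivative_mult[OF smooth_has_derivative[OF assms(1), of x] smooth_has_derivative[OF assms(2)]]]
  by (simp add: partial_def)

lemma partial_add:
  assumes "smooth f" "smooth g"
  shows "partial i (\<lambda>x. f x + g x) x = partial i f x + partial i g x"
  using partial_unique[OF has_derivative_add[OF smooth_has_derivative[OF assms(1), of x] smooth_has_derivative[OF assms(2)]]]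
  by (simp add: partial_def)

lemma partial_cnj:
  assumes "smooth f"
  shows "partial i (\<lambda>x. cnj (f x)) x = cnj (partial i f x)"
  using partial_unique[OF bounded_linear.has_derivative[OF bounded_linear_cnj smooth_has_derivative[OF assms, of x]]]
  by (simp add: partial_def)

lemma partial_const: "partial i (\<lambda>x. c) x = 0"
  by (rule partial_unique[OF has_derivative_const])

section \<open>The complex gradient of a smooth function\<close>

definition grad :: "(real ^ 'n \<Rightarrow> complex) \<Rightarrow> real ^ 'n \<Rightarrow> complex ^ 'n" where
  "grad \<phi> x = (\<chi> i. partial i \<phi> x)"

lemma continuous_on_grad: "smooth \<phi> \<Longrightarrow> continuous_on A (grad \<phi>)"
  unfolding grad_def[abs_def]
  by (intro continuous_on_vec_lambda smooth_continuous smooth_partial)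

lemma frechet_eq_grad:
  assumes "smooth \<phi>"
  shows "frechet_derivative \<phi> (at x) v = (\<Sum>i\<in>UNIV. of_real (v $ i) * grad \<phi> x $ i)"
proof -
  have lin: "linear (frechet_derivative \<phi> (at x))"
    using smooth_has_derivative[OF assms] has_derivative_linear by blast
  have "v = (\<Sum>i\<in>UNIV. (v $ i) *\<^sub>R axis i 1)"
    using basis_expansion[of v] by (simp add: scalar_mult_eq_scaleR)
  then have "frechet_derivative \<phi> (at x) v = frechet_derivative \<phi> (at x) (\<Sum>i\<in>UNIV. (v $ i) *\<^sub>R axis i 1)" by simp
  also have "\<dots> = (\<Sum>i\<in>UNIV. of_real (v $ i) * grad \<phi> x $ i)"
    unfolding linear_sum[OF lin] linear_cmul[OF lin] grad_def partial_def vec_lambda_beta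
    by (rule sum.cong) (rule refl, rule scaleR_conv_of_real)
  finally show ?thesis .
qed

text \<open>Cauchy-Schwarz over the coordinates, applied to absolute values because \<open>v\<close>
  is real and the gradient complex.\<close>

lemma norm_frechet_le:
  assumes "smooth \<phi>"
  shows "norm (frechet_derivative \<phi> (at x) v) \<le> norm v * norm (grad \<phi> x)"
proof -
  have "norm (frechet_derivative \<phi> (at x) v) \<le> (\<Sum>i\<in>UNIV. \<bar>v $ i\<bar> * \<bar>norm (grad \<phi> x $ i)\<bar>)"
    unfolding frechet_eq_grad[OF assms] by (rule order_trans[OF norm_sum]) (simp add: norm_mult)
  also have "\<dots> \<le> L2_set (\<lambda>i. v $ i) UNIV * L2_set (\<lambda>i. norm (grad \<phi> x $ i)) UNIV"
    by (rule L2_set_mult_ineq)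
  also have "\<dots> = norm v * norm (grad \<phi> x)" by (simp add: norm_vec_def L2_set_def)
  finally show ?thesis .
qed

section \<open>Hausdorff measure of Lipschitz graphs\<close>

text \<open>For a unit vector \<open>e\<close> this is the orthogonal projection onto the hyperplane
  orthogonal to \<open>e\<close>, which \<open>lipschitz_boundary\<close> writes out.\<close>

definition horiz :: "'a::real_inner \<Rightarrow> 'a \<Rightarrow> 'a" where
  "horiz e x = x - (x \<bullet> e) *\<^sub>R e"

lemma horiz_orth: "norm e = 1 \<Longrightarrow> horiz e x \<bullet> e = 0"
  by (simp add: horiz_def inner_diff_left dot_square_norm)

lemma horiz_diff: "horiz e (x - y) = horiz e x - horiz e y"
  by (simp add: horiz_def inner_diff_left algebra_simps)

lemma horiz_add: "horiz e (x + y) = horiz e x + horiz e y"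
  by (simp add: horiz_def inner_add_left algebra_simps)

lemma horiz_scale: "horiz e (c *\<^sub>R x) = c *\<^sub>R horiz e x"
  by (simp add: horiz_def algebra_simps)

lemma horiz_self: "norm e = 1 \<Longrightarrow> horiz e e = 0"
  by (simp add: horiz_def dot_square_norm)

lemma norm_horiz_le: "norm e = 1 \<Longrightarrow> norm (horiz e x) \<le> norm x"
proof -
  assume e: "norm e = 1"
  have "(norm (horiz e x))\<^sup>2 = (norm x)\<^sup>2 - (x \<bullet> e)\<^sup>2"
    using e unfolding power2_norm_eq_inner power2_eq_square[of "x \<bullet> e"]
    by (simp add: horiz_def inner_diff_left inner_diff_right inner_commute norm_eq_1)
  then have "(norm (horiz e x))\<^sup>2 \<le> (norm x)\<^sup>2" by simp
  then show ?thesis by (rule power2_le_imp_le) simp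
qed

lemma norm_le_horiz: "norm e = 1 \<Longrightarrow> norm x \<le> norm (horiz e x) + \<bar>x \<bullet> e\<bar>"
proof -
  assume "norm e = 1"
  moreover have "x = horiz e x + (x \<bullet> e) *\<^sub>R e" by (simp add: horiz_def)
  ultimately show ?thesis
    using norm_triangle_ineq[of "horiz e x" "(x \<bullet> e) *\<^sub>R e"] by simp
qed

text \<open>The equation y . e = 0 can be solved for \<open>y $ i\<close> because
  \<open>e $ i\<close> is nonzero, and the entries of a unit vector are at most 1 in modulus. That
  only \<open>CARD('n) - 1\<close> coordinates remain is what gives graphs their dimension.\<close>

lemma orth_norm_le_coords:
  fixes e y :: "real ^ 'n"
  assumes e: "norm e = 1" "e $ i \<noteq> 0" and y: "y \<bullet> e = 0"
  shows "norm y \<le> (1 + 1 / \<bar>e $ i\<bar>) * (\<Sum>j\<in>UNIV - {i}. \<bar>y $ j\<bar>)"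
proof -
  let ?S = "\<Sum>j\<in>UNIV - {i}. \<bar>y $ j\<bar>"
  have "(\<Sum>j\<in>UNIV. y $ j * e $ j) = 0" using y by (simp add: inner_vec_def)
  then have "y $ i * e $ i = - (\<Sum>j\<in>UNIV - {i}. y $ j * e $ j)"
    by (simp add: sum.remove[of UNIV i])
  then have "\<bar>y $ i\<bar> * \<bar>e $ i\<bar> = \<bar>\<Sum>j\<in>UNIV - {i}. y $ j * e $ j\<bar>" by (metis abs_minus_cancel abs_mult)
  also have "\<dots> \<le> (\<Sum>j\<in>UNIV - {i}. \<bar>y $ j * e $ j\<bar>)" by (rule sum_abs)
  also have "\<dots> \<le> ?S"
  proof (rule sum_mono)
    fix j have "\<bar>e $ j\<bar> \<le> 1" using component_le_norm_cart[of e j] e by simp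
    then show "\<bar>y $ j * e $ j\<bar> \<le> \<bar>y $ j\<bar>" by (simp add: abs_mult mult_left_le)
  qed
  finally have "\<bar>y $ i\<bar> \<le> ?S / \<bar>e $ i\<bar>" using e by (simp add: pos_le_divide_eq)
  moreover have "norm y \<le> (\<Sum>j\<in>UNIV. \<bar>y $ j\<bar>)" by (rule norm_le_l1_cart)
  ultimately show ?thesis by (simp add: sum.remove[of UNIV i] algebra_simps)
qed

text \<open>The projection of a Lipschitz graph along \<open>e\<close> is inverted by a Lipschitz
  map, with constant \<open>1 + L\<close>.\<close>

lemma graph_dist_le:
  assumes e: "norm e = 1" and L: "L-lipschitz_on {y. y \<bullet> e = 0} \<psi>"
    and x: "x \<bullet> e = \<psi> (horiz e x)" and y: "y \<bullet> e = \<psi> (horiz e y)"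
  shows "norm (x - y) \<le> (1 + L) * norm (horiz e (x - y))"
proof -
  have "\<bar>(x - y) \<bullet> e\<bar> = dist (\<psi> (horiz e x)) (\<psi> (horiz e y))"
    by (simp add: inner_diff_left x[symmetric] y[symmetric] dist_real_def)
  also have "\<dots> \<le> L * dist (horiz e x) (horiz e y)"
    by (rule lipschitz_onD[OF L]) (simp_all add: horiz_orth e)
  finally show ?thesis using norm_le_horiz[OF e, of "x - y"]
    by (simp add: dist_norm horiz_diff algebra_simps)
qed

lemma sets_hausdorff [simp, measurable_cong]: "sets (hausdorff_measure s) = sets borel"
  unfolding hausdorff_measure_def
  by (metis sets.sigma_sets_eq sets_measure_of_conv space_borel top.extremum Pow_UNIV)

lemma space_hausdorff [simp]: "space (hausdorff_measure s) = UNIV"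
  by (metis sets_eq_imp_space_eq sets_hausdorff space_borel)

text \<open>
  \<^const>\<open>measure_of\<close> yields the zero measure if its argument is not countably additive, so without
  Caratheodory's theorem only upper bounds are available; positivity of the boundary measure is
  derived later from the uniqueness of solutions.
\<close>

lemma emeasure_hausdorff_le: "emeasure (hausdorff_measure s) A \<le> hausdorff_outer s A"
  unfolding hausdorff_measure_def by (simp add: emeasure_measure_of_conv)

text \<open>
  If \<open>e $ i \<noteq> 0\<close>, the coordinates other than \<open>i\<close> of the horizontal part control the distance of two
  graph points, so a grid in these \<open>n - 1\<close> coordinates provides the covering.
\<close>

lemma hausdorff_outer_graph:
  fixes e :: "real ^ 'n"
  assumes dim: "CARD('n) \<ge> 2" and e: "norm e = 1" and L: "L-lipschitz_on {y. y \<bullet> e = 0} \<psi>"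
  obtains K where "K \<ge> 0" "\<And>S x0 \<rho>. 0 < \<rho> \<Longrightarrow> S \<subseteq> cball x0 \<rho> \<Longrightarrow> (\<And>x. x \<in> S \<Longrightarrow> x \<bullet> e = \<psi> (horiz e x)) \<Longrightarrow>
    hausdorff_outer (CARD('n) - 1) S \<le> ennreal (K * \<rho> ^ (CARD('n) - 1))"
proof -
  define d where "d = CARD('n) - 1"
  have d: "d > 0" using dim by (simp add: d_def)
  have "e \<noteq> 0" using e by auto
  then obtain i where i: "e $ i \<noteq> 0" by (metis vec_eq_iff zero_index)
  have L0: "L \<ge> 0" using L lipschitz_on_nonneg by blast
  \<comment> \<open>The factor \<open>1 + L\<close> comes from \<open>graph_dist_le\<close>, the
    rest from \<open>orth_norm_le_coords\<close> with \<open>d\<close> coordinates that each differ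
    by at most one grid width.\<close>
  define \<kappa> where "\<kappa> = (1 + L) * ((1 + 1 / \<bar>e $ i\<bar>) * real d)"
  have \<kappa>: "\<kappa> \<ge> 0" unfolding \<kappa>_def using L0 by simp
  define \<omega> where "\<omega> = unit_ball_vol (real d)"
  have \<omega>: "\<omega> \<ge> 0" unfolding \<omega>_def by simp
  define K where "K = \<omega> * (3 * \<kappa> / 2) ^ d"
  have "hausdorff_outer d S \<le> ennreal (K * \<rho> ^ d)"
    if \<rho>: "0 < \<rho>" and S: "S \<subseteq> cball x0 \<rho>" and gr: "\<And>x. x \<in> S \<Longrightarrow> x \<bullet> e = \<psi> (horiz e x)" for S x0 \<rho>
    unfolding hausdorff_outer_def
  proof (rule SUP_least)
    fix \<delta> :: real assume "\<delta> \<in> {0<..}"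
    then have \<delta>: "\<delta> > 0" by simp
    \<comment> \<open>The grid has width \<rho> / N; N is taken so large that the cells have
      diameter at most \<delta>. Adding 1 excludes N = 0.\<close>
    obtain N0 :: nat where N0: "\<kappa> * \<rho> / \<delta> < real N0" using reals_Archimedean2 by blast
    define N where "N = N0 + 1"
    have N: "N \<ge> 1" "\<kappa> * \<rho> / real N \<le> \<delta>" 
    proof -
      have "\<kappa> * \<rho> \<le> \<delta> * real N" using N0 \<delta> by (simp add: N_def field_simps)
      then show "\<kappa> * \<rho> / real N \<le> \<delta>" by (simp add: N_def field_simps)
    qed (simp add: N_def)
    \<comment> \<open>The grid cell of \<open>x\<close>. Each of its \<open>d\<close> indices runs
      from -N to N inclusive, hence at most (2 N + 1)^d cells.\<close>
    define key where "key x = restrict (\<lambda>j. \<lfloor>horiz e (x - x0) $ j * real N / \<rho>\<rfloor>) (UNIV - {i})" for x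
    define I where "I = PiE (UNIV - {i}) (\<lambda>_. {- int N..int N})"
    have fin: "finite I" unfolding I_def by (rule finite_PiE) auto
    have cardI: "card I = (2 * N + 1) ^ d"
      by (simp add: I_def card_PiE d_def card_Diff_singleton)
         (simp add: nat_add_distrib nat_mult_distrib algebra_simps)
    have keyI: "key x \<in> I" if "x \<in> S" for x
      unfolding key_def I_def
    proof (rule restrict_PiE_iff[THEN iffD2], rule ballI)
      fix j assume "j \<in> UNIV - {i}"
      have "\<bar>horiz e (x - x0) $ j\<bar> \<le> \<rho>"
        using component_le_norm_cart[of "horiz e (x - x0)" j] norm_horiz_le[OF e, of "x - x0"] that S
        by (auto simp: dist_norm norm_minus_commute)
      then have "horiz e (x - x0) $ j * real N / \<rho> \<le> real N" "- real N \<le> horiz e (x - x0) $ j * real N / \<rho>"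
        using \<rho> mult_right_mono[of "horiz e (x - x0) $ j" \<rho> "real N"] mult_right_mono[of "- \<rho>" "horiz e (x - x0) $ j" "real N"]
        by (auto simp: field_simps abs_le_iff)
      then show "\<lfloor>horiz e (x - x0) $ j * real N / \<rho>\<rfloor> \<in> {- int N..int N}"
        by (simp add: le_floor_iff floor_le_iff)
    qed
    have close: "norm (x - y) \<le> \<kappa> * \<rho> / real N" if "x \<in> S" "y \<in> S" "key x = key y" for x y
    proof -
      have "\<bar>horiz e (x - y) $ j\<bar> \<le> \<rho> / real N" if "j \<in> UNIV - {i}" for j
      proof -
        have "\<lfloor>horiz e (x - x0) $ j * real N / \<rho>\<rfloor> = \<lfloor>horiz e (y - x0) $ j * real N / \<rho>\<rfloor>"
          using fun_cong[OF \<open>key x = key y\<close>, of j] that by (simp add: key_def)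
        then have "\<bar>horiz e (x - x0) $ j * real N / \<rho> - horiz e (y - x0) $ j * real N / \<rho>\<bar> \<le> 1"
          by linarith
        moreover have "horiz e (x - x0) $ j * real N / \<rho> - horiz e (y - x0) $ j * real N / \<rho> = horiz e (x - y) $ j * (real N / \<rho>)"
        proof -
          have "horiz e (x - y) $ j = horiz e (x - x0) $ j - horiz e (y - x0) $ j" by (simp add: horiz_diff)
          then show ?thesis by (simp add: left_diff_distrib diff_divide_distrib)
        qed
        ultimately have "\<bar>horiz e (x - y) $ j\<bar> * (real N / \<rho>) \<le> 1"
          using \<rho> by (simp add: abs_mult)
        then show ?thesis using \<rho> N by (simp add: field_simps)
      qed
      then have "(\<Sum>j\<in>UNIV - {i}. \<bar>horiz e (x - y) $ j\<bar>) \<le> (\<Sum>j\<in>UNIV - {i}. \<rho> / real N)"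
        by (rule sum_mono)
      also have "\<dots> = real d * \<rho> / real N" by (simp add: d_def card_Diff_singleton)
      finally have "norm (horiz e (x - y)) \<le> (1 + 1 / \<bar>e $ i\<bar>) * (real d * \<rho> / real N)"
        using orth_norm_le_coords[OF e i horiz_orth[OF e], of "x - y"]
          mult_left_mono[of _ "real d * \<rho> / real N" "1 + 1 / \<bar>e $ i\<bar>"] by fastforce
      then have "norm (x - y) \<le> (1 + L) * ((1 + 1 / \<bar>e $ i\<bar>) * (real d * \<rho> / real N))"
        using graph_dist_le[OF e L gr gr, OF that(1,2)] L0
          mult_left_mono[of "norm (horiz e (x - y))" _ "1 + L"] by fastforce
      then show ?thesis by (simp add: \<kappa>_def mult.assoc)
    qed
    obtain en where en: "bij_betw en {0..<card I} I" using ex_bij_betw_nat_finite[OF fin] by blast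
    \<comment> \<open>The cells are numbered and the sequence is continued by empty sets, as
      \<open>hausdorff_pre\<close> wants a countable cover.\<close>
    define C where "C j = (if j < card I then {x \<in> S. key x = en j} else {})" for j
    have diam: "diameter (C j) \<le> \<kappa> * \<rho> / real N" for j
      by (rule diameter_le) (use \<kappa> \<rho> close in \<open>auto simp: C_def split: if_splits\<close>)
    have bd: "bounded (C j)" for j
      by (rule bounded_subset[OF bounded_cball[of x0 \<rho>]]) (use S in \<open>auto simp: C_def\<close>)
    have "hausdorff_pre d \<delta> S \<le> (\<Sum>j. ennreal (unit_ball_vol (real d) * (diameter (C j) / 2) ^ d))"
      unfolding hausdorff_pre_def
    proof (rule INF_lower)
      have "S \<subseteq> (\<Union>j. C j)"
      proof
        fix x assume x: "x \<in> S"
        then obtain j where "j < card I" "en j = key x"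
          using keyI en by (metis atLeastLessThan_iff bij_betw_iff_bijections)
        then show "x \<in> (\<Union>j. C j)" using x by (auto simp: C_def)
      qed
      then show "C \<in> {C. S \<subseteq> \<Union> (range C) \<and> (\<forall>j. bounded (C j) \<and> diameter (C j) \<le> \<delta>)}"
        using bd diam N(2) by (auto intro: order_trans)
    qed
    \<comment> \<open>The empty sets have diameter 0 and contribute \<open>0 ^ d\<close>, which
      vanishes because \<open>d > 0\<close>.\<close>
    also have "\<dots> = (\<Sum>j<card I. ennreal (\<omega> * (diameter (C j) / 2) ^ d))"
      unfolding \<omega>_def by (rule suminf_finite) (use d in \<open>auto simp: C_def\<close>)
    also have "\<dots> \<le> (\<Sum>j<card I. ennreal (\<omega> * (\<kappa> * \<rho> / real N / 2) ^ d))"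
      by (intro sum_mono ennreal_leI mult_left_mono power_mono \<omega> divide_right_mono diam)
         (use bd diameter_ge_0 in auto)
    also have "\<dots> = ennreal (real (card I) * (\<omega> * (\<kappa> * \<rho> / real N / 2) ^ d))"
      by (simp add: ennreal_mult'' ennreal_of_nat_eq_real_of_nat \<omega> \<kappa> \<rho> less_imp_le)
    also have "\<dots> \<le> ennreal (K * \<rho> ^ d)"
    proof (rule ennreal_leI)
      have "real (card I) = (2 * real N + 1) ^ d" by (simp add: cardI add.commute)
      \<comment> \<open>After this rounding the powers of N cancel, so the bound does not depend on
        \<delta>.\<close>
      also have "\<dots> \<le> (3 * real N) ^ d" using N by (intro power_mono) auto
      finally have "real (card I) * (\<omega> * (\<kappa> * \<rho> / real N / 2) ^ d) \<le> (3 * real N) ^ d * (\<omega> * (\<kappa> * \<rho> / real N / 2) ^ d)"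
        by (rule mult_right_mono) (use \<omega> \<kappa> \<rho> in auto)
      also have "\<dots> = K * \<rho> ^ d"
        using N by (simp add: K_def power_mult_distrib power_divide)
      finally show "real (card I) * (\<omega> * (\<kappa> * \<rho> / real N / 2) ^ d) \<le> K * \<rho> ^ d" .
    qed
    finally show "hausdorff_pre d \<delta> S \<le> ennreal (K * \<rho> ^ d)" .
  qed
  moreover have "K \<ge> 0" unfolding K_def using \<omega> \<kappa> by simp
  ultimately show thesis using that unfolding d_def by blast
qed

text \<open>A limit of points above the graph lies on or above it. A frontier point of an open set
  is outside the set, hence not strictly above.\<close>

lemma frontier_on_graph:
  fixes U :: "(real ^ 'n) set"
  assumes "open U" and e: "norm e = 1" and L: "L-lipschitz_on {y. y \<bullet> e = 0} \<psi>"
    and U: "U \<inter> ball p r = {x \<in> ball p r. \<psi> (horiz e x) < x \<bullet> e}"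
    and x: "x \<in> ball p r"
  shows closure_above_graph: "x \<in> closure U \<Longrightarrow> \<psi> (horiz e x) \<le> x \<bullet> e"
    and "x \<in> frontier U \<Longrightarrow> x \<bullet> e = \<psi> (horiz e x)"
proof -
  show *: "\<psi> (horiz e x) \<le> x \<bullet> e" if cl: "x \<in> closure U"
  proof -
    have cont: "continuous_on UNIV (\<lambda>x. \<psi> (horiz e x))"
      by (rule continuous_on_compose2[OF lipschitz_on_continuous_on[OF L]])
         (auto simp: horiz_orth e horiz_def intro!: continuous_intros simp: inner_diff_left dot_square_norm)
    have "x \<in> closure (U \<inter> ball p r)"
      using cl x open_Int_closure_subset[OF open_ball, of p r U] by (auto simp: Int_commute)
    moreover have "U \<inter> ball p r \<subseteq> {x. \<psi> (horiz e x) \<le> x \<bullet> e}" unfolding U by auto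
    moreover have "closed {x. \<psi> (horiz e x) \<le> x \<bullet> e}"
      by (intro closed_Collect_le cont continuous_intros)
    ultimately show ?thesis using closure_minimal by blast
  qed
  assume "x \<in> frontier U"
  then have "x \<in> closure U" "x \<notin> U" using \<open>open U\<close> by (auto simp: frontier_def interior_open)
  then show "x \<bullet> e = \<psi> (horiz e x)" using * U x by fastforce
qed

text \<open>Everything that is used about a chart, with the graph function itself hidden. The second
  inclusion holds because a segment from a closure point near \<open>p\<close> to the ball about
  \<open>p + t e\<close> is steep: its direction lies in the cone of slope \<open>L\<close> about
  \<open>e\<close>.\<close>

lemma lipschitz_boundary_chart:
  fixes U :: "(real ^ 'n) set"
  assumes dim: "CARD('n) \<ge> 2" and op: "open U" and lip: "lipschitz_boundary U" and p: "p \<in> frontier U"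
  obtains e t \<rho> K where "norm e = 1" "0 < t" "0 < \<rho>" "0 \<le> K"
    "\<And>x s. x \<in> closure U \<inter> ball p t \<Longrightarrow> 0 < s \<Longrightarrow> s \<le> t \<Longrightarrow> x + s *\<^sub>R e \<in> U"
    "\<And>x y s. x \<in> closure U \<inter> ball p \<rho> \<Longrightarrow> y \<in> ball (p + t *\<^sub>R e) \<rho> \<Longrightarrow> 0 < s \<Longrightarrow> s \<le> 1 \<Longrightarrow> x + s *\<^sub>R (y - x) \<in> U"
    "\<And>x y. x \<in> frontier U \<inter> ball p t \<Longrightarrow> y \<in> frontier U \<inter> ball p t \<Longrightarrow> norm (x - y) \<le> K * norm (horiz e (x - y))"
    "\<And>x0 h. 0 < h \<Longrightarrow> hausdorff_outer (CARD('n) - 1) (frontier U \<inter> ball p t \<inter> cball x0 h) \<le> ennreal (K * h ^ (CARD('n) - 1))"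
proof -
  obtain e r L \<psi> where e: "norm e = 1" and r: "0 < r" and L: "L-lipschitz_on {y. y \<bullet> e = 0} \<psi>"
    and U: "U \<inter> ball p r = {x \<in> ball p r. \<psi> (horiz e x) < x \<bullet> e}"
    using lip p unfolding lipschitz_boundary_def horiz_def by blast
  have L0: "L \<ge> 0" using L lipschitz_on_nonneg by blast
  \<comment> \<open>Half the radius, so that points of \<open>ball p t\<close> moved by at most
    \<open>t\<close> stay inside the chart.\<close>
  define t where "t = r / 2"
  have t: "0 < t" "2 * t = r" using r by (auto simp: t_def)
  \<comment> \<open>A direction within 2 \<rho> of \<open>t e\<close> has vertical part above t - 2
    \<rho> and horizontal part at most 2 \<rho>, so steepness requires 2 \<rho> (1 + L) < t. This
    choice makes 2 \<rho> (2 + L) = t.\<close>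
  define \<rho> where "\<rho> = t / (2 + L) / 2"
  have \<rho>: "0 < \<rho>" using t L0 by (simp add: \<rho>_def)
  have "2 * (y / 2) = y" for y :: real by simp
  then have "2 * \<rho> = t / (2 + L)" unfolding \<rho>_def .
  moreover have "2 + L \<noteq> 0" using L0 by linarith
  ultimately have \<rho>2: "2 * \<rho> * (2 + L) = t" by simp
  then have \<rho>3: "2 * \<rho> * (1 + L) < t" "\<rho> < t" using \<rho> L0 t by (auto simp: algebra_simps add_pos_nonneg)
  have lipd: "\<psi> (horiz e (x + w)) \<le> \<psi> (horiz e x) + L * norm (horiz e w)" for x w
  proof -
    have "dist (\<psi> (horiz e (x + w))) (\<psi> (horiz e x)) \<le> L * dist (horiz e (x + w)) (horiz e x)"
      by (rule lipschitz_onD[OF L]) (simp_all add: horiz_orth e)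
    then show ?thesis by (simp add: dist_real_def dist_norm horiz_add)
  qed
  obtain K where K: "K \<ge> 0" "\<And>S x0 \<rho>. 0 < \<rho> \<Longrightarrow> S \<subseteq> cball x0 \<rho> \<Longrightarrow> (\<And>x. x \<in> S \<Longrightarrow> x \<bullet> e = \<psi> (horiz e x)) \<Longrightarrow>
    hausdorff_outer (CARD('n) - 1) S \<le> ennreal (K * \<rho> ^ (CARD('n) - 1))"
    using hausdorff_outer_graph[OF dim e L] by metis
  show thesis
  proof (rule that[OF e t(1) \<rho>, of "K + (1 + L)"])
    fix x s assume x: "x \<in> closure U \<inter> ball p t" and s: "0 < s" "s \<le> t"
    have "dist p (x + s *\<^sub>R e) \<le> dist p x + norm (s *\<^sub>R e)"
      by (metis dist_norm add.commute diff_diff_eq norm_triangle_ineq4)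
    then have "x + s *\<^sub>R e \<in> ball p r" using x s e t by simp
    moreover have "\<psi> (horiz e x) \<le> x \<bullet> e"
      by (rule closure_above_graph[OF op e L U]) (use x t in auto)
    then have "\<psi> (horiz e (x + s *\<^sub>R e)) < (x + s *\<^sub>R e) \<bullet> e"
      using s e by (simp add: horiz_add horiz_scale horiz_self inner_add_left dot_square_norm)
    ultimately show "x + s *\<^sub>R e \<in> U" using U by blast
  next
    fix x y s assume x: "x \<in> closure U \<inter> ball p \<rho>" and y: "y \<in> ball (p + t *\<^sub>R e) \<rho>" and s: "0 < s" "s \<le> (1::real)"
    have xr: "x \<in> ball p r" using x \<rho>3 t by simp
    have "dist p y \<le> dist p (p + t *\<^sub>R e) + dist (p + t *\<^sub>R e) y" by (rule dist_triangle)
    also have "\<dots> < t + \<rho>" using y e t by (simp add: dist_norm)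
    finally have yr: "y \<in> ball p r" using \<rho>3 t by simp
    have "(1 - s) *\<^sub>R x + s *\<^sub>R y \<in> ball p r"
      by (rule convexD[OF convex_ball xr yr]) (use s in auto)
    then have zr: "x + s *\<^sub>R (y - x) \<in> ball p r" by (simp add: algebra_simps)
    \<comment> \<open>The deviation of the segment from the vertical vector
      \<open>t e\<close>.\<close>
    define w where "w = y - x - t *\<^sub>R e"
    have "norm w = norm ((y - (p + t *\<^sub>R e)) - (x - p))" by (simp add: w_def algebra_simps)
    also have "\<dots> \<le> norm (y - (p + t *\<^sub>R e)) + norm (x - p)" by (rule norm_triangle_ineq4)
    also have "\<dots> < 2 * \<rho>" using x y by (simp add: dist_norm norm_minus_commute)
    finally have w: "norm w < 2 * \<rho>" .
    have yx: "y - x = t *\<^sub>R e + w" by (simp add: w_def)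
    have "\<bar>w \<bullet> e\<bar> \<le> norm w" using Cauchy_Schwarz_ineq2[of w e] e by simp
    then have 1: "(y - x) \<bullet> e > t - 2 * \<rho>"
      using w e by (simp add: yx inner_add_left dot_square_norm)
    have "norm (horiz e (y - x)) \<le> 2 * \<rho>"
      using norm_horiz_le[OF e, of w] w e by (simp add: yx horiz_add horiz_scale horiz_self)
    then have "L * norm (horiz e (y - x)) \<le> L * (2 * \<rho>)" using L0 by (rule mult_left_mono)
    then have "L * norm (horiz e (y - x)) < (y - x) \<bullet> e" using 1 \<rho>3(1) by (simp add: algebra_simps)
    then have 2: "L * norm (horiz e (s *\<^sub>R (y - x))) < (s *\<^sub>R (y - x)) \<bullet> e"
      using s by (simp add: horiz_scale)
    have "\<psi> (horiz e x) \<le> x \<bullet> e"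
      by (rule closure_above_graph[OF op e L U xr]) (use x in auto)
    then have "\<psi> (horiz e (x + s *\<^sub>R (y - x))) < (x + s *\<^sub>R (y - x)) \<bullet> e"
      using 2 lipd[of x "s *\<^sub>R (y - x)"] by (simp add: inner_add_left)
    then show "x + s *\<^sub>R (y - x) \<in> U" using U zr by blast
  next
    fix x y assume x: "x \<in> frontier U \<inter> ball p t" and y: "y \<in> frontier U \<inter> ball p t"
    have "norm (x - y) \<le> (1 + L) * norm (horiz e (x - y))"
      by (rule graph_dist_le[OF e L]; rule frontier_on_graph(2)[OF op e L U]) (use x y t in auto)
    also have "\<dots> \<le> (K + (1 + L)) * norm (horiz e (x - y))" using K by (intro mult_right_mono) auto
    finally show "norm (x - y) \<le> (K + (1 + L)) * norm (horiz e (x - y))" .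
  next
    fix x0 and h :: real assume h: "0 < h"
    have "hausdorff_outer (CARD('n) - 1) (frontier U \<inter> ball p t \<inter> cball x0 h) \<le> ennreal (K * h ^ (CARD('n) - 1))"
      by (rule K(2)[OF h]) (use t in \<open>auto intro!: frontier_on_graph(2)[OF op e L U]\<close>)
    also have "\<dots> \<le> ennreal ((K + (1 + L)) * h ^ (CARD('n) - 1))"
      using h L0 by (intro ennreal_leI mult_right_mono) auto
    finally show "hausdorff_outer (CARD('n) - 1) (frontier U \<inter> ball p t \<inter> cball x0 h) \<le> ennreal ((K + (1 + L)) * h ^ (CARD('n) - 1))" .
  qed (use K L0 in auto)
qed

section \<open>The Poincare inequality up to the boundary\<close>

text \<open>
  The integrand is at most the limit inferior of its averages over small balls; Fatou's lemma and
  Fubini's theorem then only require a bound on the mass of preimages of balls.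
\<close>

lemma nn_integral_regular_le:
  fixes T :: "'m \<Rightarrow> 'a::euclidean_space"
  assumes sf: "sigma_finite_measure M" and T [measurable]: "T \<in> borel_measurable M"
    and U: "open U" and g: "continuous_on UNIV g" "\<And>x. 0 \<le> g x"
    and h0: "0 < h0" and K: "0 \<le> K"
    and reg: "\<And>z h. 0 < h \<Longrightarrow> h < h0 \<Longrightarrow> emeasure M {m \<in> space M. dist (T m) z < h} \<le> ennreal (K * h ^ DIM('a))"
  shows "(\<integral>\<^sup>+m. indicator U (T m) * ennreal (g (T m)) \<partial>M)
    \<le> ennreal (K / unit_ball_vol (DIM('a))) * (\<integral>\<^sup>+x. indicator U x * ennreal (g x) \<partial>lborel)"
proof -
  interpret M: sigma_finite_measure M by fact
  interpret pair_sigma_finite M lborel ..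
  define G where "G x = indicator U x * ennreal (g x)" for x
  have [measurable]: "g \<in> borel_measurable borel" using g by (simp add: borel_measurable_continuous_onI)
  have [measurable]: "U \<in> sets borel" using U by simp
  have [measurable]: "G \<in> borel_measurable borel" unfolding G_def by measurable
  define hh where "hh k = h0 / (real k + 2)" for k :: nat
  have hh: "0 < hh k" "hh k < h0" for k using h0 by (auto simp: hh_def field_simps intro: add_pos_nonneg)
  have hh0: "hh \<longlonglongrightarrow> 0" unfolding hh_def by real_asymp
  define \<omega> where "\<omega> = unit_ball_vol (real DIM('a))"
  have \<omega>: "\<omega> > 0" unfolding \<omega>_def by simp
  define V where "V k = \<omega> * hh k ^ DIM('a)" for k
  have V: "V k > 0" for k using hh(1)[of k] \<omega> by (simp add: V_def)
  \<comment> \<open>The mean of \<open>G\<close> over the ball of radius \<open>hh k\<close> about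
    \<open>x\<close>, written with a condition symmetric in both points so that the integrations can
    be exchanged.\<close>
  define A where "A k x = ennreal (1 / V k) * (\<integral>\<^sup>+z. (if dist x z < hh k then G z else 0) \<partial>lborel)" for k x
  have [measurable]: "A k \<in> borel_measurable borel" for k unfolding A_def by measurable
  \<comment> \<open>Openness of \<open>U\<close> and continuity of \<open>g\<close> make
    \<open>G\<close> lower semicontinuous, which is enough for this one-sided bound.\<close>
  have liminf: "G x \<le> liminf (\<lambda>k. A k x)" for x
  proof (cases "x \<in> U")
    case True
    show ?thesis unfolding le_Liminf_iff
    proof safe
      fix y assume "y < G x"
      then have "y < ennreal (g x)" using True by (simp add: G_def)
      then obtain c' where c': "y < c'" "c' < ennreal (g x)" using dense by blast
      then obtain c where c: "c' = ennreal c" "0 \<le> c" by (cases c') auto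
      then have cg: "c < g x" using c' g(2)[of x] by (simp add: ennreal_less_iff)
      have "open (U \<inter> {x. c < g x})"
        by (intro open_Int U open_Collect_less g continuous_intros)
      then obtain r where r: "r > 0" "ball x r \<subseteq> U \<inter> {x. c < g x}"
        using True cg openE[of "U \<inter> {x. c < g x}" x] by auto
      have "eventually (\<lambda>k. hh k < r) sequentially"
        using order_tendstoD(2)[OF hh0 r(1)] .
      then show "eventually (\<lambda>k. y < A k x) sequentially"
      proof eventually_elim
        case (elim k)
        have "c' = ennreal (1 / V k) * (ennreal c * emeasure lborel (ball x (hh k)))"
          using V[of k] c hh(1)[of k] \<omega>[THEN less_imp_neq]
          by (simp add: emeasure_ball ennreal_mult[symmetric] V_def \<omega>_def less_imp_le)
        also have "\<dots> = ennreal (1 / V k) * (\<integral>\<^sup>+z. ennreal c * indicator (ball x (hh k)) z \<partial>lborel)"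
          by (subst nn_integral_cmult_indicator) auto
        also have "\<dots> \<le> A k x" unfolding A_def
        proof (intro mult_left_mono nn_integral_mono)
          fix z
          show "ennreal c * indicator (ball x (hh k)) z \<le> (if dist x z < hh k then G z else 0)"
          proof (cases "dist x z < hh k")
            case True
            then have "z \<in> ball x r" using elim by simp
            then have "z \<in> U" "c < g z" using r by auto
            then show ?thesis using True by (simp add: G_def ennreal_leI)
          qed simp
        qed simp
        finally show ?case using c' by simp
      qed
    qed
  qed (simp add: G_def)
  have "(\<integral>\<^sup>+m. G (T m) \<partial>M) \<le> (\<integral>\<^sup>+m. liminf (\<lambda>k. A k (T m)) \<partial>M)"
    by (intro nn_integral_mono liminf)
  also have "\<dots> \<le> liminf (\<lambda>k. \<integral>\<^sup>+m. A k (T m) \<partial>M)"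
    by (rule nn_integral_liminf) measurable
  also have "\<dots> \<le> liminf (\<lambda>k. ennreal (K / \<omega>) * (\<integral>\<^sup>+x. G x \<partial>lborel))"
  proof (intro Liminf_mono always_eventually allI)
    fix k
    have "(\<integral>\<^sup>+m. A k (T m) \<partial>M) = ennreal (1 / V k) * (\<integral>\<^sup>+m. \<integral>\<^sup>+z. (if dist (T m) z < hh k then G z else 0) \<partial>lborel \<partial>M)"
      unfolding A_def by (rule nn_integral_cmult) measurable
    also have "(\<integral>\<^sup>+m. \<integral>\<^sup>+z. (if dist (T m) z < hh k then G z else 0) \<partial>lborel \<partial>M) =
        (\<integral>\<^sup>+z. \<integral>\<^sup>+m. (if dist (T m) z < hh k then G z else 0) \<partial>M \<partial>lborel)"
      by (rule Fubini'[symmetric]) measurable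
    also have "\<dots> = (\<integral>\<^sup>+z. G z * emeasure M {m \<in> space M. dist (T m) z < hh k} \<partial>lborel)"
    proof (intro nn_integral_cong)
      fix z
      have "(\<integral>\<^sup>+m. (if dist (T m) z < hh k then G z else 0) \<partial>M) =
          (\<integral>\<^sup>+m. G z * indicator {m \<in> space M. dist (T m) z < hh k} m \<partial>M)"
        by (intro nn_integral_cong) auto
      then show "(\<integral>\<^sup>+m. (if dist (T m) z < hh k then G z else 0) \<partial>M) = G z * emeasure M {m \<in> space M. dist (T m) z < hh k}"
        by (simp add: nn_integral_cmult_indicator)
    qed
    also have "\<dots> \<le> (\<integral>\<^sup>+z. G z * ennreal (K * hh k ^ DIM('a)) \<partial>lborel)"
      by (intro nn_integral_mono mult_left_mono reg hh) auto
    also have "\<dots> = ennreal (K * hh k ^ DIM('a)) * (\<integral>\<^sup>+z. G z \<partial>lborel)"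
      by (subst nn_integral_multc) (auto simp: mult.commute)
    finally have "(\<integral>\<^sup>+m. A k (T m) \<partial>M) \<le> ennreal (1 / V k) * (ennreal (K * hh k ^ DIM('a)) * (\<integral>\<^sup>+z. G z \<partial>lborel))"
      by (simp add: mult_left_mono)
    also have "\<dots> = ennreal (1 / V k * (K * hh k ^ DIM('a))) * (\<integral>\<^sup>+z. G z \<partial>lborel)"
      by (subst ennreal_mult'[of "1 / V k"]) (simp_all only: mult.assoc, use V[of k] in simp)
    \<comment> \<open>The mass bound and the volume of the ball carry the same power of
      \<open>hh k\<close>, so the radius drops out.\<close>
    also have "1 / V k * (K * hh k ^ DIM('a)) = K / \<omega>" using hh(1)[of k] \<omega> by (simp add: V_def)
    finally show "(\<integral>\<^sup>+m. A k (T m) \<partial>M) \<le> ennreal (K / \<omega>) * (\<integral>\<^sup>+x. G x \<partial>lborel)" .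
  qed
  finally show ?thesis by (simp add: G_def \<omega>_def Liminf_const)
qed

abbreviation energy :: "(real ^ 'n) set \<Rightarrow> (real ^ 'n \<Rightarrow> complex) \<Rightarrow> ennreal" where
  "energy U \<phi> \<equiv> (\<integral>\<^sup>+x. indicator U x * ennreal ((norm (grad \<phi> x))\<^sup>2) \<partial>lborel)"

text \<open>Half-open because a segment may start at a boundary point, which does not belong to the
  open set.\<close>

abbreviation unit_interval :: "real measure" where
  "unit_interval \<equiv> restrict_space lborel {0<..1}"

text \<open>The fundamental theorem of calculus along the segment, then Cauchy-Schwarz on an
  interval of mass 1.\<close>

lemma diff_le_segment:
  assumes \<phi>: "smooth \<phi>"
  shows "ennreal ((cmod (\<phi> y - \<phi> x))\<^sup>2) \<le>
    ennreal ((norm (y - x))\<^sup>2) * (\<integral>\<^sup>+s. ennreal ((norm (grad \<phi> (x + s *\<^sub>R (y - x))))\<^sup>2) \<partial>unit_interval)"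
proof -
  define g where "g s = norm (grad \<phi> (x + s *\<^sub>R (y - x)))" for s
  have gc: "continuous_on A g" for A unfolding g_def
    by (intro continuous_on_norm continuous_on_compose2[OF continuous_on_grad[OF \<phi>, of UNIV]] continuous_intros) auto
  then have [measurable]: "g \<in> borel_measurable borel" by (rule borel_measurable_continuous_onI)
  define I where "I = integral {0..1} g"
  have gI: "(g has_integral I) {0..1}" unfolding I_def
    using integrable_integral[OF integrable_continuous_real[OF gc]] .
  have "((\<lambda>s. frechet_derivative \<phi> (at (x + s *\<^sub>R (y - x))) (y - x)) has_integral (\<phi> (x + 1 *\<^sub>R (y - x)) - \<phi> (x + 0 *\<^sub>R (y - x)))) {0..1}"
  proof (rule fundamental_theorem_of_calculus)
    fix s :: real
    have "((\<lambda>s. \<phi> (x + s *\<^sub>R (y - x))) has_derivative (\<lambda>h. frechet_derivative \<phi> (at (x + s *\<^sub>R (y - x))) (h *\<^sub>R (y - x)))) (at s within {0..1})"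
      by (rule has_derivative_compose[OF _ smooth_has_derivative[OF \<phi>], unfolded o_def]) (auto intro!: derivative_eq_intros)
    then show "((\<lambda>s. \<phi> (x + s *\<^sub>R (y - x))) has_vector_derivative frechet_derivative \<phi> (at (x + s *\<^sub>R (y - x))) (y - x)) (at s within {0..1})"
      unfolding has_vector_derivative_def
      using linear_cmul[OF has_derivative_linear[OF smooth_has_derivative[OF \<phi>]]] by simp
  qed simp
  then have "norm (\<phi> y - \<phi> x) \<le> norm (y - x) * I"
    using has_integral_norm_bound_integral_component
    by (smt (verit, best) has_integral_mult_right[OF gI, of "norm (y - x)"] add_diff_cancel_left'
        integral_norm_bound_integral integral_unique has_integral_integrable g_def norm_frechet_le[OF \<phi>]
        scaleR_one scaleR_zero_left add_0_right diff_add_cancel add.commute)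
  then have "(norm (\<phi> y - \<phi> x))\<^sup>2 \<le> (norm (y - x))\<^sup>2 * I\<^sup>2"
    by (metis norm_ge_zero power_mono power_mult_distrib)
  then have "ennreal ((norm (\<phi> y - \<phi> x))\<^sup>2) \<le> ennreal ((norm (y - x))\<^sup>2) * ennreal (I\<^sup>2)"
    by (metis ennreal_leI ennreal_mult' zero_le_power2)
  also have "ennreal (I\<^sup>2) \<le> (\<integral>\<^sup>+s. ennreal ((g s)\<^sup>2) \<partial>unit_interval)"
  proof -
    have I0: "I \<ge> 0" using has_integral_nonneg[OF gI] by (simp add: g_def)
    have "(\<integral>\<^sup>+s. indicator {0..1} s * g s \<partial>lborel) = I"
      by (rule nn_integral_has_integral_lebesgue[OF _ gI]) (simp add: g_def)
    also have "(\<integral>\<^sup>+s. indicator {0..1} s * g s \<partial>lborel) = (\<integral>\<^sup>+s. ennreal (g s) * indicator {0<..1} s \<partial>lborel)"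
      by (intro nn_integral_cong_AE)
         (use AE_lborel_singleton[of 0] in eventually_elim, auto simp: indicator_def)
    also have "\<dots> = (\<integral>\<^sup>+s. 1 * ennreal (g s) \<partial>unit_interval)"
      by (simp add: nn_integral_restrict_space)
    finally have "ennreal (I\<^sup>2) = (\<integral>\<^sup>+s. 1 * ennreal (g s) \<partial>unit_interval)\<^sup>2"
      using I0 by (simp add: ennreal_power)
    also have "\<dots> \<le> (\<integral>\<^sup>+s. 1 ^ 2 \<partial>unit_interval) * (\<integral>\<^sup>+s. (ennreal (g s))\<^sup>2 \<partial>unit_interval)"
      by (rule Cauchy_Schwarz_nn_integral) (auto intro!: measurable_restrict_space1)
    also have "(\<integral>\<^sup>+s. 1 ^ 2 \<partial>unit_interval) = 1" by (simp add: emeasure_restrict_space space_restrict_space)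
    finally show ?thesis by (simp add: ennreal_power g_def)
  qed
  finally show ?thesis by (simp add: g_def mult_left_mono)
qed

lemma finite_measure_unit_interval: "finite_measure unit_interval"
  by (rule finite_measureI) (simp add: emeasure_restrict_space space_restrict_space)

text \<open>Integrating \<open>diff_le_segment\<close> over a family of segments leaves the gradient
  integrated along the map that sends a segment and a parameter s to a point. Assumption
  \<open>reg\<close> says that this map spreads mass no more densely than Lebesgue measure, up to a
  constant, so \<open>nn_integral_regular_le\<close> applies.\<close>

lemma segment_energy_le:
  fixes X Y :: "'m \<Rightarrow> real ^ 'n"
  assumes sf: "sigma_finite_measure \<alpha>" and [measurable]: "X \<in> borel_measurable \<alpha>" "Y \<in> borel_measurable \<alpha>"
    and U: "open U" "\<And>m s. m \<in> space \<alpha> \<Longrightarrow> 0 < s \<Longrightarrow> s \<le> 1 \<Longrightarrow> X m + s *\<^sub>R (Y m - X m) \<in> U"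
    and R: "\<And>m. m \<in> space \<alpha> \<Longrightarrow> norm (Y m - X m) \<le> R"
    and h0: "0 < h0" and K: "0 \<le> K"
    and reg: "\<And>z h. 0 < h \<Longrightarrow> h < h0 \<Longrightarrow> emeasure (\<alpha> \<Otimes>\<^sub>M unit_interval)
       {p \<in> space (\<alpha> \<Otimes>\<^sub>M unit_interval). dist (X (fst p) + snd p *\<^sub>R (Y (fst p) - X (fst p))) z < h} \<le> ennreal (K * h ^ CARD('n))"
    and \<phi>: "smooth \<phi>"
  shows "(\<integral>\<^sup>+m. ennreal ((cmod (\<phi> (Y m) - \<phi> (X m)))\<^sup>2) \<partial>\<alpha>)
     \<le> ennreal (R\<^sup>2 * (K / unit_ball_vol (CARD('n)))) * energy U \<phi>"
proof -
  interpret \<alpha>: sigma_finite_measure \<alpha> by fact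
  interpret I: finite_measure unit_interval by (rule finite_measure_unit_interval)
  interpret pair_sigma_finite \<alpha> unit_interval ..
  define g where "g x = (norm (grad \<phi> x))\<^sup>2" for x
  have gc: "continuous_on UNIV g" unfolding g_def by (intro continuous_intros continuous_on_grad \<phi>)
  then have [measurable]: "g \<in> borel_measurable borel" by (rule borel_measurable_continuous_onI)
  have [measurable]: "(\<lambda>s. s) \<in> borel_measurable unit_interval" by (intro measurable_restrict_space1) simp
  let ?T = "\<lambda>p. X (fst p) + snd p *\<^sub>R (Y (fst p) - X (fst p))"
  have [measurable]: "snd \<in> borel_measurable (\<alpha> \<Otimes>\<^sub>M unit_interval)"
    using measurable_compose[OF measurable_snd, of "\<lambda>s. s" unit_interval borel] by simp
  have T [measurable]: "?T \<in> borel_measurable (\<alpha> \<Otimes>\<^sub>M unit_interval)" by measurable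
  have "(\<integral>\<^sup>+m. ennreal ((cmod (\<phi> (Y m) - \<phi> (X m)))\<^sup>2) \<partial>\<alpha>) \<le>
      (\<integral>\<^sup>+m. ennreal (R\<^sup>2) * (\<integral>\<^sup>+s. ennreal (g (X m + s *\<^sub>R (Y m - X m))) \<partial>unit_interval) \<partial>\<alpha>)"
    unfolding g_def
    by (intro nn_integral_mono order_trans[OF diff_le_segment[OF \<phi>]] mult_right_mono ennreal_leI power_mono R) auto
  also have "\<dots> = ennreal (R\<^sup>2) * (\<integral>\<^sup>+m. (\<integral>\<^sup>+s. ennreal (g (X m + s *\<^sub>R (Y m - X m))) \<partial>unit_interval) \<partial>\<alpha>)"
    by (rule nn_integral_cmult) measurable
  also have "(\<integral>\<^sup>+m. (\<integral>\<^sup>+s. ennreal (g (X m + s *\<^sub>R (Y m - X m))) \<partial>unit_interval) \<partial>\<alpha>) =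
     (\<integral>\<^sup>+p. ennreal (g (?T p)) \<partial>(\<alpha> \<Otimes>\<^sub>M unit_interval))"
    by (subst I.nn_integral_fst[symmetric]) (auto simp: split_beta)
  also have "\<dots> = (\<integral>\<^sup>+p. indicator U (?T p) * ennreal (g (?T p)) \<partial>(\<alpha> \<Otimes>\<^sub>M unit_interval))"
    by (intro nn_integral_cong) (auto simp: space_pair_measure space_restrict_space indicator_def U(2))
  also have "\<dots> \<le> ennreal (K / unit_ball_vol (CARD('n))) * energy U \<phi>"
    using nn_integral_regular_le[OF sigma_finite_measure_axioms T U(1) gc _ h0 K] reg
    by (simp add: g_def)
  finally show ?thesis using K
    by (subst ennreal_mult') (auto simp: mult.assoc mult_left_mono)
qed

text \<open>Measurability of the identity says that Borel functions are measurable. It is used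
  instead of an equality of sigma-algebras because the measures below are restrictions, whose
  underlying space is only a subset.\<close>

definition fborel :: "'a::topological_space measure \<Rightarrow> bool" where
  "fborel \<mu> \<longleftrightarrow> finite_measure \<mu> \<and> (\<lambda>x. x) \<in> borel_measurable \<mu>"

text \<open>A Poincare inequality in difference form. It contains no mean values, so instances for
  different measures can be chained.\<close>

definition linked :: "(real ^ 'n) set \<Rightarrow> (real ^ 'n) measure \<Rightarrow> (real ^ 'n) measure \<Rightarrow> bool" where
  "linked U \<mu> \<nu> \<longleftrightarrow> (\<exists>C\<ge>0. \<forall>\<phi>. smooth \<phi> \<longrightarrow>
     (\<integral>\<^sup>+x. \<integral>\<^sup>+y. ennreal ((cmod (\<phi> y - \<phi> x))\<^sup>2) \<partial>\<nu> \<partial>\<mu>) \<le> ennreal C * energy U \<phi>)"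

lemma fborel_restrict_lborel: "A \<in> sets borel \<Longrightarrow> bounded A \<Longrightarrow> fborel (restrict_space lborel A)"
  unfolding fborel_def
  using emeasure_bounded_finite[of A]
  by (auto intro!: finite_measureI measurable_restrict_space1 simp: emeasure_restrict_space space_restrict_space)

lemma fborel_smooth: "fborel \<mu> \<Longrightarrow> smooth \<phi> \<Longrightarrow> \<phi> \<in> borel_measurable \<mu>"
  unfolding fborel_def
  using measurable_compose[of "\<lambda>x. x" \<mu> borel \<phi> borel] borel_measurable_continuous_onI[OF smooth_continuous]
  by blast

lemma fborel_pair:
  assumes "fborel \<mu>" "fborel \<nu>"
  shows "pair_sigma_finite \<mu> \<nu>" "sigma_finite_measure \<mu>" "sigma_finite_measure \<nu>"
  using assms unfolding fborel_def pair_sigma_finite_def finite_measure_def by auto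

lemma linked_sym:
  assumes "fborel \<mu>" "fborel \<nu>" "linked U \<mu> \<nu>" shows "linked U \<nu> \<mu>"
proof -
  interpret pair_sigma_finite \<mu> \<nu> using assms fborel_pair by blast
  have "(\<integral>\<^sup>+x. \<integral>\<^sup>+y. ennreal ((cmod (\<phi> y - \<phi> x))\<^sup>2) \<partial>\<mu> \<partial>\<nu>) = (\<integral>\<^sup>+x. \<integral>\<^sup>+y. ennreal ((cmod (\<phi> y - \<phi> x))\<^sup>2) \<partial>\<nu> \<partial>\<mu>)"
    if "smooth \<phi>" for \<phi>
  proof -
    have [measurable]: "\<phi> \<in> borel_measurable \<mu>" "\<phi> \<in> borel_measurable \<nu>"
      using fborel_smooth assms that by blast+
    have "(\<integral>\<^sup>+x. \<integral>\<^sup>+y. ennreal ((cmod (\<phi> y - \<phi> x))\<^sup>2) \<partial>\<mu> \<partial>\<nu>) = (\<integral>\<^sup>+x. \<integral>\<^sup>+y. ennreal ((cmod (\<phi> x - \<phi> y))\<^sup>2) \<partial>\<nu> \<partial>\<mu>)"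
      by (rule Fubini') measurable
    then show ?thesis by (simp add: norm_minus_commute)
  qed
  then show ?thesis using assms(3) unfolding linked_def by simp
qed

lemma cmod_diff_sq_le: "(cmod (a - c))\<^sup>2 \<le> 2 * (cmod (a - b))\<^sup>2 + 2 * (cmod (b - c))\<^sup>2"
proof -
  have "(cmod (a - c))\<^sup>2 \<le> (cmod (a - b) + cmod (b - c))\<^sup>2"
    by (intro power_mono) (metis norm_triangle_ineq diff_add_cancel add_diff_eq, simp)
  also have "\<dots> \<le> 2 * (cmod (a - b))\<^sup>2 + 2 * (cmod (b - c))\<^sup>2"
    using sum_squares_bound[of "cmod (a - b)" "cmod (b - c)"] by (simp add: power2_sum)
  finally show ?thesis .
qed

text \<open>A third point distributed by \<open>\<rho>\<close> is inserted into |\<phi> y - \<phi>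
  x|^2, and the result is integrated over all three measures. Each term then carries the mass of the
  measure that it does not involve, and the left side the mass of \<open>\<rho>\<close>, by which
  one divides; this gives \<open>C\<close>.\<close>

lemma linked_trans:
  assumes f: "fborel \<mu>" "fborel \<rho>" "fborel \<nu>" and l: "linked U \<mu> \<rho>" "linked U \<rho> \<nu>"
    and pos: "emeasure \<rho> (space \<rho>) \<noteq> 0"
  shows "linked U \<mu> \<nu>"
proof -
  interpret M: finite_measure \<mu> using f fborel_def by blast
  interpret R: finite_measure \<rho> using f fborel_def by blast
  interpret N: finite_measure \<nu> using f fborel_def by blast
  interpret RN: pair_sigma_finite \<rho> \<nu> ..
  define m r n where "m = measure \<mu> (space \<mu>)" "r = measure \<rho> (space \<rho>)" "n = measure \<nu> (space \<nu>)"
  have r: "r > 0" using pos by (simp add: m_r_n_def R.emeasure_eq_measure zero_less_measure_iff)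
  have mn: "m \<ge> 0" "n \<ge> 0" by (auto simp: m_r_n_def)
  obtain C1 where C1: "C1 \<ge> 0" "\<And>\<phi>. smooth \<phi> \<Longrightarrow> (\<integral>\<^sup>+x. \<integral>\<^sup>+y. ennreal ((cmod (\<phi> y - \<phi> x))\<^sup>2) \<partial>\<rho> \<partial>\<mu>) \<le> ennreal C1 * energy U \<phi>"
    using l(1) unfolding linked_def by blast
  obtain C2 where C2: "C2 \<ge> 0" "\<And>\<phi>. smooth \<phi> \<Longrightarrow> (\<integral>\<^sup>+x. \<integral>\<^sup>+y. ennreal ((cmod (\<phi> y - \<phi> x))\<^sup>2) \<partial>\<nu> \<partial>\<rho>) \<le> ennreal C2 * energy U \<phi>"
    using l(2) unfolding linked_def by blast
  define C where "C = (2 * n * C1 + 2 * m * C2) / r"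
  have "(\<integral>\<^sup>+x. \<integral>\<^sup>+y. ennreal ((cmod (\<phi> y - \<phi> x))\<^sup>2) \<partial>\<nu> \<partial>\<mu>) \<le> ennreal C * energy U \<phi>" if \<phi>: "smooth \<phi>" for \<phi>
  proof -
    have [measurable]: "\<phi> \<in> borel_measurable \<mu>" "\<phi> \<in> borel_measurable \<nu>" "\<phi> \<in> borel_measurable \<rho>"
      using fborel_smooth f \<phi> by blast+
    define a where "a x y = ennreal ((cmod (\<phi> y - \<phi> x))\<^sup>2)" for x y
    have [measurable]: "case_prod a \<in> borel_measurable (\<rho> \<Otimes>\<^sub>M \<nu>)" "case_prod a \<in> borel_measurable (\<mu> \<Otimes>\<^sub>M \<nu>)"
      "case_prod a \<in> borel_measurable (\<mu> \<Otimes>\<^sub>M \<rho>)" "case_prod (\<lambda>y z. a z y) \<in> borel_measurable (\<nu> \<Otimes>\<^sub>M \<rho>)"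
      unfolding a_def by measurable
    have [measurable]: "a x \<in> borel_measurable \<nu>" "a x \<in> borel_measurable \<rho>" "(\<lambda>z. a z y) \<in> borel_measurable \<rho>" for x y
      unfolding a_def by measurable
    have le: "a x y \<le> 2 * a x z + 2 * a z y" for x y z
    proof -
      have "a x y \<le> ennreal (2 * (cmod (\<phi> y - \<phi> z))\<^sup>2 + 2 * (cmod (\<phi> z - \<phi> x))\<^sup>2)"
        unfolding a_def by (intro ennreal_leI cmod_diff_sq_le)
      also have "\<dots> = 2 * a x z + 2 * a z y"
        by (simp add: a_def ennreal_plus ennreal_mult' add.commute)
      finally show ?thesis .
    qed
    have "ennreal r * (\<integral>\<^sup>+x. \<integral>\<^sup>+y. a x y \<partial>\<nu> \<partial>\<mu>) = (\<integral>\<^sup>+x. \<integral>\<^sup>+y. \<integral>\<^sup>+z. a x y \<partial>\<rho> \<partial>\<nu> \<partial>\<mu>)"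
      by (simp add: R.emeasure_eq_measure m_r_n_def nn_integral_multc mult.commute)
    also have "\<dots> \<le> (\<integral>\<^sup>+x. \<integral>\<^sup>+y. \<integral>\<^sup>+z. 2 * a x z + 2 * a z y \<partial>\<rho> \<partial>\<nu> \<partial>\<mu>)"
      by (intro nn_integral_mono le)
    also have "\<dots> = (\<integral>\<^sup>+x. \<integral>\<^sup>+y. 2 * (\<integral>\<^sup>+z. a x z \<partial>\<rho>) + 2 * (\<integral>\<^sup>+z. a z y \<partial>\<rho>) \<partial>\<nu> \<partial>\<mu>)"
      by (intro nn_integral_cong) (simp add: nn_integral_add nn_integral_cmult)
    also have "\<dots> = (\<integral>\<^sup>+x. 2 * (\<integral>\<^sup>+z. a x z \<partial>\<rho>) * ennreal n + 2 * (\<integral>\<^sup>+y. \<integral>\<^sup>+z. a z y \<partial>\<rho> \<partial>\<nu>) \<partial>\<mu>)"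
      by (intro nn_integral_cong) (simp add: nn_integral_add nn_integral_cmult N.emeasure_eq_measure m_r_n_def)
    also have "\<dots> = 2 * (\<integral>\<^sup>+x. \<integral>\<^sup>+z. a x z \<partial>\<rho> \<partial>\<mu>) * ennreal n + 2 * (\<integral>\<^sup>+y. \<integral>\<^sup>+z. a z y \<partial>\<rho> \<partial>\<nu>) * ennreal m"
      by (simp add: nn_integral_add nn_integral_cmult nn_integral_multc M.emeasure_eq_measure m_r_n_def)
    also have "(\<integral>\<^sup>+y. \<integral>\<^sup>+z. a z y \<partial>\<rho> \<partial>\<nu>) = (\<integral>\<^sup>+z. \<integral>\<^sup>+y. a z y \<partial>\<nu> \<partial>\<rho>)"
      by (rule RN.Fubini') measurable
    also have "2 * (\<integral>\<^sup>+x. \<integral>\<^sup>+z. a x z \<partial>\<rho> \<partial>\<mu>) * ennreal n + 2 * (\<integral>\<^sup>+z. \<integral>\<^sup>+y. a z y \<partial>\<nu> \<partial>\<rho>) * ennreal m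
       \<le> 2 * (ennreal C1 * energy U \<phi>) * ennreal n + 2 * (ennreal C2 * energy U \<phi>) * ennreal m"
      unfolding a_def by (intro add_mono mult_right_mono mult_left_mono C1 C2 \<phi>) auto
    also have "\<dots> = ennreal (r * C) * energy U \<phi>"
    proof -
      have "r * C = 2 * n * C1 + 2 * m * C2" using r by (simp add: C_def)
      then show ?thesis using C1(1) C2(1) mn
        by (simp add: ennreal_plus ennreal_mult algebra_simps)
    qed
    finally have "ennreal (1 / r) * (ennreal r * (\<integral>\<^sup>+x. \<integral>\<^sup>+y. a x y \<partial>\<nu> \<partial>\<mu>)) \<le> ennreal (1 / r) * (ennreal (r * C) * energy U \<phi>)"
      by (rule mult_left_mono) simp
    moreover have "ennreal (1 / r) * ennreal r = 1" "ennreal (1 / r) * ennreal (r * C) = ennreal C"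
      using r ennreal_mult'[of "1/r" r] ennreal_mult'[of "1/r" "r * C"] by auto
    ultimately show ?thesis by (simp add: mult.assoc[symmetric] a_def)
  qed
  moreover have "C \<ge> 0" unfolding C_def using C1 C2 mn r by simp
  ultimately show ?thesis unfolding linked_def by blast
qed

text \<open>The inner integral is nonnegative, so overlaps of the cover only enlarge the sum of the
  local bounds.\<close>

lemma linked_cover:
  assumes M: "sets M = sets borel" and I: "finite I" and B: "\<And>i. i \<in> I \<Longrightarrow> B i \<in> sets borel"
    and A: "A \<in> sets borel" "A \<subseteq> (\<Union>i\<in>I. B i)" and \<nu>: "fborel \<nu>"
    and l: "\<And>i. i \<in> I \<Longrightarrow> linked U (restrict_space M (B i)) \<nu>"
  shows "linked U (restrict_space M A) \<nu>"
proof -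
  interpret N: finite_measure \<nu> using \<nu> fborel_def by blast
  have sp: "space M = UNIV" using M sets_eq_imp_space_eq by fastforce
  define Q where "Q i C \<longleftrightarrow> C \<ge> 0 \<and> (\<forall>\<phi>. smooth \<phi> \<longrightarrow>
     (\<integral>\<^sup>+x. \<integral>\<^sup>+y. ennreal ((cmod (\<phi> y - \<phi> x))\<^sup>2) \<partial>\<nu> \<partial>(restrict_space M (B i))) \<le> ennreal C * energy U \<phi>)"
    for i and C :: real
  have "\<forall>i\<in>I. \<exists>C. Q i C"
    using l unfolding linked_def Q_def by blast
  then obtain C where "\<forall>i\<in>I. Q i (C i)" using bchoice by blast
  then have C: "\<And>i. i \<in> I \<Longrightarrow> C i \<ge> 0" "\<And>i \<phi>. i \<in> I \<Longrightarrow> smooth \<phi> \<Longrightarrow>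
     (\<integral>\<^sup>+x. \<integral>\<^sup>+y. ennreal ((cmod (\<phi> y - \<phi> x))\<^sup>2) \<partial>\<nu> \<partial>(restrict_space M (B i))) \<le> ennreal (C i) * energy U \<phi>"
    unfolding Q_def by blast+
  have "(\<integral>\<^sup>+x. \<integral>\<^sup>+y. ennreal ((cmod (\<phi> y - \<phi> x))\<^sup>2) \<partial>\<nu> \<partial>(restrict_space M A)) \<le> ennreal (\<Sum>i\<in>I. C i) * energy U \<phi>"
    if \<phi>: "smooth \<phi>" for \<phi>
  proof -
    have [measurable]: "\<phi> \<in> borel_measurable \<nu>" by (rule fborel_smooth[OF \<nu> \<phi>])
    have "\<phi> \<in> borel_measurable borel"
      using borel_measurable_continuous_onI[OF smooth_continuous[OF \<phi>]] .
    then have [measurable]: "\<phi> \<in> borel_measurable M" using M measurable_cong_sets by blast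
    define F where "F x = (\<integral>\<^sup>+y. ennreal ((cmod (\<phi> y - \<phi> x))\<^sup>2) \<partial>\<nu>)" for x
    have [measurable]: "F \<in> borel_measurable M" unfolding F_def by measurable
    have [measurable]: "B i \<in> sets M" if "i \<in> I" for i using B that M by simp
    have "(\<integral>\<^sup>+x. F x \<partial>(restrict_space M A)) = (\<integral>\<^sup>+x. F x * indicator A x \<partial>M)"
      using A M sp by (simp add: nn_integral_restrict_space)
    also have "\<dots> \<le> (\<integral>\<^sup>+x. (\<Sum>i\<in>I. F x * indicator (B i) x) \<partial>M)"
    proof (intro nn_integral_mono)
      fix x
      show "F x * indicator A x \<le> (\<Sum>i\<in>I. F x * indicator (B i) x)"
      proof (cases "x \<in> A")
        case True
        then obtain i where i: "i \<in> I" "x \<in> B i" using A by blast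
        then have "F x * indicator A x \<le> F x * indicator (B i) x" using True by simp
        also have "\<dots> \<le> (\<Sum>i\<in>I. F x * indicator (B i) x)"
          using I i by (intro member_le_sum) auto
        finally show ?thesis .
      qed simp
    qed
    also have "\<dots> = (\<Sum>i\<in>I. \<integral>\<^sup>+x. F x * indicator (B i) x \<partial>M)"
      by (rule nn_integral_sum) measurable
    also have "\<dots> = (\<Sum>i\<in>I. \<integral>\<^sup>+x. F x \<partial>(restrict_space M (B i)))"
      using B M sp by (intro sum.cong) (auto simp: nn_integral_restrict_space)
    also have "\<dots> \<le> (\<Sum>i\<in>I. ennreal (C i) * energy U \<phi>)"
      unfolding F_def by (intro sum_mono C \<phi>)
    also have "\<dots> = ennreal (\<Sum>i\<in>I. C i) * energy U \<phi>"
      unfolding sum_distrib_right[symmetric] using C(1) by (simp add: sum_ennreal)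
    finally show ?thesis by (simp add: F_def)
  qed
  moreover have "(\<Sum>i\<in>I. C i) \<ge> 0" using C(1) by (rule sum_nonneg)
  ultimately show ?thesis unfolding linked_def by blast
qed

lemma linked_subset:
  assumes "sets M = sets borel" "A \<in> sets borel" "B \<in> sets borel" "A \<subseteq> B" "fborel \<nu>" "linked U (restrict_space M B) \<nu>"
  shows "linked U (restrict_space M A) \<nu>"
  using linked_cover[of M "{()}" "\<lambda>_. B" A \<nu> U] assms by simp

lemma emeasure_restrict_lborel_le:
  "S \<in> sets borel \<Longrightarrow> T \<subseteq> S \<Longrightarrow> T \<subseteq> T' \<Longrightarrow> T' \<in> sets borel \<Longrightarrow>
    emeasure (restrict_space lborel S) T \<le> emeasure lborel T'"
  by (subst emeasure_restrict_space) (auto intro!: emeasure_mono)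

text \<open>The point x + s (y - x) is regularly distributed for every s: if s >= 1/2, fix x and let
  y vary, which moves the point at rate s; otherwise fix y and let x vary, at rate 1 - s. The rate
  is at least 1/2 in both cases, so no singularity arises as s approaches 0 or 1.\<close>

lemma linked_segments:
  fixes A B U :: "(real ^ 'n) set"
  assumes A: "A \<in> sets borel" "bounded A" and B: "B \<in> sets borel" "bounded B" and U: "open U"
    and seg: "\<And>x y s. x \<in> A \<Longrightarrow> y \<in> B \<Longrightarrow> 0 < s \<Longrightarrow> s \<le> 1 \<Longrightarrow> x + s *\<^sub>R (y - x) \<in> U"
  shows "linked U (restrict_space lborel A) (restrict_space lborel B)"
proof -
  let ?A = "restrict_space lborel A" and ?B = "restrict_space lborel B"
  have fA: "fborel ?A" and fB: "fborel ?B" using A B fborel_restrict_lborel by blast+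
  interpret A: finite_measure ?A using fA fborel_def by blast
  interpret B: finite_measure ?B using fB fborel_def by blast
  interpret AB: pair_sigma_finite ?A ?B ..
  interpret I: finite_measure unit_interval by (rule finite_measure_unit_interval)
  interpret ABI: pair_sigma_finite "?A \<Otimes>\<^sub>M ?B" unit_interval ..
  have [measurable]: "(\<lambda>x. x) \<in> borel_measurable ?A" "(\<lambda>x. x) \<in> borel_measurable ?B" "(\<lambda>s. s) \<in> borel_measurable unit_interval"
    by (intro measurable_restrict_space1; simp)+
  have m1 [measurable]: "fst \<in> borel_measurable (?A \<Otimes>\<^sub>M ?B)"
    using measurable_compose[OF measurable_fst, of "\<lambda>s. s" ?A borel ?B] by simp
  have m2 [measurable]: "snd \<in> borel_measurable (?A \<Otimes>\<^sub>M ?B)"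
    using measurable_compose[OF measurable_snd, of "\<lambda>s. s" ?B borel ?A] by simp
  have m3 [measurable]: "snd \<in> borel_measurable ((?A \<Otimes>\<^sub>M ?B) \<Otimes>\<^sub>M unit_interval)"
    using measurable_compose[OF measurable_snd, of "\<lambda>s. s" unit_interval borel "?A \<Otimes>\<^sub>M ?B"] by simp
  have spA: "space ?A = A" and spB: "space ?B = B" by (auto simp: space_restrict_space)
  define \<omega> where "\<omega> = unit_ball_vol (real CARD('n))"
  have \<omega>: "\<omega> \<ge> 0" by (simp add: \<omega>_def)
  define a b where "a = measure ?A A" "b = measure ?B B"
  have ab: "a \<ge> 0" "b \<ge> 0" by (auto simp: a_b_def)
  \<comment> \<open>The power of 2 is the largest inverse Jacobian at rate at least 1/2;
    \<open>a + b\<close> dominates the total mass of whichever variable is kept fixed.\<close>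
  define K where "K = (a + b) * (\<omega> * 2 ^ CARD('n))"
  have K: "K \<ge> 0" using ab \<omega> by (simp add: K_def)
  obtain R where R: "\<And>x y. x \<in> A \<Longrightarrow> y \<in> B \<Longrightarrow> norm (y - x) \<le> R"
  proof -
    obtain r1 r2 where "\<And>x. x \<in> A \<Longrightarrow> norm x \<le> r1" "\<And>x. x \<in> B \<Longrightarrow> norm x \<le> r2"
      using A B unfolding bounded_iff by blast
    then show thesis by (intro that[of "r2 + r1"]) (meson add_mono norm_triangle_ineq4 order_trans)
  qed
  have slice: "emeasure lborel {y. dist (v + s *\<^sub>R y) z < h} \<le> ennreal (\<omega> * (2 * h) ^ CARD('n))"
    if "1 / 2 \<le> s" "0 < h" for v z :: "real ^ 'n" and s h :: real
  proof -
    have "{y. dist (v + s *\<^sub>R y) z < h} \<subseteq> ball ((1 / s) *\<^sub>R (z - v)) (2 * h)"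
    proof
      fix y assume "y \<in> {y. dist (v + s *\<^sub>R y) z < h}"
      moreover have "v + s *\<^sub>R y - z = s *\<^sub>R (y - (1 / s) *\<^sub>R (z - v))" using that by (simp add: algebra_simps)
      ultimately have "s * norm (y - (1 / s) *\<^sub>R (z - v)) < h" using that by (simp add: dist_norm)
      moreover have "(1 / 2) * norm (y - (1 / s) *\<^sub>R (z - v)) \<le> s * norm (y - (1 / s) *\<^sub>R (z - v))"
        by (rule mult_right_mono) (use that in auto)
      ultimately show "y \<in> ball ((1 / s) *\<^sub>R (z - v)) (2 * h)" by (simp add: dist_norm norm_minus_commute)
    qed
    then have "emeasure lborel {y. dist (v + s *\<^sub>R y) z < h} \<le> emeasure lborel (ball ((1 / s) *\<^sub>R (z - v)) (2 * h))"
      by (rule emeasure_mono) simp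
    also have "\<dots> = ennreal (\<omega> * (2 * h) ^ CARD('n))" using that by (simp add: emeasure_ball \<omega>_def)
    finally show ?thesis .
  qed
  have reg: "emeasure ((?A \<Otimes>\<^sub>M ?B) \<Otimes>\<^sub>M unit_interval)
       {p \<in> space ((?A \<Otimes>\<^sub>M ?B) \<Otimes>\<^sub>M unit_interval). dist (fst (fst p) + snd p *\<^sub>R (snd (fst p) - fst (fst p))) z < h}
      \<le> ennreal (K * h ^ CARD('n))" (is "emeasure _ ?S \<le> _")
    if h: "0 < h" for z h
  proof -
    have S: "?S \<in> sets ((?A \<Otimes>\<^sub>M ?B) \<Otimes>\<^sub>M unit_interval)" by measurable
    have "emeasure ((?A \<Otimes>\<^sub>M ?B) \<Otimes>\<^sub>M unit_interval) ?S =
        (\<integral>\<^sup>+s. emeasure (?A \<Otimes>\<^sub>M ?B) ((\<lambda>m. (m, s)) -` ?S) \<partial>unit_interval)"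
      by (rule ABI.emeasure_pair_measure_alt2[OF S])
    also have "\<dots> \<le> (\<integral>\<^sup>+s. ennreal (K * h ^ CARD('n)) \<partial>unit_interval)"
    proof (intro nn_integral_mono)
      fix s assume "s \<in> space unit_interval"
      then have s: "0 < s" "s \<le> 1" by (auto simp: space_restrict_space)
      let ?T = "(\<lambda>m. (m, s)) -` ?S"
      have T: "?T \<in> sets (?A \<Otimes>\<^sub>M ?B)" by (rule sets_Pair2[OF S])
      have TT: "?T \<subseteq> {m. fst m \<in> A \<and> snd m \<in> B \<and> dist (fst m + s *\<^sub>R (snd m - fst m)) z < h}"
        by (auto simp: space_pair_measure spA spB)
      have "emeasure (?A \<Otimes>\<^sub>M ?B) ?T \<le> ennreal (K * h ^ CARD('n))"
      proof (cases "1 / 2 \<le> s")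
        case True
        have "emeasure (?A \<Otimes>\<^sub>M ?B) ?T = (\<integral>\<^sup>+x. emeasure ?B (Pair x -` ?T) \<partial>?A)"
          by (rule B.emeasure_pair_measure_alt[OF T])
        also have "\<dots> \<le> (\<integral>\<^sup>+x. ennreal (\<omega> * (2 * h) ^ CARD('n)) \<partial>?A)"
        proof (intro nn_integral_mono order_trans[OF _ slice[OF True h]] emeasure_restrict_lborel_le)
          fix x show "Pair x -` ?T \<subseteq> {y. dist ((1 - s) *\<^sub>R x + s *\<^sub>R y) z < h}"
            using TT by (auto simp: algebra_simps)
          show "{y. dist ((1 - s) *\<^sub>R x + s *\<^sub>R y) z < h} \<in> sets borel" by measurable
        qed (use B TT in auto)
        also have "\<dots> = ennreal (a * (\<omega> * (2 * h) ^ CARD('n)))"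
          using \<omega> h by (simp add: spA A.emeasure_eq_measure a_b_def ennreal_mult mult.commute)
        also have "\<dots> \<le> ennreal (K * h ^ CARD('n))"
          using ab \<omega> h by (intro ennreal_leI) (simp add: K_def power_mult_distrib algebra_simps)
        finally show ?thesis .
      next
        case False
        then have s2: "1 / 2 \<le> 1 - s" by simp
        have "emeasure (?A \<Otimes>\<^sub>M ?B) ?T = (\<integral>\<^sup>+y. emeasure ?A ((\<lambda>x. (x, y)) -` ?T) \<partial>?B)"
          by (rule AB.emeasure_pair_measure_alt2[OF T])
        also have "\<dots> \<le> (\<integral>\<^sup>+y. ennreal (\<omega> * (2 * h) ^ CARD('n)) \<partial>?B)"
        proof (intro nn_integral_mono order_trans[OF _ slice[OF s2 h]] emeasure_restrict_lborel_le)
          fix y show "(\<lambda>x. (x, y)) -` ?T \<subseteq> {x. dist (s *\<^sub>R y + (1 - s) *\<^sub>R x) z < h}"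
            using TT by (auto simp: algebra_simps)
          show "{x. dist (s *\<^sub>R y + (1 - s) *\<^sub>R x) z < h} \<in> sets borel" by measurable
        qed (use A TT in auto)
        also have "\<dots> = ennreal (b * (\<omega> * (2 * h) ^ CARD('n)))"
          using \<omega> h by (simp add: spB B.emeasure_eq_measure a_b_def ennreal_mult mult.commute)
        also have "\<dots> \<le> ennreal (K * h ^ CARD('n))"
          using ab \<omega> h by (intro ennreal_leI) (simp add: K_def power_mult_distrib algebra_simps)
        finally show ?thesis .
      qed
      then show "emeasure (?A \<Otimes>\<^sub>M ?B) ?T \<le> ennreal (K * h ^ CARD('n))" .
    qed
    also have "\<dots> = ennreal (K * h ^ CARD('n))" by (simp add: emeasure_restrict_space space_restrict_space)
    finally show ?thesis .
  qed
  have sf: "sigma_finite_measure (?A \<Otimes>\<^sub>M ?B)" by unfold_locales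
  have "(\<integral>\<^sup>+x. \<integral>\<^sup>+y. ennreal ((cmod (\<phi> y - \<phi> x))\<^sup>2) \<partial>?B \<partial>?A)
     \<le> ennreal (R\<^sup>2 * (K / unit_ball_vol (CARD('n)))) * energy U \<phi>" if \<phi>: "smooth \<phi>" for \<phi>
  proof -
    have [measurable]: "\<phi> \<in> borel_measurable ?A" "\<phi> \<in> borel_measurable ?B"
      using fborel_smooth fA fB \<phi> by blast+
    have "(\<integral>\<^sup>+x. \<integral>\<^sup>+y. ennreal ((cmod (\<phi> y - \<phi> x))\<^sup>2) \<partial>?B \<partial>?A) =
       (\<integral>\<^sup>+m. ennreal ((cmod (\<phi> (snd m) - \<phi> (fst m)))\<^sup>2) \<partial>(?A \<Otimes>\<^sub>M ?B))"
    proof (subst B.nn_integral_fst[symmetric])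
      have "(\<lambda>m. \<phi> (snd m)) \<in> borel_measurable (?A \<Otimes>\<^sub>M ?B)"
        by (rule measurable_compose[OF measurable_snd]) fact
      moreover have "(\<lambda>m. \<phi> (fst m)) \<in> borel_measurable (?A \<Otimes>\<^sub>M ?B)"
        by (rule measurable_compose[OF measurable_fst]) fact
      ultimately show "(\<lambda>m. ennreal ((cmod (\<phi> (snd m) - \<phi> (fst m)))\<^sup>2)) \<in> borel_measurable (?A \<Otimes>\<^sub>M ?B)"
        by simp
    qed simp
    also have "\<dots> \<le> ennreal (R\<^sup>2 * (K / unit_ball_vol (CARD('n)))) * energy U \<phi>"
      by (rule segment_energy_le[OF sf m1 m2 U, of R 1, OF _ _ _ K reg \<phi>])
         (auto simp: space_pair_measure spA spB intro: seg R)
    finally show ?thesis .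
  qed
  then show ?thesis using K unfolding linked_def
    by (intro exI[of _ "R\<^sup>2 * (K / unit_ball_vol (CARD('n)))"]) auto
qed

text \<open>Being linked through balls of a common radius is an equivalence relation that holds
  locally, so on a connected open set it relates any two points.\<close>

lemma linked_balls:
  fixes U :: "(real ^ 'n) set"
  assumes U: "open U" "connected U" and a: "a \<in> U" and b: "b \<in> U"
  shows "\<exists>\<rho>>0. ball a \<rho> \<subseteq> U \<and> ball b \<rho> \<subseteq> U \<and> linked U (restrict_space lborel (ball a \<rho>)) (restrict_space lborel (ball b \<rho>))"
proof -
  define R where "R a b \<longleftrightarrow> (\<exists>\<rho>>0. ball a \<rho> \<subseteq> U \<and> ball b \<rho> \<subseteq> U \<and>
    linked U (restrict_space lborel (ball a \<rho>)) (restrict_space lborel (ball b \<rho>)))" for a b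
  have fb: "fborel (restrict_space lborel (ball x \<rho>))" for x :: "real ^ 'n" and \<rho>
    by (rule fborel_restrict_lborel) auto
  \<comment> \<open>Chaining requires the two balls about the middle point to coincide, so the radii
    are reduced to the smaller one.\<close>
  have shrink: "linked U (restrict_space lborel (ball a \<rho>)) (restrict_space lborel (ball b \<rho>))"
    if "linked U (restrict_space lborel (ball a \<rho>')) (restrict_space lborel (ball b \<rho>'))" "\<rho> \<le> \<rho>'" for a b \<rho> \<rho>'
  proof -
    have "linked U (restrict_space lborel (ball a \<rho>)) (restrict_space lborel (ball b \<rho>'))"
      by (rule linked_subset[of lborel _ "ball a \<rho>'"]) (use that fb in auto)
    note 1 = linked_sym[OF fb fb this]
    have "linked U (restrict_space lborel (ball b \<rho>)) (restrict_space lborel (ball a \<rho>))"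
      by (rule linked_subset[of lborel _ "ball b \<rho>'"]) (use that fb 1 in auto)
    then show ?thesis by (rule linked_sym[OF fb fb])
  qed
  have "R a b"
  proof (rule connected_equivalence_relation[OF U(2) a b])
    fix x y assume "R x y" then show "R y x" unfolding R_def using linked_sym[OF fb fb] by blast
  next
    fix x y z assume "R x y" "R y z"
    then obtain r1 r2 where r: "r1 > 0" "r2 > 0" "ball x r1 \<subseteq> U" "ball y r1 \<subseteq> U" "ball z r2 \<subseteq> U"
      "linked U (restrict_space lborel (ball x r1)) (restrict_space lborel (ball y r1))"
      "linked U (restrict_space lborel (ball y r2)) (restrict_space lborel (ball z r2))" unfolding R_def by blast
    define r where "r = min r1 r2"
    have "linked U (restrict_space lborel (ball x r)) (restrict_space lborel (ball z r))"
    proof (rule linked_trans[OF fb fb fb])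
      show "linked U (restrict_space lborel (ball x r)) (restrict_space lborel (ball y r))"
        by (rule shrink[OF r(6)]) (simp add: r_def)
      show "linked U (restrict_space lborel (ball y r)) (restrict_space lborel (ball z r))"
        by (rule shrink[OF r(7)]) (simp add: r_def)
      show "emeasure (restrict_space lborel (ball y r)) (space (restrict_space lborel (ball y r))) \<noteq> 0"
        using r less_imp_neq[OF unit_ball_vol_pos[of "real CARD('n)"]]
        by (simp add: space_restrict_space emeasure_restrict_space emeasure_ball r_def)
    qed
    then show "R x z" unfolding R_def using r by (intro exI[of _ r]) (auto simp: r_def)
  next
    fix x assume "x \<in> U"
    then obtain r where r: "r > 0" "ball x r \<subseteq> U" using U openE by blast
    \<comment> \<open>Both half-radius balls lie in the convex set \<open>ball x r\<close>, so all
      segments between them stay inside \<open>U\<close>.\<close>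
    have "R x y" if "y \<in> ball x (r / 2)" for y
      unfolding R_def
    proof (intro exI[of _ "r / 2"] conjI linked_segments)
      have "ball y (r / 2) \<subseteq> ball x r"
      proof
        fix z assume "z \<in> ball y (r / 2)"
        then show "z \<in> ball x r" using that dist_triangle[of x z y] by auto
      qed
      then show "ball y (r / 2) \<subseteq> U" using r by blast
      fix u v and s :: real assume u: "u \<in> ball x (r / 2)" and v: "v \<in> ball y (r / 2)" and s: "0 < s" "s \<le> 1"
      have "u \<in> ball x r" "v \<in> ball x r" using u v \<open>ball y (r / 2) \<subseteq> ball x r\<close> r(1) subset_ball[of "r / 2" r x] by auto
      then have "(1 - s) *\<^sub>R u + s *\<^sub>R v \<in> ball x r" by (rule convexD[OF convex_ball]) (use s in auto)
      then show "u + s *\<^sub>R (v - u) \<in> U" using r by (auto simp: algebra_simps)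
    qed (use r U in auto)
    then show "\<exists>T. openin (top_of_set U) T \<and> x \<in> T \<and> (\<forall>y\<in>T. R x y)"
      using r U by (intro exI[of _ "ball x (r / 2)"]) (auto simp: openin_open_eq subset_iff)
  qed
  then show ?thesis unfolding R_def .
qed

text \<open>Every point of the compact closure has a neighbourhood whose part in \<open>U\<close> is
  linked to one fixed ball: interior points by chains of balls, boundary points by the segments of a
  chart followed by such a chain. A finite cover and transitivity through the fixed ball finish the
  proof.\<close>

lemma linked_domain:
  fixes U :: "(real ^ 'n) set"
  assumes dim: "CARD('n) \<ge> 2" and bd: "bounded U" and U: "open U" "connected U" "lipschitz_boundary U"
  shows "linked U (restrict_space lborel U) (restrict_space lborel U)"
proof (cases "U = {}")
  case True
  then show ?thesis unfolding linked_def
    by (intro exI[of _ 0]) (simp add: nn_integral_empty space_restrict_space)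
next
  case False
  then obtain q where q: "q \<in> U" by blast
  obtain r0 where r0: "r0 > 0" "ball q r0 \<subseteq> U" using q U openE by blast
  have fb: "fborel (restrict_space lborel (ball x \<rho>))" for x :: "real ^ 'n" and \<rho>
    by (rule fborel_restrict_lborel) auto
  have fU: "fborel (restrict_space lborel (U \<inter> S))" if "open S" for S
    by (rule fborel_restrict_lborel) (use bd U that in auto)
  have pos: "emeasure (restrict_space lborel (ball y r)) (space (restrict_space lborel (ball y r))) \<noteq> 0"
    if "r > 0" for y :: "real ^ 'n" and r
    using that less_imp_neq[OF unit_ball_vol_pos[of "real CARD('n)"]]
    by (simp add: space_restrict_space emeasure_restrict_space emeasure_ball)
  let ?B = "restrict_space lborel (ball q r0)"
  have toq: "\<exists>\<rho>>0. linked U (restrict_space lborel (ball y \<rho>)) ?B" if "y \<in> U" for y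
  proof -
    obtain \<rho> where \<rho>: "\<rho> > 0" "ball q \<rho> \<subseteq> U"
      "linked U (restrict_space lborel (ball y \<rho>)) (restrict_space lborel (ball q \<rho>))"
      using linked_balls[OF U(1,2) \<open>y \<in> U\<close> q] by blast
    \<comment> \<open>The radius about \<open>q\<close> that \<open>linked_balls\<close> supplies
      depends on \<open>y\<close>; the ball with the smaller of the two radii mediates between it
      and the fixed ball.\<close>
    have 1: "linked U (restrict_space lborel (ball q (min \<rho> r0))) ?B"
    proof (rule linked_segments)
      fix u v and s :: real assume "u \<in> ball q (min \<rho> r0)" "v \<in> ball q r0" and s: "0 < s" "s \<le> 1"
      then have "(1 - s) *\<^sub>R u + s *\<^sub>R v \<in> ball q r0" by (intro convexD[OF convex_ball]) auto
      then show "u + s *\<^sub>R (v - u) \<in> U" using r0 by (auto simp: algebra_simps)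
    qed (use U in auto)
    have 2: "linked U (restrict_space lborel (ball y \<rho>)) (restrict_space lborel (ball q (min \<rho> r0)))"
      by (rule linked_sym[OF fb fb], rule linked_subset[of lborel _ "ball q \<rho>"])
         (use linked_sym[OF fb fb \<rho>(3)] fb in auto)
    have "linked U (restrict_space lborel (ball y \<rho>)) ?B"
      by (rule linked_trans[OF fb fb fb 2 1 pos]) (use \<rho>(1) r0(1) in simp)
    then show ?thesis using \<rho>(1) by blast
  qed
  have local: "\<exists>\<rho>>0. linked U (restrict_space lborel (U \<inter> ball p \<rho>)) ?B" if p: "p \<in> closure U" for p
  proof (cases "p \<in> U")
    case True
    then obtain \<rho> where "\<rho> > 0" "linked U (restrict_space lborel (ball p \<rho>)) ?B" using toq by blast
    note \<rho> = this
    have "linked U (restrict_space lborel (U \<inter> ball p \<rho>)) ?B"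
      by (rule linked_subset[of lborel _ "ball p \<rho>"]) (use U fb \<rho> in auto)
    then show ?thesis using \<rho> by blast
  next
    case False
    then have "p \<in> frontier U" using p U by (simp add: frontier_def interior_open)
    then obtain e t \<rho> where c: "0 < t" "0 < \<rho>"
      "\<And>x s. x \<in> closure U \<inter> ball p t \<Longrightarrow> 0 < s \<Longrightarrow> s \<le> t \<Longrightarrow> x + s *\<^sub>R e \<in> U"
      "\<And>x y s. x \<in> closure U \<inter> ball p \<rho> \<Longrightarrow> y \<in> ball (p + t *\<^sub>R e) \<rho> \<Longrightarrow> 0 < s \<Longrightarrow> s \<le> 1 \<Longrightarrow> x + s *\<^sub>R (y - x) \<in> U"
      using lipschitz_boundary_chart[OF dim U(1,3)] by metis
    have "p + t *\<^sub>R e \<in> U" by (rule c(3)) (use p c in auto)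
    then obtain \<rho>' where \<rho>': "\<rho>' > 0" "linked U (restrict_space lborel (ball (p + t *\<^sub>R e) \<rho>')) ?B" using toq by blast
    \<comment> \<open>The ball above \<open>p\<close> must be small enough both for the segments of
      the chart and for the chain.\<close>
    define r where "r = min \<rho> \<rho>'"
    have 1: "linked U (restrict_space lborel (U \<inter> ball p \<rho>)) (restrict_space lborel (ball (p + t *\<^sub>R e) r))"
      by (rule linked_segments)
         (use U bd closure_subset[of U] in \<open>auto simp: r_def intro!: c(4)\<close>)
    have 2: "linked U (restrict_space lborel (ball (p + t *\<^sub>R e) r)) ?B"
      by (rule linked_subset[of lborel _ "ball (p + t *\<^sub>R e) \<rho>'"]) (use \<rho>' fb in \<open>auto simp: r_def\<close>)
    have "linked U (restrict_space lborel (U \<inter> ball p \<rho>)) ?B"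
      by (rule linked_trans[OF fU[OF open_ball] fb fb 1 2 pos]) (use c \<rho>' in \<open>simp add: r_def\<close>)
    then show ?thesis using c by blast
  qed
  then obtain \<rho> where \<rho>: "\<And>p. p \<in> closure U \<Longrightarrow> \<rho> p > 0 \<and> linked U (restrict_space lborel (U \<inter> ball p (\<rho> p))) ?B"
    by metis
  have "compact (closure U)" using bd by simp
  then obtain I where I: "I \<subseteq> closure U" "finite I" "closure U \<subseteq> (\<Union>p\<in>I. ball p (\<rho> p))"
    by (rule compactE_image[of _ "closure U" "\<lambda>p. ball p (\<rho> p)"]) (use \<rho> in auto)
  have UB: "linked U (restrict_space lborel U) ?B"
  proof (rule linked_cover[where I = I and B = "\<lambda>p. U \<inter> ball p (\<rho> p)"])
    show "U \<subseteq> (\<Union>p\<in>I. U \<inter> ball p (\<rho> p))" using I(3) closure_subset[of U] by blast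
  qed (use I U fb \<rho> in auto)
  have f: "fborel (restrict_space lborel U)" using fU[of UNIV] by simp
  show ?thesis
    by (rule linked_trans[OF f fb f UB linked_sym[OF f fb UB] pos[OF r0(1)]])
qed

text \<open>
  Boundary points \<open>x\<close> are moved to \<open>x + r *\<^sub>R e\<close> inside the domain. Averaging over \<open>r \<in> (t / 2, t]\<close>
  makes the distribution of the moved points regular with respect to Lebesgue measure.
\<close>

lemma linked_boundary_piece:
  fixes U :: "(real ^ 'n) set"
  defines "H \<equiv> hausdorff_measure (CARD('n) - 1)"
  assumes dim: "CARD('n) \<ge> 2" and bd: "bounded U" and U: "open U" "lipschitz_boundary U"
    and UU: "linked U (restrict_space lborel U) (restrict_space lborel U)" and p: "p \<in> frontier U"
  shows "\<exists>t>0. emeasure H (frontier U \<inter> ball p t) < \<infinity> \<and>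
    linked U (restrict_space H (frontier U \<inter> ball p t)) (restrict_space lborel U)"
proof -
  let ?d = "CARD('n) - 1"
  obtain e t \<rho> K0 where e: "norm e = 1" and t: "0 < t" and K0: "0 \<le> K0"
    and up: "\<And>x s. x \<in> closure U \<inter> ball p t \<Longrightarrow> 0 < s \<Longrightarrow> s \<le> t \<Longrightarrow> x + s *\<^sub>R e \<in> U"
    and sep0: "\<And>x y. x \<in> frontier U \<inter> ball p t \<Longrightarrow> y \<in> frontier U \<inter> ball p t \<Longrightarrow> norm (x - y) \<le> K0 * norm (horiz e (x - y))"
    and reg0: "\<And>x0 h. 0 < h \<Longrightarrow> hausdorff_outer ?d (frontier U \<inter> ball p t \<inter> cball x0 h) \<le> ennreal (K0 * h ^ ?d)"
    using lipschitz_boundary_chart[OF dim U p] by metis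
  define F where "F = frontier U \<inter> ball p t"
  have Fb [measurable]: "F \<in> sets borel" by (simp add: F_def)
  have reg: "emeasure H (F \<inter> cball x0 h) \<le> ennreal (K0 * h ^ ?d)" if "0 < h" for x0 h
    unfolding H_def F_def using emeasure_hausdorff_le reg0[OF that] by (rule order_trans)
  have Ffin: "emeasure H F < \<infinity>"
  proof -
    have "F = F \<inter> cball p t" unfolding F_def by auto
    then have "emeasure H F \<le> ennreal (K0 * t ^ ?d)" using reg[OF t] by metis
    then show ?thesis by (simp add: le_less_trans)
  qed
  let ?\<mu> = "restrict_space H F" and ?\<tau> = "restrict_space lborel {t / 2<..t}" and ?L = "restrict_space lborel U"
  have [simp]: "space H = UNIV" "sets H = sets borel" by (simp_all add: H_def)
  have sp: "space ?\<mu> = F" "space ?\<tau> = {t / 2<..t}" "space ?L = U" by (auto simp: space_restrict_space)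
  have f\<mu>: "fborel ?\<mu>" unfolding fborel_def
  proof
    show "finite_measure ?\<mu>"
      by (rule finite_measureI) (use Ffin in \<open>simp add: sp emeasure_restrict_space\<close>)
    show "(\<lambda>x. x) \<in> borel_measurable ?\<mu>"
      by (intro measurable_restrict_space1) (simp add: measurable_ident_sets)
  qed
  have id\<mu>: "(\<lambda>x. x) \<in> borel_measurable ?\<mu>" using f\<mu> unfolding fborel_def by blast
  have ind\<mu>: "(\<lambda>x. indicator S x :: ennreal) \<in> borel_measurable ?\<mu>" if "S \<in> sets borel" for S
    by (rule measurable_compose[OF id\<mu> borel_measurable_indicator[OF that]])
  have f\<tau>: "fborel ?\<tau>" by (rule fborel_restrict_lborel) auto
  have fL: "fborel ?L" by (rule fborel_restrict_lborel) (use U bd in auto)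
  interpret M: finite_measure ?\<mu> using f\<mu> fborel_def by blast
  interpret T: finite_measure ?\<tau> using f\<tau> fborel_def by blast
  interpret L: finite_measure ?L using fL fborel_def by blast
  interpret I: finite_measure unit_interval by (rule finite_measure_unit_interval)
  define \<alpha> where "\<alpha> = ?\<mu> \<Otimes>\<^sub>M ?\<tau>"
  interpret MT: pair_sigma_finite ?\<mu> ?\<tau> ..
  have sf: "sigma_finite_measure \<alpha>" unfolding \<alpha>_def by unfold_locales
  interpret A: sigma_finite_measure \<alpha> by (rule sf)
  interpret AL: pair_sigma_finite \<alpha> ?L ..
  have sp\<alpha>: "space \<alpha> = F \<times> {t / 2<..t}" by (simp add: \<alpha>_def space_pair_measure sp)
  have [measurable]: "(\<lambda>s. s) \<in> borel_measurable unit_interval" by (intro measurable_restrict_space1) simp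
  have m1 [measurable]: "fst \<in> borel_measurable \<alpha>"
    using measurable_compose[OF measurable_fst, of "\<lambda>s. s" ?\<mu> borel ?\<tau>] f\<mu> unfolding fborel_def \<alpha>_def by simp
  have m2 [measurable]: "snd \<in> borel_measurable \<alpha>"
    using measurable_compose[OF measurable_snd, of "\<lambda>s. s" ?\<tau> borel ?\<mu>] f\<tau> unfolding fborel_def \<alpha>_def by simp
  have m3 [measurable]: "snd \<in> borel_measurable (\<alpha> \<Otimes>\<^sub>M unit_interval)"
    using measurable_compose[OF measurable_snd, of "\<lambda>s. s" unit_interval borel \<alpha>] by simp
  define Y where "Y m = fst m + snd m *\<^sub>R e" for m :: "(real ^ 'n) \<times> real"
  have Y [measurable]: "Y \<in> borel_measurable \<alpha>" unfolding Y_def by measurable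
  have up': "fst m + (s * snd m) *\<^sub>R e \<in> U" if "m \<in> space \<alpha>" "0 < s" "s \<le> 1" for m s
  proof (rule up)
    show "fst m \<in> closure U \<inter> ball p t" using that by (auto simp: sp\<alpha> F_def frontier_def)
    have "0 < snd m" "snd m \<le> t" using that t by (auto simp: sp\<alpha>)
    then show "0 < s * snd m" "s * snd m \<le> t" using that mult_le_one mult_mono[of s 1 "snd m" t] t by auto
  qed
  \<comment> \<open>Adding 1 makes the radius \<open>2 * K * h\<close> positive even if
    \<open>K0\<close> is 0.\<close>
  define K where "K = K0 + 1"
  have K: "K > 0" using K0 by (simp add: K_def)
  \<comment> \<open>Shifts along \<open>e\<close> do not change \<open>horiz e\<close>, so boundary
    points whose shifts reach the same ball of radius h have horizontal distance at most 2 h. They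
    fill a set of measure O(h^(n-1)); the shift parameter supplies the missing factor h.\<close>
  have sep: "x \<in> cball x0 (2 * K * h)"
    if "x \<in> F" "x0 \<in> F" "dist (x + r *\<^sub>R e) z < h" "dist (x0 + r0 *\<^sub>R e) z < h" for x x0 z r r0 h
  proof -
    have "norm (horiz e (x - x0)) = norm (horiz e ((x + r *\<^sub>R e) - (x0 + r0 *\<^sub>R e)))"
      by (simp add: horiz_diff horiz_add horiz_scale horiz_self e)
    also have "\<dots> \<le> dist (x + r *\<^sub>R e) (x0 + r0 *\<^sub>R e)" unfolding dist_norm by (rule norm_horiz_le[OF e])
    also have "\<dots> \<le> 2 * h" using that(3,4) dist_triangle2[of "x + r *\<^sub>R e" "x0 + r0 *\<^sub>R e" z] by linarith
    finally have "K0 * norm (horiz e (x - x0)) \<le> K * (2 * h)"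
      using K0 by (intro mult_mono) (auto simp: K_def)
    moreover have "norm (x - x0) \<le> K0 * norm (horiz e (x - x0))" using sep0 that unfolding F_def by blast
    ultimately show ?thesis by (simp add: dist_norm norm_minus_commute)
  qed
  \<comment> \<open>The component along \<open>e\<close> alone confines the parameter to an interval
    of length 2 h / r.\<close>
  have len: "{s. dist (x + (s * r) *\<^sub>R e) z < h} \<subseteq> {((z - x) \<bullet> e) / r - h / r..((z - x) \<bullet> e) / r + h / r}"
    if "r > 0" for x z :: "real ^ 'n" and r h :: real
  proof
    fix s assume "s \<in> {s. dist (x + (s * r) *\<^sub>R e) z < h}"
    then have "norm (x + (s * r) *\<^sub>R e - z) < h" by (simp add: dist_norm)
    moreover have "\<bar>(x + (s * r) *\<^sub>R e - z) \<bullet> e\<bar> \<le> norm (x + (s * r) *\<^sub>R e - z)"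
      using Cauchy_Schwarz_ineq2[of _ e] e by (metis mult.right_neutral)
    moreover have "(x + (s * r) *\<^sub>R e - z) \<bullet> e = s * r - (z - x) \<bullet> e"
      using e by (simp add: inner_add_left inner_diff_left dot_square_norm)
    ultimately have "\<bar>s * r - (z - x) \<bullet> e\<bar> \<le> h" by linarith
    then show "s \<in> {((z - x) \<bullet> e) / r - h / r..((z - x) \<bullet> e) / r + h / r}"
      using that by (auto simp: abs_le_iff field_simps)
  qed
  have ballbound: "(\<integral>\<^sup>+x. ennreal (c * h) * indicator (cball x0 (2 * K * h)) x \<partial>?\<mu>) \<le> ennreal (c * K0 * (2 * K) ^ ?d * h ^ CARD('n))"
    if "0 \<le> c" "0 < h" for c h x0
  proof -
    have cF: "cball x0 (2 * K * h) \<inter> F \<in> sets ?\<mu>"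
      using Fb by (simp add: sets_restrict_space_iff)
    have "(\<integral>\<^sup>+x. ennreal (c * h) * indicator (cball x0 (2 * K * h)) x \<partial>?\<mu>) =
      (\<integral>\<^sup>+x. ennreal (c * h) * indicator (cball x0 (2 * K * h) \<inter> F) x \<partial>?\<mu>)"
      by (intro nn_integral_cong) (auto simp: sp indicator_def)
    also have "\<dots> = ennreal (c * h) * emeasure H (F \<inter> cball x0 (2 * K * h))"
      by (subst nn_integral_cmult_indicator[OF cF]) (simp add: emeasure_restrict_space Int_commute)
    also have "\<dots> \<le> ennreal (c * h) * ennreal (K0 * (2 * K * h) ^ ?d)"
      by (intro mult_left_mono reg) (use K that in auto)
    also have "\<dots> = ennreal (c * h * (K0 * (2 * K * h) ^ ?d))"
      by (rule ennreal_mult'[symmetric]) (use that in auto)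
    also have "c * h * (K0 * (2 * K * h) ^ ?d) = c * K0 * (2 * K) ^ ?d * h ^ CARD('n)"
      using dim by (simp add: power_mult_distrib power_eq_if[of h "CARD('n)"])
    finally show ?thesis .
  qed
  \<comment> \<open>The endpoints \<open>Y m\<close>: for a fixed boundary point the shift itself
    runs through an interval of length 2 h, which is \<open>len\<close> with rate 1.\<close>
  have reg1: "emeasure \<alpha> {m \<in> space \<alpha>. dist (Y m) z < h} \<le> ennreal (2 * K0 * (2 * K) ^ ?d * h ^ CARD('n))" (is "emeasure \<alpha> ?S \<le> _")
    if h: "0 < h" for z h
  proof (cases "?S = {}")
    case False
    then obtain x0 r0 where x0: "x0 \<in> F" "dist (x0 + r0 *\<^sub>R e) z < h" by (auto simp: sp\<alpha> Y_def)
    have S: "?S \<in> sets (?\<mu> \<Otimes>\<^sub>M ?\<tau>)" unfolding \<alpha>_def[symmetric] by measurable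
    have "emeasure \<alpha> ?S = (\<integral>\<^sup>+x. emeasure ?\<tau> (Pair x -` ?S) \<partial>?\<mu>)"
      unfolding \<alpha>_def by (rule T.emeasure_pair_measure_alt[OF S[unfolded \<alpha>_def]])
    also have "\<dots> \<le> (\<integral>\<^sup>+x. ennreal (2 * h) * indicator (cball x0 (2 * K * h)) x \<partial>?\<mu>)"
    proof (intro nn_integral_mono)
      fix x assume "x \<in> space ?\<mu>"
      show "emeasure ?\<tau> (Pair x -` ?S) \<le> ennreal (2 * h) * indicator (cball x0 (2 * K * h)) x"
      proof (cases "Pair x -` ?S = {}")
        case False
        then have "x \<in> cball x0 (2 * K * h)" using sep[OF _ x0(1) _ x0(2)] by (auto simp: sp\<alpha> Y_def)
        moreover have "emeasure ?\<tau> (Pair x -` ?S) \<le> emeasure lborel {((z - x) \<bullet> e) / 1 - h / 1..((z - x) \<bullet> e) / 1 + h / 1}"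
          by (rule emeasure_restrict_lborel_le) (use len[of 1 x z h] in \<open>auto simp: sp\<alpha> Y_def\<close>)
        ultimately show ?thesis using h by simp
      next
        case True
        then show ?thesis by (simp only: emeasure_empty zero_le)
      qed
    qed
    also note ballbound[of 2 h x0]
    finally show ?thesis using h by simp
  next
    case True
    then show ?thesis by (simp only: emeasure_empty zero_le)
  qed
  \<comment> \<open>The points of the segments are x + (s r) e. Now s varies at rate r, and r > t /
    2 keeps the interval length 2 h / r below 4 h / t; the outer factor \<open>t / 2\<close> is the
    mass of the shifts.\<close>
  have reg2: "emeasure (\<alpha> \<Otimes>\<^sub>M unit_interval)
       {q \<in> space (\<alpha> \<Otimes>\<^sub>M unit_interval). dist (fst (fst q) + snd q *\<^sub>R (Y (fst q) - fst (fst q))) z < h}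
       \<le> ennreal (t / 2 * (4 / t * K0 * (2 * K) ^ ?d) * h ^ CARD('n))" (is "emeasure _ ?S \<le> _")
    if h: "0 < h" for z h
  proof (cases "?S = {}")
    case False
    then obtain x0 r0 where x0: "x0 \<in> F" "dist (x0 + r0 *\<^sub>R e) z < h"
      by (auto simp: sp\<alpha> Y_def space_pair_measure)
    have S: "?S \<in> sets (\<alpha> \<Otimes>\<^sub>M unit_interval)" by measurable
    have "emeasure (\<alpha> \<Otimes>\<^sub>M unit_interval) ?S = (\<integral>\<^sup>+m. emeasure unit_interval (Pair m -` ?S) \<partial>\<alpha>)"
      by (rule I.emeasure_pair_measure_alt[OF S])
    also have "\<dots> \<le> (\<integral>\<^sup>+m. ennreal (4 / t * h) * indicator (cball x0 (2 * K * h)) (fst m) \<partial>\<alpha>)"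
    proof (intro nn_integral_mono)
      fix m assume m: "m \<in> space \<alpha>"
      then have r: "snd m > 0" "snd m > t / 2" using t by (auto simp: sp\<alpha>)
      show "emeasure unit_interval (Pair m -` ?S) \<le> ennreal (4 / t * h) * indicator (cball x0 (2 * K * h)) (fst m)"
      proof (cases "Pair m -` ?S = {}")
        case False
        then obtain s where "dist (fst m + (s * snd m) *\<^sub>R e) z < h" by (auto simp: Y_def)
        then have "fst m \<in> cball x0 (2 * K * h)" using sep[OF _ x0(1) _ x0(2)] m by (auto simp: sp\<alpha>)
        moreover have "emeasure unit_interval (Pair m -` ?S) \<le>
            emeasure lborel {((z - fst m) \<bullet> e) / snd m - h / snd m..((z - fst m) \<bullet> e) / snd m + h / snd m}"
          by (rule emeasure_restrict_lborel_le)
             (use len[OF r(1), of "fst m" z h] in \<open>auto simp: space_pair_measure space_restrict_space Y_def\<close>)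
        moreover have "emeasure lborel {((z - fst m) \<bullet> e) / snd m - h / snd m..((z - fst m) \<bullet> e) / snd m + h / snd m} = ennreal (2 * (h / snd m))"
          using h r by simp
        moreover have "2 * (h / snd m) \<le> 4 / t * h"
        proof -
          have "h / snd m \<le> h / (t / 2)" using h r t by (intro divide_left_mono) auto
          then show ?thesis by simp
        qed
        ultimately show ?thesis using ennreal_leI[of "2 * (h / snd m)" "4 / t * h"] by simp
      next
        case True
        then show ?thesis by (simp only: emeasure_empty zero_le)
      qed
    qed
    also have "\<dots> = (\<integral>\<^sup>+x. \<integral>\<^sup>+r. ennreal (4 / t * h) * indicator (cball x0 (2 * K * h)) x \<partial>?\<tau> \<partial>?\<mu>)"
    proof -
      have "(\<lambda>m. indicator (cball x0 (2 * K * h)) (fst m) :: ennreal) \<in> borel_measurable \<alpha>"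
        by (rule measurable_compose[OF m1]) (rule borel_measurable_indicator, simp)
      then have "(\<lambda>m. ennreal (4 / t * h) * indicator (cball x0 (2 * K * h)) (fst m)) \<in> borel_measurable \<alpha>" by measurable
      then show ?thesis unfolding \<alpha>_def by (subst T.nn_integral_fst[symmetric]) simp_all
    qed
    also have "\<dots> = (\<integral>\<^sup>+x. ennreal (t / 2) * (ennreal (4 / t * h) * indicator (cball x0 (2 * K * h)) x) \<partial>?\<mu>)"
      using t by (intro nn_integral_cong) (simp add: sp emeasure_restrict_space mult.commute)
    also have "\<dots> = ennreal (t / 2) * (\<integral>\<^sup>+x. (ennreal (4 / t * h) * indicator (cball x0 (2 * K * h)) x) \<partial>?\<mu>)"
      by (rule nn_integral_cmult) (rule borel_measurable_times_ennreal[OF borel_measurable_const ind\<mu>], simp)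
    also have "\<dots> \<le> ennreal (t / 2) * ennreal (4 / t * K0 * (2 * K) ^ ?d * h ^ CARD('n))"
      by (intro mult_left_mono ballbound) (use t h in auto)
    also have "\<dots> = ennreal (t / 2 * (4 / t * K0 * (2 * K) ^ ?d * h ^ CARD('n)))"
      by (rule ennreal_mult'[symmetric]) (use t in auto)
    finally show ?thesis by (simp only: mult.assoc)
  next
    case True
    then show ?thesis by (simp only: emeasure_empty zero_le)
  qed
  \<comment> \<open>The factor t^2 bounds the squared length of the segments, the rest is the
    constant of \<open>reg2\<close>.\<close>
  define C1 where "C1 = t\<^sup>2 * (t / 2 * (4 / t * K0 * (2 * K) ^ ?d) / unit_ball_vol (CARD('n)))"
  define C2 where "C2 = 2 * K0 * (2 * K) ^ ?d / unit_ball_vol (CARD('n))"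
  have C0: "C1 \<ge> 0" "C2 \<ge> 0" using K0 K t by (auto simp: C1_def C2_def)
  obtain C3 where C3: "C3 \<ge> 0" "\<And>\<phi>. smooth \<phi> \<Longrightarrow> (\<integral>\<^sup>+x. \<integral>\<^sup>+y. ennreal ((cmod (\<phi> y - \<phi> x))\<^sup>2) \<partial>?L \<partial>?L) \<le> ennreal C3 * energy U \<phi>"
    using UU unfolding linked_def by blast
  define v where "v = measure ?L U"
  have v: "v \<ge> 0" by (simp add: v_def)
  define C where "C = (2 * v * C1 + 2 * C2 * C3) / (t / 2)"
  have "(\<integral>\<^sup>+x. \<integral>\<^sup>+w. ennreal ((cmod (\<phi> w - \<phi> x))\<^sup>2) \<partial>?L \<partial>?\<mu>) \<le> ennreal C * energy U \<phi>" if \<phi>: "smooth \<phi>" for \<phi>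
  proof -
    have \<phi>b [measurable]: "\<phi> \<in> borel_measurable borel"
      using borel_measurable_continuous_onI[OF smooth_continuous[OF \<phi>]] .
    have \<phi>L [measurable]: "\<phi> \<in> borel_measurable ?L" and \<phi>\<mu> [measurable]: "\<phi> \<in> borel_measurable ?\<mu>"
      using fborel_smooth fL f\<mu> \<phi> by blast+
    have [measurable]: "(\<lambda>m. \<phi> (fst m)) \<in> borel_measurable \<alpha>" "(\<lambda>m. \<phi> (Y m)) \<in> borel_measurable \<alpha>"
      using measurable_compose[OF m1 \<phi>b] measurable_compose[OF Y \<phi>b] by auto
    let ?sq = "\<lambda>u w. ennreal ((cmod (u - w))\<^sup>2)"
    \<comment> \<open>The factor is the mass of \<open>?\<tau>\<close>; it turns the integral over
      \<open>?\<mu>\<close> into one over \<open>\<alpha>\<close>, where the intermediate point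
      \<open>Y m\<close> is available.\<close>
    have "ennreal (t / 2) * (\<integral>\<^sup>+x. \<integral>\<^sup>+w. ?sq (\<phi> w) (\<phi> x) \<partial>?L \<partial>?\<mu>) =
        (\<integral>\<^sup>+x. ennreal (t / 2) * (\<integral>\<^sup>+w. ?sq (\<phi> w) (\<phi> x) \<partial>?L) \<partial>?\<mu>)"
      by (rule nn_integral_cmult[symmetric]) measurable
    also have "\<dots> = (\<integral>\<^sup>+x. \<integral>\<^sup>+r. (\<integral>\<^sup>+w. ?sq (\<phi> w) (\<phi> x) \<partial>?L) \<partial>?\<tau> \<partial>?\<mu>)"
      using t by (intro nn_integral_cong) (simp add: sp emeasure_restrict_space mult.commute)
    also have "\<dots> = (\<integral>\<^sup>+m. (\<integral>\<^sup>+w. ?sq (\<phi> w) (\<phi> (fst m)) \<partial>?L) \<partial>\<alpha>)"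
      unfolding \<alpha>_def by (subst T.nn_integral_fst[symmetric]) (simp_all add: \<alpha>_def[symmetric])
    also have "\<dots> \<le> (\<integral>\<^sup>+m. (\<integral>\<^sup>+w. 2 * ?sq (\<phi> (Y m)) (\<phi> (fst m)) + 2 * ?sq (\<phi> w) (\<phi> (Y m)) \<partial>?L) \<partial>\<alpha>)"
    proof (intro nn_integral_mono)
      fix m w
      have "?sq (\<phi> w) (\<phi> (fst m)) \<le> ennreal (2 * (cmod (\<phi> w - \<phi> (Y m)))\<^sup>2 + 2 * (cmod (\<phi> (Y m) - \<phi> (fst m)))\<^sup>2)"
        by (intro ennreal_leI cmod_diff_sq_le)
      then show "?sq (\<phi> w) (\<phi> (fst m)) \<le> 2 * ?sq (\<phi> (Y m)) (\<phi> (fst m)) + 2 * ?sq (\<phi> w) (\<phi> (Y m))"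
        by (simp add: ennreal_plus ennreal_mult' add.commute)
    qed
    also have "\<dots> = (\<integral>\<^sup>+m. 2 * ?sq (\<phi> (Y m)) (\<phi> (fst m)) * ennreal v + 2 * (\<integral>\<^sup>+w. ?sq (\<phi> w) (\<phi> (Y m)) \<partial>?L) \<partial>\<alpha>)"
      by (intro nn_integral_cong) (simp add: nn_integral_add nn_integral_cmult L.emeasure_eq_measure sp v_def)
    also have "\<dots> = 2 * (\<integral>\<^sup>+m. ?sq (\<phi> (Y m)) (\<phi> (fst m)) \<partial>\<alpha>) * ennreal v + 2 * (\<integral>\<^sup>+m. \<integral>\<^sup>+w. ?sq (\<phi> w) (\<phi> (Y m)) \<partial>?L \<partial>\<alpha>)"
      by (simp add: nn_integral_add nn_integral_cmult nn_integral_multc)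
    finally have E1: "ennreal (t / 2) * (\<integral>\<^sup>+x. \<integral>\<^sup>+w. ?sq (\<phi> w) (\<phi> x) \<partial>?L \<partial>?\<mu>)
      \<le> 2 * (\<integral>\<^sup>+m. ?sq (\<phi> (Y m)) (\<phi> (fst m)) \<partial>\<alpha>) * ennreal v + 2 * (\<integral>\<^sup>+m. \<integral>\<^sup>+w. ?sq (\<phi> w) (\<phi> (Y m)) \<partial>?L \<partial>\<alpha>)" .
    have "(\<integral>\<^sup>+m. \<integral>\<^sup>+w. ?sq (\<phi> w) (\<phi> (Y m)) \<partial>?L \<partial>\<alpha>) = (\<integral>\<^sup>+w. \<integral>\<^sup>+m. ?sq (\<phi> w) (\<phi> (Y m)) \<partial>\<alpha> \<partial>?L)"
      by (rule AL.Fubini'[symmetric]) measurable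
    also have "\<dots> \<le> (\<integral>\<^sup>+w. ennreal C2 * (\<integral>\<^sup>+y. ?sq (\<phi> y) (\<phi> w) \<partial>?L) \<partial>?L)"
    proof (intro nn_integral_mono)
      fix w
      have "(\<integral>\<^sup>+m. ?sq (\<phi> w) (\<phi> (Y m)) \<partial>\<alpha>) = (\<integral>\<^sup>+m. indicator U (Y m) * ?sq (\<phi> (Y m)) (\<phi> w) \<partial>\<alpha>)"
        by (intro nn_integral_cong) (use up'[of _ 1] in \<open>auto simp: Y_def norm_minus_commute indicator_def\<close>)
      \<comment> \<open>By \<open>reg1\<close> the shifted points are distributed with density at
        most \<open>C2\<close>, so this part reduces to the inequality inside \<open>U\<close> with
        constant \<open>C3\<close>.\<close>
      also have "\<dots> \<le> ennreal (2 * K0 * (2 * K) ^ ?d / unit_ball_vol (CARD('n))) * (\<integral>\<^sup>+y. indicator U y * ?sq (\<phi> y) (\<phi> w) \<partial>lborel)"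
        using nn_integral_regular_le[OF sf Y U(1), of "\<lambda>y. (cmod (\<phi> y - \<phi> w))\<^sup>2" 1 "2 * K0 * (2 * K) ^ ?d"] reg1 K0 K
        by (simp add: continuous_on_power continuous_on_norm continuous_on_diff smooth_continuous[OF \<phi>])
      also have "(\<integral>\<^sup>+y. indicator U y * ?sq (\<phi> y) (\<phi> w) \<partial>lborel) = (\<integral>\<^sup>+y. ?sq (\<phi> y) (\<phi> w) \<partial>?L)"
        using U by (simp add: nn_integral_restrict_space mult.commute)
      finally show "(\<integral>\<^sup>+m. ?sq (\<phi> w) (\<phi> (Y m)) \<partial>\<alpha>) \<le> ennreal C2 * (\<integral>\<^sup>+y. ?sq (\<phi> y) (\<phi> w) \<partial>?L)" by (simp add: C2_def)
    qed
    also have "\<dots> = ennreal C2 * (\<integral>\<^sup>+w. \<integral>\<^sup>+y. ?sq (\<phi> y) (\<phi> w) \<partial>?L \<partial>?L)"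
      by (rule nn_integral_cmult) measurable
    also have "\<dots> \<le> ennreal C2 * (ennreal C3 * energy U \<phi>)" by (intro mult_left_mono C3 \<phi>) simp
    finally have E2: "(\<integral>\<^sup>+m. \<integral>\<^sup>+w. ?sq (\<phi> w) (\<phi> (Y m)) \<partial>?L \<partial>\<alpha>) \<le> ennreal C2 * (ennreal C3 * energy U \<phi>)" .
    have E3: "(\<integral>\<^sup>+m. ?sq (\<phi> (Y m)) (\<phi> (fst m)) \<partial>\<alpha>) \<le> ennreal C1 * energy U \<phi>"
      unfolding C1_def
    proof (rule segment_energy_le[OF sf m1 Y U(1) _ _ _ _ reg2 \<phi>, of t 1])
      fix m :: "(real ^ 'n) \<times> real" and s :: real
      assume m: "m \<in> space \<alpha>"
      then show "norm (Y m - fst m) \<le> t" using t e by (simp add: Y_def sp\<alpha> mem_Times_iff)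
      assume "0 < s" "s \<le> 1"
      then show "fst m + s *\<^sub>R (Y m - fst m) \<in> U" using up'[OF m, of s] by (simp add: Y_def)
    qed (use t K0 K in auto)
    have "ennreal (t / 2) * (\<integral>\<^sup>+x. \<integral>\<^sup>+w. ?sq (\<phi> w) (\<phi> x) \<partial>?L \<partial>?\<mu>)
      \<le> 2 * (ennreal C1 * energy U \<phi>) * ennreal v + 2 * (ennreal C2 * (ennreal C3 * energy U \<phi>))"
      by (intro order_trans[OF E1] add_mono mult_right_mono mult_left_mono E2 E3) simp_all
    also have "\<dots> = ennreal (t / 2 * C) * energy U \<phi>"
    proof -
      have tC: "t / 2 * C = 2 * v * C1 + 2 * C2 * C3" using t by (simp add: C_def)
      show ?thesis unfolding tC using C0 C3(1) v by (simp add: ennreal_plus ennreal_mult algebra_simps)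
    qed
    finally have "ennreal (2 / t) * (ennreal (t / 2) * (\<integral>\<^sup>+x. \<integral>\<^sup>+w. ?sq (\<phi> w) (\<phi> x) \<partial>?L \<partial>?\<mu>)) \<le> ennreal (2 / t) * (ennreal (t / 2 * C) * energy U \<phi>)"
      by (rule mult_left_mono) simp
    moreover have "ennreal (2 / t) * ennreal (t / 2) = 1" "ennreal (2 / t) * ennreal (t / 2 * C) = ennreal C"
      using t ennreal_mult'[of "2/t" "t/2"] ennreal_mult'[of "2/t" "t/2 * C"] by auto
    ultimately show ?thesis by (simp add: mult.assoc[symmetric])
  qed
  moreover have "C \<ge> 0" unfolding C_def using C0 C3 v t by simp
  ultimately have "linked U ?\<mu> ?L" unfolding linked_def by blast
  then show ?thesis using t Ffin unfolding F_def by blast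
qed

text \<open>Finitely many pieces as in \<open>linked_boundary_piece\<close> cover the compact
  frontier; they also show that the surface measure is finite.\<close>

lemma boundary_poincare:
  fixes U :: "(real ^ 'n) set"
  assumes dim: "CARD('n) \<ge> 2" and bd: "bounded U" and U: "lipschitz_domain U"
  shows "fborel (surface (frontier U))" "linked U (surface (frontier U)) (restrict_space lborel U)"
proof -
  let ?H = "hausdorff_measure (CARD('n) - 1) :: (real ^ 'n) measure"
  have U': "open U" "connected U" "lipschitz_boundary U" using U unfolding lipschitz_domain_def by auto
  have UU: "linked U (restrict_space lborel U) (restrict_space lborel U)" by (rule linked_domain[OF dim bd U'])
  obtain t where t: "\<And>p. p \<in> frontier U \<Longrightarrow> t p > 0 \<and> emeasure ?H (frontier U \<inter> ball p (t p)) < \<infinity> \<and>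
    linked U (restrict_space ?H (frontier U \<inter> ball p (t p))) (restrict_space lborel U)"
    using linked_boundary_piece[OF dim bd U'(1,3) UU] by metis
  have "compact (frontier U)" using bd by (rule compact_frontier_bounded)
  then obtain I where I: "I \<subseteq> frontier U" "finite I" "frontier U \<subseteq> (\<Union>p\<in>I. ball p (t p))"
    by (rule compactE_image[of _ "frontier U" "\<lambda>p. ball p (t p)"]) (use t in auto)
  have cov: "frontier U \<subseteq> (\<Union>p\<in>I. frontier U \<inter> ball p (t p))" using I(3) by blast
  have fL: "fborel (restrict_space lborel U)" by (rule fborel_restrict_lborel) (use U' bd in auto)
  show "linked U (surface (frontier U)) (restrict_space lborel U)"
    unfolding surface_def
    by (rule linked_cover[OF _ I(2) _ _ cov fL]) (use I t in auto)
  have "emeasure ?H (frontier U) \<le> emeasure ?H (\<Union>p\<in>I. frontier U \<inter> ball p (t p))"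
    by (rule emeasure_mono[OF cov]) (use I in \<open>auto intro!: sets.finite_UN simp del: Int_UN_distrib UN_simps\<close>)
  also have "\<dots> \<le> (\<Sum>p\<in>I. emeasure ?H (frontier U \<inter> ball p (t p)))"
    by (rule emeasure_subadditive_finite) (use I in auto)
  also have "\<dots> < \<infinity>" using I t by (auto simp: ennreal_sum_less_top)
  finally have "emeasure ?H (frontier U) < \<infinity>" .
  then show "fborel (surface (frontier U))"
    unfolding fborel_def surface_def
    by (intro conjI finite_measureI measurable_restrict_space1 measurable_ident_sets)
       (simp_all add: emeasure_restrict_space space_restrict_space)
qed

section \<open>Weak gradients\<close>

text \<open>Boxes form an intersection-stable generator of the Borel sets, and sets with vanishing
  integral form a Dynkin system. Its closure under complements needs the total integral to vanish;
  that is why \<open>f\<close> lives on a single box.\<close>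

lemma AE_zero_if_box_integrals_zero:
  fixes f :: "real ^ 'n \<Rightarrow> complex"
  assumes f: "integrable lebesgue f" and out: "\<And>x. x \<notin> box l u \<Longrightarrow> f x = 0"
    and box: "\<And>a b. (LINT x|lebesgue. indicator (box a b) x *\<^sub>R f x) = 0"
  shows "AE x in lebesgue. f x = 0"
proof (rule sigma_finite_measure.density_zero[OF _ f])
  show "sigma_finite_measure (lebesgue :: (real ^ 'n) measure)"
  proof
    obtain A :: "(real ^ 'n) set set" where A: "countable A" "A \<subseteq> sets lborel" "\<Union>A = space lborel" "\<And>a. a \<in> A \<Longrightarrow> emeasure lborel a \<noteq> \<infinity>"
      using lborel.sigma_finite_countable by metis
    show "\<exists>A. countable A \<and> A \<subseteq> sets lebesgue \<and> \<Union>A = space (lebesgue :: (real ^ 'n) measure) \<and> (\<forall>a\<in>A. emeasure lebesgue a \<noteq> \<infinity>)"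
      using A by (intro exI[of _ A]) (auto simp: subset_eq)
  qed
next
  have all: "(LINT x|lebesgue. f x) = 0"
  proof -
    have "(\<lambda>x. indicator (box l u) x *\<^sub>R f x) = f" using out by (auto simp: indicator_def)
    then show ?thesis using box[of l u] by simp
  qed
  have bor: "(LINT x:A|lebesgue. f x) = 0" if "A \<in> sets borel" for A
  proof -
    have "Int_stable (range (\<lambda>(a, b). box a b :: (real ^ 'n) set))"
      by (auto simp: Int_stable_def box_Int_box)
    moreover have "(range (\<lambda>(a, b). box a b :: (real ^ 'n) set)) \<subseteq> Pow UNIV" by auto
    moreover have "A \<in> sigma_sets UNIV (range (\<lambda>(a, b). box a b))"
      using that unfolding borel_eq_box by simp
    ultimately show ?thesis
    proof (induction rule: sigma_sets_induct_disjoint)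
      case (basic A)
      then show ?case using box by (auto simp: set_lebesgue_integral_def)
    next
      case empty
      then show ?case by (simp add: set_lebesgue_integral_def)
    next
      case (compl A)
      then have "A \<in> sets borel" by (simp add: borel_eq_box)
      then have "A \<in> sets lebesgue" by simp
      then have "set_integrable lebesgue A f" "set_integrable lebesgue (UNIV - A) f"
        using f by (auto simp: set_integrable_def intro!: integrable_mult_indicator)
      then have "(LINT x:A \<union> (UNIV - A)|lebesgue. f x) = (LINT x:A|lebesgue. f x) + (LINT x:(UNIV - A)|lebesgue. f x)"
        by (intro set_integral_Un) auto
      moreover have "A \<union> (UNIV - A) = UNIV" by auto
      ultimately show ?case using all compl by (simp add: set_lebesgue_integral_def)
    next
      case (union A)
      have "A i \<in> sets lebesgue" for i
        using union by (auto simp: borel_eq_box subset_eq)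
      then have "(LINT x:(\<Union>i. A i)|lebesgue. f x) = (\<Sum>i. (LINT x:(A i)|lebesgue. f x))"
        using union f
        by (intro lebesgue_integral_countable_add)
           (auto simp: disjoint_family_on_def set_integrable_def intro!: integrable_mult_indicator)
      then show ?case using union by simp
    qed
  qed
  fix A :: "(real ^ 'n) set" assume A: "A \<in> sets lebesgue"
  \<comment> \<open>A Lebesgue set differs from its Borel \<open>main_part\<close> by a null set
    only.\<close>
  have "AE x in lebesgue. x \<notin> null_part lborel A"
    using AE_notin_null_part[OF A] by (rule AE_completion)
  then have "AE x in lebesgue. indicator A x *\<^sub>R f x = indicator (main_part lborel A) x *\<^sub>R f x"
    by eventually_elim (subst main_part_null_part_Un[OF A, symmetric], auto simp: indicator_def)
  moreover have m: "main_part lborel A \<in> sets borel" using main_part_sets[OF A] by simp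
  moreover have "f \<in> borel_measurable lebesgue" using f by (rule borel_measurable_integrable)
  ultimately have "(LINT x:A|lebesgue. f x) = (LINT x:(main_part lborel A)|lebesgue. f x)"
    unfolding set_lebesgue_integral_def
    by (intro integral_cong_AE borel_measurable_scaleR borel_measurable_indicator) (use A in auto)
  then show "(LINT x:A|lebesgue. f x) = 0" using bor[OF m] by simp
qed

text \<open>Smooth, positive exactly on the open box, at most 1, and tending pointwise to the
  indicator of the box as k grows, since exp (-1 / (k y)) tends to 1 for y > 0.\<close>

definition box_bump :: "real ^ 'n \<Rightarrow> real ^ 'n \<Rightarrow> real \<Rightarrow> real ^ 'n \<Rightarrow> real" where
  "box_bump a b k x = (\<Prod>i\<in>UNIV. flat 1 (k * (x $ i - a $ i)) * flat 1 (k * (b $ i - x $ i)))"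

lemma flat1: "flat 1 x = (if x > 0 then exp (- 1 / x) else 0)"
  by (simp add: flat_def)

lemma flat1_bounds: "0 \<le> flat 1 x" "flat 1 x \<le> 1"
  by (auto simp: flat1)

lemma flat1_pos: "0 < flat 1 x \<longleftrightarrow> 0 < x"
  by (auto simp: flat1)

lemma box_bump_bounds: "0 \<le> box_bump a b k x" "box_bump a b k x \<le> 1"
  unfolding box_bump_def
  by (intro prod_nonneg prod_le_1 ballI conjI mult_le_one mult_nonneg_nonneg flat1_bounds)+

lemma box_bump_pos:
  assumes k: "k > 0" shows "box_bump a b k x > 0 \<longleftrightarrow> x \<in> box a b"
proof
  assume "x \<in> box a b"
  then have "0 < k * (x $ i - a $ i)" "0 < k * (b $ i - x $ i)" for i
    using k by (simp_all add: mem_box_cart)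
  then show "box_bump a b k x > 0" unfolding box_bump_def
    by (intro prod_pos ballI mult_pos_pos) (simp_all only: flat1_pos)
next
  assume "box_bump a b k x > 0"
  then have "(\<Prod>i\<in>UNIV. flat 1 (k * (x $ i - a $ i)) * flat 1 (k * (b $ i - x $ i))) \<noteq> 0"
    unfolding box_bump_def by linarith
  then have "flat 1 (k * (x $ i - a $ i)) \<noteq> 0 \<and> flat 1 (k * (b $ i - x $ i)) \<noteq> 0" for i
    by (simp add: prod_zero_iff)
  then have "0 < k * (x $ i - a $ i) \<and> 0 < k * (b $ i - x $ i)" for i
    using flat1_pos flat1_bounds(1) by (metis less_eq_real_def)
  then show "x \<in> box a b" using k by (simp add: mem_box_cart zero_less_mult_iff)
qed

lemma box_bump_zero: "k > 0 \<Longrightarrow> x \<notin> box a b \<Longrightarrow> box_bump a b k x = 0"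
  using box_bump_pos[of k a b x] box_bump_bounds(1)[of a b k x] by linarith

lemma smooth_box_bump: "smooth (\<lambda>x. complex_of_real (box_bump a b k x))"
  unfolding box_bump_def of_real_prod of_real_mult
proof (intro smooth_prod smooth_mult smooth_flat)
  fix i
  show "smooth (\<lambda>x. complex_of_real (k * (x $ i - a $ i)))"
    unfolding of_real_mult of_real_diff by (intro smooth_mult smooth_diff smooth_const smooth_coord)
  show "smooth (\<lambda>x. complex_of_real (k * (b $ i - x $ i)))"
    unfolding of_real_mult of_real_diff by (intro smooth_mult smooth_diff smooth_const smooth_coord)
qed simp_all

lemma box_bump_tendsto:
  fixes x :: "real ^ 'n"
  shows "(\<lambda>k. box_bump a b (real (Suc k)) x) \<longlonglongrightarrow> indicator (box a b) x"
proof (cases "x \<in> box a b")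
  case True
  have *: "(\<lambda>k. flat 1 (real (Suc k) * y)) \<longlonglongrightarrow> 1" if "y > 0" for y
  proof -
    have "(\<lambda>k. exp (- 1 / (real (Suc k) * y))) \<longlonglongrightarrow> 1" using that by real_asymp
    then show ?thesis using that by (simp add: flat1)
  qed
  have "(\<lambda>k. box_bump a b (real (Suc k)) x) \<longlonglongrightarrow> (\<Prod>i\<in>(UNIV::'n set). 1 * 1)"
    unfolding box_bump_def
  proof (rule tendsto_prod)
    fix i
    have "x $ i - a $ i > 0" "b $ i - x $ i > 0" using True by (auto simp: mem_box_cart)
    then show "(\<lambda>k. flat 1 (real (Suc k) * (x $ i - a $ i)) * flat 1 (real (Suc k) * (b $ i - x $ i))) \<longlonglongrightarrow> 1 * 1"
      by (intro tendsto_mult *)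
  qed
  then show ?thesis using True by simp
next
  case False
  then have "box_bump a b (real (Suc k)) x = 0" for k by (intro box_bump_zero) auto
  then show ?thesis using False by simp
qed

lemma test_fun_box_bump:
  assumes "k > 0" "cbox a b \<subseteq> U"
  shows "test_fun U (\<lambda>x. complex_of_real (box_bump a b k x))"
  unfolding test_fun_def
proof (intro conjI exI[of _ "cbox a b"] allI impI)
  fix x assume "x \<notin> cbox a b"
  then have "x \<notin> box a b" using box_subset_cbox by blast
  then show "complex_of_real (box_bump a b k x) = 0" using box_bump_zero assms(1) by simp
qed (use assms in \<open>auto simp: smooth_box_bump\<close>)

text \<open>The fundamental lemma of the calculus of variations. Bump functions converge boundedly
  to indicators of boxes, so dominated convergence gives vanishing box integrals.\<close>

lemma AE_zero_if_test_integrals_zero: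
  fixes f :: "real ^ 'n \<Rightarrow> complex"
  assumes U: "open U" and f: "integrable (lebesgue_on U) f"
    and test: "\<And>\<phi>. test_fun U \<phi> \<Longrightarrow> (LINT x|lebesgue_on U. f x * \<phi> x) = 0"
  shows "AE x in lebesgue_on U. f x = 0"
proof -
  have Um: "U \<inter> space lebesgue \<in> sets lebesgue" using U by simp
  have fi: "integrable lebesgue (\<lambda>x. indicator U x *\<^sub>R f x)"
    using f integrable_restrict_space[OF Um] by blast
  have box0: "(LINT x|lebesgue. indicator (box a b) x *\<^sub>R f x) = 0" if ab: "cbox a b \<subseteq> U" for a b
  proof -
    have "(\<lambda>k. LINT x|lebesgue. box_bump a b (real (Suc k)) x *\<^sub>R (indicator U x *\<^sub>R f x))
        \<longlonglongrightarrow> (LINT x|lebesgue. indicator (box a b) x *\<^sub>R (indicator U x *\<^sub>R f x))"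
    proof (rule integral_dominated_convergence[where w = "\<lambda>x. norm (indicator U x *\<^sub>R f x)"])
      have "continuous_on UNIV (box_bump a b (real (Suc k)))" for k
        using continuous_on_Re[OF smooth_continuous[OF smooth_box_bump[of a b "real (Suc k)"], of UNIV]] by simp
      then have "box_bump a b (real (Suc k)) \<in> borel_measurable lborel" for k
        unfolding measurable_lborel2 by (rule borel_measurable_continuous_onI)
      then have bm: "box_bump a b (real (Suc k)) \<in> borel_measurable lebesgue" for k
        by (rule measurable_completion)
      show "(\<lambda>x. box_bump a b (real (Suc k)) x *\<^sub>R (indicator U x *\<^sub>R f x)) \<in> borel_measurable lebesgue" for k
        by (rule borel_measurable_scaleR[OF bm borel_measurable_integrable[OF fi]])
      show "(\<lambda>x. indicator (box a b) x *\<^sub>R (indicator U x *\<^sub>R f x)) \<in> borel_measurable lebesgue"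
        by (rule borel_measurable_scaleR[OF _ borel_measurable_integrable[OF fi]]) (auto intro: borel_measurable_indicator)
      show "integrable lebesgue (\<lambda>x. norm (indicator U x *\<^sub>R f x))" by (rule integrable_norm[OF fi])
      show "AE x in lebesgue. (\<lambda>k. box_bump a b (real (Suc k)) x *\<^sub>R (indicator U x *\<^sub>R f x))
          \<longlonglongrightarrow> indicator (box a b) x *\<^sub>R (indicator U x *\<^sub>R f x)"
        by (intro AE_I2 tendsto_scaleR box_bump_tendsto tendsto_const)
      show "AE x in lebesgue. norm (box_bump a b (real (Suc k)) x *\<^sub>R (indicator U x *\<^sub>R f x)) \<le> norm (indicator U x *\<^sub>R f x)" for k
      proof (rule AE_I2)
        fix x
        have "norm (box_bump a b (real (Suc k)) x *\<^sub>R (indicator U x *\<^sub>R f x)) =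
            box_bump a b (real (Suc k)) x * norm (indicator U x *\<^sub>R f x)"
          unfolding norm_scaleR[of "box_bump a b (real (Suc k)) x"] abs_of_nonneg[OF box_bump_bounds(1)] ..
        also have "\<dots> \<le> norm (indicator U x *\<^sub>R f x)"
          by (rule mult_left_le_one_le[OF norm_ge_zero box_bump_bounds])
        finally show "norm (box_bump a b (real (Suc k)) x *\<^sub>R (indicator U x *\<^sub>R f x)) \<le> norm (indicator U x *\<^sub>R f x)" .
      qed
    qed
    moreover have "(LINT x|lebesgue. box_bump a b (real (Suc k)) x *\<^sub>R (indicator U x *\<^sub>R f x)) = 0" for k
    proof -
      have "(LINT x|lebesgue. box_bump a b (real (Suc k)) x *\<^sub>R (indicator U x *\<^sub>R f x)) =
          (LINT x|lebesgue_on U. f x * complex_of_real (box_bump a b (real (Suc k)) x))"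
        unfolding integral_restrict_space[OF Um]
        by (intro Bochner_Integration.integral_cong) (auto simp: scaleR_conv_of_real indicator_def)
      then show ?thesis using test[OF test_fun_box_bump[OF _ ab, of "real (Suc k)"]] by simp
    qed
    ultimately have "(LINT x|lebesgue. indicator (box a b) x *\<^sub>R (indicator U x *\<^sub>R f x)) = 0"
      by (simp add: LIMSEQ_const_iff)
    moreover have "(\<lambda>x. indicator (box a b) x *\<^sub>R (indicator U x *\<^sub>R f x)) = (\<lambda>x. indicator (box a b) x *\<^sub>R f x)"
      using ab box_subset_cbox[of a b] by (auto simp: indicator_def fun_eq_iff)
    ultimately show ?thesis by simp
  qed
  \<comment> \<open>Restricted to one box, \<open>f\<close> satisfies the hypotheses of
    \<open>AE_zero_if_box_integrals_zero\<close>, since intersections of boxes are boxes; the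
    boundary of the box is a null set.\<close>
  have loc: "AE x in lebesgue. x \<in> cbox a b \<longrightarrow> f x = 0" if ab: "cbox a b \<subseteq> U" for a b
  proof -
    define F where "F x = indicator (box a b) x *\<^sub>R f x" for x
    have "AE x in lebesgue. F x = 0"
    proof (rule AE_zero_if_box_integrals_zero)
      have "F = (\<lambda>x. indicator (box a b) x *\<^sub>R (indicator U x *\<^sub>R f x))"
        using ab box_subset_cbox[of a b] by (auto simp: F_def indicator_def fun_eq_iff)
      moreover have "integrable lebesgue (\<lambda>x. indicator (box a b) x *\<^sub>R (indicator U x *\<^sub>R f x))"
        by (rule integrable_mult_indicator[OF _ fi]) auto
      ultimately show "integrable lebesgue F" by (simp only:)
      show "F x = 0" if "x \<notin> box a b" for x using that by (simp add: F_def)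
      fix c d
      obtain l u where lu: "box c d \<inter> box a b = box l u" using box_Int_box by blast
      have "(\<lambda>x. indicator (box c d) x *\<^sub>R F x) = (\<lambda>x. indicator (box l u) x *\<^sub>R f x)"
        unfolding lu[symmetric] by (auto simp: F_def indicator_def fun_eq_iff)
      moreover have "(LINT x|lebesgue. indicator (box l u) x *\<^sub>R f x) = 0"
      \<comment> \<open>If the open box is empty, the closed one may be degenerate and need not lie
        in \<open>U\<close>; the integral is then trivially zero.\<close>
      proof (cases "box l u = {}")
        case False
        then have "cbox l u \<subseteq> cbox a b"
          using lu closure_mono[of "box l u" "box a b"] by (metis closure_box inf.cobounded2 inf_bot_right)
        then show ?thesis using box0 ab by blast
      qed simp
      ultimately show "(LINT x|lebesgue. indicator (box c d) x *\<^sub>R F x) = 0" by simp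
    qed
    moreover have "AE x in lebesgue. x \<notin> cbox a b - box a b"
      using negligible_frontier_interval[of a b] unfolding negligible_iff_null_sets by (rule AE_not_in)
    ultimately show ?thesis by eventually_elim (auto simp: F_def)
  qed
  \<comment> \<open>Boxes with rational corners: countably many of them exhaust \<open>U\<close>, so
    the exceptional null sets can be united.\<close>
  define ca cb I where "ca = (\<lambda>f :: real ^ 'n \<Rightarrow> real \<times> real. (\<Sum>i\<in>Basis. fst (f i) *\<^sub>R i))"
    and "cb = (\<lambda>f :: real ^ 'n \<Rightarrow> real \<times> real. (\<Sum>i\<in>Basis. snd (f i) *\<^sub>R i))"
    and "I = {f\<in>Basis \<rightarrow>\<^sub>E \<rat> \<times> \<rat>. cbox (ca f) (cb f) \<subseteq> U}"
  have UI: "U = (\<Union>f\<in>I. cbox (ca f) (cb f))"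
    using open_UNION_cbox[OF U] unfolding ca_def cb_def I_def .
  have "countable I" unfolding I_def
    by (rule countable_subset[of _ "Basis \<rightarrow>\<^sub>E \<rat> \<times> \<rat>"]) (auto intro!: countable_PiE countable_SIGMA countable_rat)
  then have "AE x in lebesgue. \<forall>f'\<in>I. x \<in> cbox (ca f') (cb f') \<longrightarrow> f x = 0"
    using loc by (subst AE_ball_countable) (auto simp: I_def)
  then have "AE x in lebesgue. x \<in> U \<longrightarrow> f x = 0" by eventually_elim (use UI in blast)
  then show ?thesis by (subst AE_restrict_space_iff[OF Um]) simp
qed

lemma partial_zero_outside:
  assumes "closed K" "\<And>x. x \<notin> K \<Longrightarrow> F x = 0" "x \<notin> K"
  shows "partial i F x = 0"
proof -
  have "(F has_derivative (\<lambda>_. 0)) (at x)"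
    by (rule has_derivative_transform_within_open[where f = "\<lambda>_. 0" and s = "- K"]) (use assms in auto)
  then show ?thesis by (simp add: partial_unique)
qed

text \<open>Translation invariance makes the integral of every difference quotient vanish. The
  quotients are bounded by the Lipschitz constant of \<open>F\<close> and live on one compact set,
  so the limit can be taken under the integral.\<close>

lemma integral_partial_zero:
  fixes F :: "real ^ 'n \<Rightarrow> complex"
  assumes F: "smooth F" and K: "compact K" "\<And>x. x \<notin> K \<Longrightarrow> F x = 0"
  shows "(LINT x|lborel. partial i F x) = 0"
proof -
  let ?e = "axis i 1 :: real ^ 'n"
  have g0: "grad F x = 0" if "x \<notin> K" for x
    using partial_zero_outside[OF compact_imp_closed[OF K(1)] K(2) that] by (simp add: grad_def vec_eq_iff)
  have "bounded (grad F ` K)"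
    using compact_continuous_image[OF continuous_on_grad[OF F] K(1)] compact_imp_bounded by blast
  then obtain B0 where B0: "\<And>x. x \<in> K \<Longrightarrow> norm (grad F x) \<le> B0" unfolding bounded_iff by blast
  define B where "B = max B0 0"
  have B: "norm (grad F x) \<le> B" for x using B0[of x] g0[of x] by (cases "x \<in> K") (auto simp: B_def)
  have lip: "norm (F y - F x) \<le> B * norm (y - x)" for x y
  proof (rule differentiable_bound[of UNIV F "\<lambda>x. frechet_derivative F (at x)"])
    show "onorm (frechet_derivative F (at z)) \<le> B" for z
    proof (rule onorm_le)
      fix v
      have "norm (frechet_derivative F (at z) v) \<le> norm v * norm (grad F z)" by (rule norm_frechet_le[OF F])
      also have "\<dots> \<le> norm v * B" by (rule mult_left_mono[OF B]) simp
      finally show "norm (frechet_derivative F (at z) v) \<le> B * norm v" by (simp add: mult.commute)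
    qed
  qed (use smooth_has_derivative[OF F] in auto)
  define h where "h k = inverse (real (Suc k))" for k
  have h: "h k > 0" "h k \<le> 1" for k by (auto simp: h_def inverse_le_1_iff)
  have h0: "h \<longlonglongrightarrow> 0" unfolding h_def by (rule LIMSEQ_inverse_real_of_nat)
  define D where "D k x = (F (x + h k *\<^sub>R ?e) - F x) /\<^sub>R h k" for k x
  \<comment> \<open>The closed 1-neighbourhood of \<open>K\<close>. It contains the supports of all
    \<open>D k\<close> because the steps are at most 1.\<close>
  define K' where "K' = {x + y |x y. x \<in> K \<and> y \<in> cball 0 1}"
  have K': "compact K'" unfolding K'_def by (rule compact_sums[OF K(1) compact_cball])
  have [measurable]: "F \<in> borel_measurable borel"
    using borel_measurable_continuous_onI[OF smooth_continuous[OF F]] .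
  have Fi: "integrable lborel F"
  proof -
    have "integrable lborel (\<lambda>x. indicator K x *\<^sub>R F x)"
      by (rule borel_integrable_compact[OF K(1) smooth_continuous[OF F]])
    moreover have "(\<lambda>x. indicator K x *\<^sub>R F x) = F" using K by (auto simp: indicator_def)
    ultimately show ?thesis by simp
  qed
  have shift: "integrable lborel (\<lambda>x. F (x + c))" "(LINT x|lborel. F (x + c)) = (LINT x|lborel. F x)" for c
  proof -
    have "integrable (distr lborel borel ((+) c)) F" using Fi by (simp add: lborel_distr_plus)
    then show "integrable lborel (\<lambda>x. F (x + c))" by (subst (asm) integrable_distr_eq) (auto simp: add.commute)
    have "(LINT x|distr lborel borel ((+) c). F x) = (LINT x|lborel. F (c + x))"
      by (rule integral_distr) auto
    then show "(LINT x|lborel. F (x + c)) = (LINT x|lborel. F x)"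
      by (simp add: lborel_distr_plus add.commute)
  qed
  have D0: "(LINT x|lborel. D k x) = 0" for k
    unfolding D_def using shift Fi by simp
  have "(\<lambda>k. LINT x|lborel. D k x) \<longlonglongrightarrow> (LINT x|lborel. partial i F x)"
  proof (rule integral_dominated_convergence[where w = "\<lambda>x. B * indicator K' x"])
    show "partial i F \<in> borel_measurable lborel"
      using borel_measurable_continuous_onI[OF smooth_continuous[OF smooth_partial[OF F]]] by simp
    show "D k \<in> borel_measurable lborel" for k unfolding D_def by measurable
    show "integrable lborel (\<lambda>x. B * indicator K' x)"
      using emeasure_bounded_finite[OF compact_imp_bounded[OF K']] borel_compact[OF K']
      by (intro integrable_mult_right integrable_real_indicator) auto
    show "AE x in lborel. (\<lambda>k. D k x) \<longlonglongrightarrow> partial i F x"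
    proof (rule AE_I2)
      fix x
      have "((\<lambda>t. F (x + t *\<^sub>R ?e)) has_derivative (\<lambda>t. frechet_derivative F (at (x + 0 *\<^sub>R ?e)) (t *\<^sub>R ?e))) (at 0)"
        by (rule has_derivative_compose[OF _ smooth_has_derivative[OF F], unfolded o_def]) (auto intro!: derivative_eq_intros)
      then have "((\<lambda>t. F (x + t *\<^sub>R ?e)) has_vector_derivative partial i F x) (at 0)"
        unfolding has_vector_derivative_def partial_def
        using linear_cmul[OF has_derivative_linear[OF smooth_has_derivative[OF F]]] by simp
      then have "((\<lambda>t. norm (F (x + t *\<^sub>R ?e) - F x - t *\<^sub>R partial i F x) / norm t) \<longlongrightarrow> 0) (at 0)"
        by (simp add: has_vector_derivative_def has_derivative_at)
      then have "((\<lambda>t. norm ((F (x + t *\<^sub>R ?e) - F x) /\<^sub>R t - partial i F x)) \<longlongrightarrow> 0) (at 0)"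
      proof (rule Lim_transform_eventually)
        have "norm (u - t *\<^sub>R v) / norm t = norm (u /\<^sub>R t - v)" if "t \<noteq> 0" for u v :: complex and t :: real
        proof -
          have "u /\<^sub>R t - v = (u - t *\<^sub>R v) /\<^sub>R t" using that by (simp add: scaleR_diff_right)
          then show ?thesis by (simp add: divide_inverse mult.commute)
        qed
        then show "\<forall>\<^sub>F t in at 0. norm (F (x + t *\<^sub>R ?e) - F x - t *\<^sub>R partial i F x) / norm t =
            norm ((F (x + t *\<^sub>R ?e) - F x) /\<^sub>R t - partial i F x)"
          by (auto simp: eventually_at_filter)
      qed
      then have "((\<lambda>t. (F (x + t *\<^sub>R ?e) - F x) /\<^sub>R t) \<longlongrightarrow> partial i F x) (at 0)"
        using Lim_null tendsto_norm_zero_iff by blast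
      then show "(\<lambda>k. D k x) \<longlonglongrightarrow> partial i F x"
        unfolding D_def by (rule filterlim_compose) (use h0 less_imp_neq[OF h(1)] in \<open>auto simp: filterlim_at\<close>)
    qed
    show "AE x in lborel. norm (D k x) \<le> B * indicator K' x" for k
    proof (rule AE_I2)
      fix x
      have "norm (D k x) \<le> B"
      proof -
        have "norm (D k x) = norm (F (x + h k *\<^sub>R ?e) - F x) / h k"
          unfolding D_def norm_scaleR using h(1)[of k] by (simp add: divide_inverse mult.commute)
        also have "\<dots> \<le> B" using lip[of "x + h k *\<^sub>R ?e" x] h(1)[of k] by (simp add: norm_axis_1 pos_divide_le_eq)
        finally show ?thesis .
      qed
      moreover have "D k x = 0" if "x \<notin> K'"
      proof -
        have "x \<notin> K" using that unfolding K'_def by (metis (mono_tags, lifting) add.right_neutral centre_in_cball mem_Collect_eq zero_le_one)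
        moreover have "x + h k *\<^sub>R ?e \<notin> K"
        proof
          assume "x + h k *\<^sub>R ?e \<in> K"
          moreover have "x = (x + h k *\<^sub>R ?e) + (- (h k *\<^sub>R ?e))" by simp
          moreover have "- (h k *\<^sub>R ?e) \<in> cball 0 1" using h[of k] by (simp add: norm_axis_1)
          ultimately have "x \<in> K'" unfolding K'_def by blast
          then show False using that by simp
        qed
        ultimately show ?thesis using K by (simp add: D_def)
      qed
      ultimately show "norm (D k x) \<le> B * indicator K' x" by (cases "x \<in> K'") auto
    qed
  qed
  then show ?thesis using D0 by (simp add: LIMSEQ_const_iff)
qed

section \<open>Estimates for square-integrable functions\<close>

lemma L2D: "f \<in> L2 M \<Longrightarrow> f \<in> borel_measurable M" "f \<in> L2 M \<Longrightarrow> integrable M (\<lambda>x. (norm (f x))\<^sup>2)"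
  by (auto simp: L2_def)

lemma L2_norm_nonneg: "0 \<le> L2_norm M f"
  by (simp add: L2_norm_def)

lemma L2_norm_sq: "(L2_norm M f)\<^sup>2 = (LINT x|M. (norm (f x))\<^sup>2)"
  by (simp add: L2_norm_def)

lemma L2_norm_cong_AE:
  assumes "AE x in M. f x = g x" "f \<in> borel_measurable M" "g \<in> borel_measurable M"
  shows "L2_norm M f = L2_norm M g"
  unfolding L2_norm_def
  using assms by (intro arg_cong[of _ _ sqrt] integral_cong_AE) (auto intro: borel_measurable_power borel_measurable_norm)

text \<open>One pointwise bound yields both membership and a norm estimate. Working with squared
  norms, at the price of factors 2 for sums, avoids Minkowski's inequality.\<close>

lemma L2_dominated:
  assumes p: "p \<in> borel_measurable M" and f: "f \<in> L2 M" and g: "g \<in> L2 M"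
    and le: "\<And>x. x \<in> space M \<Longrightarrow> (norm (p x))\<^sup>2 \<le> c * (norm (f x))\<^sup>2 + d * (norm (g x))\<^sup>2"
  shows "p \<in> L2 M" "(L2_norm M p)\<^sup>2 \<le> c * (L2_norm M f)\<^sup>2 + d * (L2_norm M g)\<^sup>2"
proof -
  have i: "integrable M (\<lambda>x. c * (norm (f x))\<^sup>2 + d * (norm (g x))\<^sup>2)"
    using L2D(2)[OF f] L2D(2)[OF g] by simp
  have pi: "integrable M (\<lambda>x. (norm (p x))\<^sup>2)"
  proof (rule Bochner_Integration.integrable_bound[OF i])
    show "(\<lambda>x. (norm (p x))\<^sup>2) \<in> borel_measurable M" using p by measurable
    show "AE x in M. norm ((norm (p x))\<^sup>2) \<le> norm (c * (norm (f x))\<^sup>2 + d * (norm (g x))\<^sup>2)"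
      using le by (intro AE_I2) fastforce
  qed
  then show "p \<in> L2 M" using p by (simp add: L2_def)
  have "(LINT x|M. (norm (p x))\<^sup>2) \<le> (LINT x|M. c * (norm (f x))\<^sup>2 + d * (norm (g x))\<^sup>2)"
    by (rule integral_mono[OF pi i le])
  then show "(L2_norm M p)\<^sup>2 \<le> c * (L2_norm M f)\<^sup>2 + d * (L2_norm M g)\<^sup>2"
    using L2D(2)[OF f] L2D(2)[OF g] by (simp add: L2_norm_sq)
qed

lemma norm_add_sq_le:
  fixes a b :: "'a::real_normed_vector"
  shows "(norm (a + b))\<^sup>2 \<le> 2 * (norm a)\<^sup>2 + 2 * (norm b)\<^sup>2"
proof -
  have "(norm (a + b))\<^sup>2 \<le> (norm a + norm b)\<^sup>2" by (intro power_mono norm_triangle_ineq) simp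
  also have "\<dots> \<le> 2 * (norm a)\<^sup>2 + 2 * (norm b)\<^sup>2"
    using sum_squares_bound[of "norm a" "norm b"] by (simp add: power2_sum)
  finally show ?thesis .
qed

lemma L2_add:
  assumes f: "f \<in> L2 M" and g: "g \<in> L2 M"
  shows "(\<lambda>x. f x + g x) \<in> L2 M" "(L2_norm M (\<lambda>x. f x + g x))\<^sup>2 \<le> 2 * (L2_norm M f)\<^sup>2 + 2 * (L2_norm M g)\<^sup>2"
  by (rule L2_dominated[OF borel_measurable_add[OF L2D(1)[OF f] L2D(1)[OF g]] f g], rule norm_add_sq_le)+

lemma L2_diff:
  assumes f: "f \<in> L2 M" and g: "g \<in> L2 M"
  shows "(\<lambda>x. f x - g x) \<in> L2 M" "(L2_norm M (\<lambda>x. f x - g x))\<^sup>2 \<le> 2 * (L2_norm M f)\<^sup>2 + 2 * (L2_norm M g)\<^sup>2"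
proof -
  have "(norm (f x - g x))\<^sup>2 \<le> 2 * (norm (f x))\<^sup>2 + 2 * (norm (g x))\<^sup>2" for x
    using norm_add_sq_le[of "f x" "- g x"] by simp
  then show "(\<lambda>x. f x - g x) \<in> L2 M" "(L2_norm M (\<lambda>x. f x - g x))\<^sup>2 \<le> 2 * (L2_norm M f)\<^sup>2 + 2 * (L2_norm M g)\<^sup>2"
    by (intro L2_dominated[OF borel_measurable_diff[OF L2D(1)[OF f] L2D(1)[OF g]] f g]; blast)+
qed

text \<open>Cauchy-Schwarz for an integrand that is only dominated by a product of norms, so that
  products of scalars and the weighted \<open>cdot\<close> of gradients are covered alike.\<close>

lemma L2_pairing:
  fixes p :: "'m \<Rightarrow> complex"
  assumes p: "p \<in> borel_measurable M" and f: "f \<in> L2 M" and g: "g \<in> L2 M" and c: "0 \<le> c"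
    and le: "\<And>x. x \<in> space M \<Longrightarrow> norm (p x) \<le> c * (norm (f x) * norm (g x))"
  shows "integrable M p" "norm (LINT x|M. p x) \<le> c * (L2_norm M f * L2_norm M g)"
proof -
  have [measurable]: "f \<in> borel_measurable M" "g \<in> borel_measurable M" using L2D(1) f g by auto
  have fg: "integrable M (\<lambda>x. norm (f x) * norm (g x))"
  proof (rule Bochner_Integration.integrable_bound[OF Bochner_Integration.integrable_add[OF L2D(2)[OF f] L2D(2)[OF g]]])
    show "AE x in M. norm (norm (f x) * norm (g x)) \<le> norm ((norm (f x))\<^sup>2 + (norm (g x))\<^sup>2)"
    proof (rule AE_I2)
      fix x
      have "norm (norm (f x) * norm (g x)) \<le> 2 * norm (f x) * norm (g x)" by simp
      also note sum_squares_bound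
      also have "(norm (f x))\<^sup>2 + (norm (g x))\<^sup>2 \<le> norm ((norm (f x))\<^sup>2 + (norm (g x))\<^sup>2)" by simp
      finally show "norm (norm (f x) * norm (g x)) \<le> norm ((norm (f x))\<^sup>2 + (norm (g x))\<^sup>2)" .
    qed
  qed measurable
  show pi: "integrable M p"
    by (rule Bochner_Integration.integrable_bound[OF integrable_mult_right[OF fg, of c] p])
       (use le c in \<open>auto intro!: AE_I2 simp: abs_mult\<close>)
  have "norm (LINT x|M. p x) \<le> (LINT x|M. norm (p x))" by (rule integral_norm_bound)
  also have "\<dots> \<le> (LINT x|M. c * (norm (f x) * norm (g x)))"
    by (rule integral_mono) (use pi fg le in auto)
  also have "\<dots> = c * (LINT x|M. norm (f x) * norm (g x))" by simp
  also have "(LINT x|M. norm (f x) * norm (g x)) \<le> L2_norm M f * L2_norm M g"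
  proof (rule power2_le_imp_le)
    have nn: "(\<integral>\<^sup>+x. ennreal (norm (f x)) * ennreal (norm (g x)) \<partial>M) = ennreal (LINT x|M. norm (f x) * norm (g x))"
      using nn_integral_eq_integral[OF fg] by (simp add: ennreal_mult)
    have "(ennreal (LINT x|M. norm (f x) * norm (g x)))\<^sup>2 \<le>
        (\<integral>\<^sup>+x. (ennreal (norm (f x)))\<^sup>2 \<partial>M) * (\<integral>\<^sup>+x. (ennreal (norm (g x)))\<^sup>2 \<partial>M)"
      unfolding nn[symmetric] by (rule Cauchy_Schwarz_nn_integral) measurable
    also have "\<dots> = ennreal ((L2_norm M f * L2_norm M g)\<^sup>2)"
      using nn_integral_eq_integral[OF L2D(2)[OF f]] nn_integral_eq_integral[OF L2D(2)[OF g]]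
      by (simp add: ennreal_power L2_norm_sq power_mult_distrib ennreal_mult)
    finally show "(LINT x|M. norm (f x) * norm (g x))\<^sup>2 \<le> (L2_norm M f * L2_norm M g)\<^sup>2"
      by (simp add: ennreal_power integral_nonneg)
  qed (simp add: L2_norm_nonneg)
  finally show "norm (LINT x|M. p x) \<le> c * (L2_norm M f * L2_norm M g)" using c by (simp add: mult_left_mono)
qed

section \<open>Complex vector fields and changes of domain\<close>

lemma borel_measurable_vec_nth: "G \<in> borel_measurable M \<Longrightarrow> (\<lambda>x. (G x :: complex ^ 'n) $ i) \<in> borel_measurable M"
  by (rule borel_measurable_continuous_on[where f = "\<lambda>v. v $ i"]) (auto intro!: continuous_intros)

lemma borel_measurable_vec_lambda:
  assumes "\<And>i. (\<lambda>x. f i x :: complex) \<in> borel_measurable M"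
  shows "(\<lambda>x. (\<chi> i. f i x) :: complex ^ 'n) \<in> borel_measurable M"
proof -
  have "(\<lambda>x. (\<chi> i. f i x) :: complex ^ 'n) = (\<lambda>x. \<Sum>i\<in>UNIV. axis i (f i x))"
    by (auto simp: vec_eq_iff axis_def fun_eq_iff)
  moreover have "(\<lambda>x. axis i (f i x) :: complex ^ 'n) \<in> borel_measurable M" for i
    by (rule borel_measurable_continuous_on[where f = "axis i", OF _ assms])
       (auto simp: axis_def[abs_def] intro!: continuous_on_vec_lambda, case_tac "ia = i", auto)
  ultimately show ?thesis by simp
qed

lemma norm_vector_scalar_mult: "norm (c *s v) = cmod c * norm (v :: complex ^ 'n)"
  by (simp add: norm_vec_def norm_mult L2_set_right_distrib)

lemma borel_measurable_vector_scalar_mult: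
  "f \<in> borel_measurable M \<Longrightarrow> G \<in> borel_measurable M \<Longrightarrow> (\<lambda>x. f x *s (G x :: complex ^ 'n)) \<in> borel_measurable M"
  unfolding vector_scalar_mult_def by (intro borel_measurable_vec_lambda borel_measurable_times borel_measurable_vec_nth)

lemma norm_cdot_le: "cmod (cdot v w) \<le> norm v * norm w"
proof -
  have "cmod (cdot v w) \<le> (\<Sum>i\<in>UNIV. \<bar>norm (v $ i)\<bar> * \<bar>norm (w $ i)\<bar>)"
    unfolding cdot_def by (rule order_trans[OF norm_sum]) (simp add: norm_mult)
  also have "\<dots> \<le> L2_set (\<lambda>i. norm (v $ i)) UNIV * L2_set (\<lambda>i. norm (w $ i)) UNIV"
    by (rule L2_set_mult_ineq)
  finally show ?thesis by (simp add: norm_vec_def)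
qed

lemma borel_measurable_cdot:
  "F \<in> borel_measurable M \<Longrightarrow> G \<in> borel_measurable M \<Longrightarrow> (\<lambda>x. cdot (F x) (G x)) \<in> borel_measurable M"
  unfolding cdot_def by (intro borel_measurable_sum borel_measurable_times borel_measurable_vec_nth)

lemma continuous_borel_measurable_lebesgue_on:
  fixes f :: "real ^ 'n \<Rightarrow> 'b::euclidean_space"
  assumes "continuous_on UNIV f" shows "f \<in> borel_measurable (lebesgue_on U)"
  using measurable_completion[of f lborel borel] borel_measurable_continuous_onI[OF assms]
  by (intro measurable_restrict_space1) simp

lemma continuous_L2:
  fixes f :: "real ^ 'n \<Rightarrow> 'b::euclidean_space"
  assumes U: "open U" "bounded U" and f: "continuous_on UNIV f"
  shows "f \<in> L2 (lebesgue_on U)"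
proof -
  have "compact (f ` closure U)"
    by (rule compact_continuous_image[OF continuous_on_subset[OF f subset_UNIV]]) (use U in simp)
  from compact_imp_bounded[OF this]
  obtain B where B: "\<And>x. x \<in> closure U \<Longrightarrow> norm (f x) \<le> B"
    unfolding bounded_iff ball_simps by auto
  have m: "f \<in> borel_measurable (lebesgue_on U)" by (rule continuous_borel_measurable_lebesgue_on[OF f])
  have "finite_measure (lebesgue_on U)"
    using U by (intro finite_measure_lebesgue_on lmeasurable_open)
  then have "integrable (lebesgue_on U) (\<lambda>x. B\<^sup>2)" by (simp add: finite_measure.integrable_const)
  then have "integrable (lebesgue_on U) (\<lambda>x. (norm (f x))\<^sup>2)"
  proof (rule Bochner_Integration.integrable_bound)
    show "(\<lambda>x. (norm (f x))\<^sup>2) \<in> borel_measurable (lebesgue_on U)" using m by measurable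
    show "AE x in lebesgue_on U. norm ((norm (f x))\<^sup>2) \<le> norm (B\<^sup>2)"
    proof (rule AE_I2)
      fix x assume "x \<in> space (lebesgue_on U)"
      then have "norm (f x) \<le> B" using B closure_subset[of U] by (auto simp: space_restrict_space)
      then show "norm ((norm (f x))\<^sup>2) \<le> norm (B\<^sup>2)" using power_mono[of "norm (f x)" B 2] by simp
    qed
  qed
  then show ?thesis using m by (simp add: L2_def)
qed

lemma lebesgue_on_transfer:
  fixes f :: "real ^ 'n \<Rightarrow> 'b::euclidean_space"
  assumes "open U" "open V" "\<And>x. x \<in> U \<Longrightarrow> x \<notin> V \<Longrightarrow> f x = 0" "V \<subseteq> U"
  shows "(LINT x|lebesgue_on U. f x) = (LINT x|lebesgue_on V. f x)"
    "integrable (lebesgue_on U) f \<longleftrightarrow> integrable (lebesgue_on V) f"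
proof -
  have "(\<lambda>x. indicator U x *\<^sub>R f x) = (\<lambda>x. indicator V x *\<^sub>R f x)"
    using assms by (auto simp: fun_eq_iff indicator_def)
  then show "(LINT x|lebesgue_on U. f x) = (LINT x|lebesgue_on V. f x)"
    "integrable (lebesgue_on U) f \<longleftrightarrow> integrable (lebesgue_on V) f"
    using assms by (simp_all add: integral_restrict_space integrable_restrict_space)
qed

lemma lebesgue_on_subset:
  fixes f :: "real ^ 'n \<Rightarrow> 'b::euclidean_space"
  assumes "open U" "open V" "V \<subseteq> U"
  shows "f \<in> borel_measurable (lebesgue_on U) \<Longrightarrow> f \<in> borel_measurable (lebesgue_on V)"
    and "integrable (lebesgue_on U) f \<Longrightarrow> integrable (lebesgue_on V) f"
proof -
  have "lebesgue_on V = restrict_space (lebesgue_on U) V"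
    using assms by (simp add: restrict_restrict_space Int_absorb1)
  then show "f \<in> borel_measurable (lebesgue_on U) \<Longrightarrow> f \<in> borel_measurable (lebesgue_on V)"
    using measurable_restrict_space1 by metis
  have e: "(\<lambda>x. indicator V x *\<^sub>R f x) = (\<lambda>x. indicator V x *\<^sub>R (indicator U x *\<^sub>R f x))"
    using assms by (auto simp: fun_eq_iff indicator_def)
  assume "integrable (lebesgue_on U) f"
  then have "integrable lebesgue (\<lambda>x. indicator U x *\<^sub>R f x)"
    using assms by (simp add: integrable_restrict_space)
  then have "integrable lebesgue (\<lambda>x. indicator V x *\<^sub>R (indicator U x *\<^sub>R f x))"
    by (rule integrable_mult_indicator[rotated]) (use assms in auto)
  then show "integrable (lebesgue_on V) f" unfolding e[symmetric]
    using assms by (simp add: integrable_restrict_space)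
qed

lemma L2_subset:
  fixes f :: "real ^ 'n \<Rightarrow> 'b::euclidean_space"
  assumes "open U" "open V" "V \<subseteq> U" "f \<in> L2 (lebesgue_on U)"
  shows "f \<in> L2 (lebesgue_on V)" "L2_norm (lebesgue_on V) f \<le> L2_norm (lebesgue_on U) f"
proof -
  have i: "integrable (lebesgue_on U) (\<lambda>x. (norm (f x))\<^sup>2)" using L2D(2)[OF assms(4)] .
  then have iV: "integrable (lebesgue_on V) (\<lambda>x. (norm (f x))\<^sup>2)" using lebesgue_on_subset(2)[OF assms(1-3)] by blast
  then show "f \<in> L2 (lebesgue_on V)"
    using lebesgue_on_subset(1)[OF assms(1-3) L2D(1)[OF assms(4)]] by (simp add: L2_def)
  show "L2_norm (lebesgue_on V) f \<le> L2_norm (lebesgue_on U) f"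
    unfolding L2_norm_def
  proof (rule real_sqrt_le_mono)
    have "(LINT x|lebesgue_on V. (norm (f x))\<^sup>2) = (LINT x|lebesgue. indicator V x *\<^sub>R (norm (f x))\<^sup>2)"
      using assms by (simp add: integral_restrict_space)
    also have "\<dots> \<le> (LINT x|lebesgue. indicator U x *\<^sub>R (norm (f x))\<^sup>2)"
      by (rule integral_mono) (use i iV assms in \<open>auto simp: integrable_restrict_space indicator_def\<close>)
    also have "\<dots> = (LINT x|lebesgue_on U. (norm (f x))\<^sup>2)"
      using assms by (simp add: integral_restrict_space)
    finally show "(LINT x|lebesgue_on V. (norm (f x))\<^sup>2) \<le> (LINT x|lebesgue_on U. (norm (f x))\<^sup>2)" .
  qed
qed

section \<open>Test functions and the calculus of weak gradients\<close>

lemma test_funD: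
  assumes "test_fun U \<phi>"
  shows "smooth \<phi>" "x \<notin> U \<Longrightarrow> \<phi> x = 0" "x \<notin> U \<Longrightarrow> partial i \<phi> x = 0"
proof -
  obtain K where K: "compact K" "K \<subseteq> U" "\<And>x. x \<notin> K \<Longrightarrow> \<phi> x = 0" and s: "smooth \<phi>"
    using assms unfolding test_fun_def by blast
  show "smooth \<phi>" by fact
  show "x \<notin> U \<Longrightarrow> \<phi> x = 0" using K by blast
  show "x \<notin> U \<Longrightarrow> partial i \<phi> x = 0"
    using partial_zero_outside[of K \<phi> x i, OF compact_imp_closed[OF K(1)] K(3)] K(2) by blast
qed

lemma test_fun_mono: "test_fun V \<phi> \<Longrightarrow> V \<subseteq> U \<Longrightarrow> test_fun U \<phi>"
  unfolding test_fun_def by blast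

lemma test_fun_mult:
  assumes "test_fun U \<phi>" "smooth \<eta>" shows "test_fun U (\<lambda>x. \<eta> x * \<phi> x)"
proof -
  obtain K where "compact K" "K \<subseteq> U" "\<And>x. x \<notin> K \<Longrightarrow> \<phi> x = 0" "smooth \<phi>"
    using assms(1) unfolding test_fun_def by blast
  then show ?thesis unfolding test_fun_def
    by (intro conjI exI[of _ K] smooth_mult assms) auto
qed

lemma test_fun_cnj:
  assumes "test_fun U \<phi>" shows "test_fun U (\<lambda>x. cnj (\<phi> x))"
proof -
  obtain K where "compact K" "K \<subseteq> U" "\<And>x. x \<notin> K \<Longrightarrow> \<phi> x = 0" "smooth \<phi>"
    using assms(1) unfolding test_fun_def by blast
  then show ?thesis unfolding test_fun_def
    by (intro conjI exI[of _ K] smooth_cnj assms) auto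
qed

lemma smooth_L2: "open U \<Longrightarrow> bounded U \<Longrightarrow> smooth \<phi> \<Longrightarrow> \<phi> \<in> L2 (lebesgue_on U)"
  by (intro continuous_L2 smooth_continuous)

lemma smooth_grad_L2: "open U \<Longrightarrow> bounded U \<Longrightarrow> smooth \<phi> \<Longrightarrow> grad \<phi> \<in> L2 (lebesgue_on U)"
  by (intro continuous_L2 continuous_on_grad)

lemma L2_mult_integrable:
  fixes f g :: "'m \<Rightarrow> complex"
  assumes "f \<in> L2 M" "g \<in> L2 M" shows "integrable M (\<lambda>x. f x * g x)"
  by (rule L2_pairing(1)[OF borel_measurable_times[OF L2D(1)[OF assms(1)] L2D(1)[OF assms(2)]] assms, of 1])
     (simp_all add: norm_mult)

lemma L2_vec_nth:
  assumes "G \<in> L2 M" shows "(\<lambda>x. (G x :: complex ^ 'n) $ i) \<in> L2 M"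
proof (rule L2_dominated(1)[OF borel_measurable_vec_nth[OF L2D(1)[OF assms]] assms assms, where c = 1 and d = 0])
  show "(norm (G x $ i))\<^sup>2 \<le> 1 * (norm (G x))\<^sup>2 + 0 * (norm (G x))\<^sup>2" for x
    using power_mono[OF Finite_Cartesian_Product.norm_nth_le[of "G x" i] norm_ge_zero, of 2] by simp
qed

text \<open>Boundedness puts every smooth function and its gradient into \<open>L2\<close>, which
  settles the integrability conditions below.\<close>

locale bounded_open =
  fixes U :: "(real ^ 'n) set"
  assumes op: "open U" and bd: "bounded U"
begin

lemma weak_gradient_integrable:
  assumes "u \<in> L2 (lebesgue_on U)" "G \<in> L2 (lebesgue_on U)" "smooth \<phi>"
  shows "integrable (lebesgue_on U) (\<lambda>x. u x * partial i \<phi> x)" "integrable (lebesgue_on U) (\<lambda>x. G x $ i * \<phi> x)"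
  using assms op bd by (auto intro!: L2_mult_integrable smooth_L2 smooth_partial L2_vec_nth)

text \<open>The fundamental lemma, applied in each component. It allows \<open>wgrad\<close> to be
  replaced by any explicitly known gradient under integrals.\<close>

lemma weak_gradient_unique:
  assumes u: "has_weak_gradient U u G" "has_weak_gradient U u H"
  shows "AE x in lebesgue_on U. G x = H x"
proof -
  have GH: "G \<in> L2 (lebesgue_on U)" "H \<in> L2 (lebesgue_on U)" using u by (auto simp: has_weak_gradient_def)
  have "AE x in lebesgue_on U. G x $ i - H x $ i = 0" for i
  proof (rule AE_zero_if_test_integrals_zero[OF op])
    have one: "(\<lambda>x. 1 :: complex) \<in> L2 (lebesgue_on U)" by (rule smooth_L2[OF op bd smooth_const])
    show "integrable (lebesgue_on U) (\<lambda>x. G x $ i - H x $ i)"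
      using L2_mult_integrable[OF L2_vec_nth[OF GH(1)] one] L2_mult_integrable[OF L2_vec_nth[OF GH(2)] one] by simp
    fix \<phi> assume t: "test_fun U \<phi>"
    have "(LINT x|lebesgue_on U. (G x $ i - H x $ i) * \<phi> x) =
      (LINT x|lebesgue_on U. G x $ i * \<phi> x) - (LINT x|lebesgue_on U. H x $ i * \<phi> x)"
      unfolding left_diff_distrib
      by (intro Bochner_Integration.integral_diff L2_mult_integrable L2_vec_nth GH smooth_L2 op bd test_funD(1)[OF t])
    also have "\<dots> = 0"
    proof -
      have "(LINT x|lebesgue_on U. u x * partial i \<phi> x) = - (LINT x|lebesgue_on U. G x $ i * \<phi> x)"
        "(LINT x|lebesgue_on U. u x * partial i \<phi> x) = - (LINT x|lebesgue_on U. H x $ i * \<phi> x)"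
        using u t unfolding has_weak_gradient_def by blast+
      then show ?thesis by simp
    qed
    finally show "(LINT x|lebesgue_on U. (G x $ i - H x $ i) * \<phi> x) = 0" .
  qed
  then have "AE x in lebesgue_on U. \<forall>i\<in>UNIV. G x $ i - H x $ i = 0" by (subst AE_finite_all) auto
  then show ?thesis by eventually_elim (simp add: vec_eq_iff)
qed

lemma has_weak_gradient_wgrad: "has_weak_gradient U u G \<Longrightarrow> has_weak_gradient U u (wgrad U u)"
  unfolding wgrad_def by (rule someI[of "has_weak_gradient U u"])

lemma wgrad_AE: "has_weak_gradient U u G \<Longrightarrow> AE x in lebesgue_on U. wgrad U u x = G x"
  using has_weak_gradient_wgrad weak_gradient_unique by blast

lemma H1D:
  assumes "u \<in> H1 U"
  shows "u \<in> L2 (lebesgue_on U)" "has_weak_gradient U u (wgrad U u)" "wgrad U u \<in> L2 (lebesgue_on U)"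
  using assms has_weak_gradient_wgrad unfolding H1_def has_weak_gradient_def by blast+

lemma H1_norm_eq:
  assumes "has_weak_gradient U u G"
  shows "(H1_norm U u)\<^sup>2 = (L2_norm (lebesgue_on U) u)\<^sup>2 + (L2_norm (lebesgue_on U) G)\<^sup>2"
proof -
  have "L2_norm (lebesgue_on U) (wgrad U u) = L2_norm (lebesgue_on U) G"
    by (rule L2_norm_cong_AE[OF wgrad_AE[OF assms]])
       (use assms has_weak_gradient_wgrad[OF assms] in \<open>auto simp: has_weak_gradient_def L2D(1)\<close>)
  then show ?thesis by (simp add: H1_norm_def)
qed

lemma weak_gradient_add_scaled:
  assumes u: "u \<in> L2 (lebesgue_on U)" "has_weak_gradient U u G"
    and v: "v \<in> L2 (lebesgue_on U)" "has_weak_gradient U v H"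
  shows "has_weak_gradient U (\<lambda>x. u x + c * v x) (\<lambda>x. G x + c *s H x)"
proof -
  have GH: "G \<in> L2 (lebesgue_on U)" "H \<in> L2 (lebesgue_on U)" using u v by (auto simp: has_weak_gradient_def)
  have cH: "(\<lambda>x. c *s H x) \<in> L2 (lebesgue_on U)"
    by (rule L2_dominated(1)[OF borel_measurable_vector_scalar_mult[OF borel_measurable_const L2D(1)[OF GH(2)]] GH(2) GH(2),
          where c = "(cmod c)\<^sup>2" and d = 0])
       (simp add: norm_vector_scalar_mult power_mult_distrib)
  have "(LINT x|lebesgue_on U. (u x + c * v x) * partial i \<phi> x) = - (LINT x|lebesgue_on U. (G x + c *s H x) $ i * \<phi> x)"
    if t: "test_fun U \<phi>" for \<phi> i
  proof -
    have s: "smooth \<phi>" by (rule test_funD(1)[OF t])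
    note I = weak_gradient_integrable[OF u(1) GH(1) s, of i] weak_gradient_integrable[OF v(1) GH(2) s, of i]
    have "(LINT x|lebesgue_on U. (u x + c * v x) * partial i \<phi> x) =
       (LINT x|lebesgue_on U. u x * partial i \<phi> x + c * (v x * partial i \<phi> x))"
      by (simp add: algebra_simps)
    also have "\<dots> = (LINT x|lebesgue_on U. u x * partial i \<phi> x) + c * (LINT x|lebesgue_on U. v x * partial i \<phi> x)"
      using I by simp
    also have "\<dots> = - ((LINT x|lebesgue_on U. G x $ i * \<phi> x) + c * (LINT x|lebesgue_on U. H x $ i * \<phi> x))"
      using u v t unfolding has_weak_gradient_def by simp
    also have "(LINT x|lebesgue_on U. G x $ i * \<phi> x) + c * (LINT x|lebesgue_on U. H x $ i * \<phi> x) =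
       (LINT x|lebesgue_on U. G x $ i * \<phi> x + c * (H x $ i * \<phi> x))"
      using I by simp
    also have "\<dots> = (LINT x|lebesgue_on U. (G x + c *s H x) $ i * \<phi> x)"
      by (simp add: algebra_simps)
    finally show ?thesis .
  qed
  then show ?thesis using L2_add(1)[OF GH(1) cH] unfolding has_weak_gradient_def by blast
qed

text \<open>Partial derivatives are taken in real directions and commute with conjugation, so the
  conjugate of a test function can be used.\<close>

lemma weak_gradient_cnj:
  assumes u: "has_weak_gradient U u G"
  shows "has_weak_gradient U (\<lambda>x. cnj (u x)) (\<lambda>x. \<chi> i. cnj (G x $ i))"
proof -
  have G: "G \<in> L2 (lebesgue_on U)" using u by (auto simp: has_weak_gradient_def)
  have n: "norm ((\<chi> i. cnj (v $ i)) :: complex ^ 'n) = norm v" for v :: "complex ^ 'n"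
    by (simp add: norm_vec_def)
  have m: "(\<lambda>x. \<chi> i. cnj (G x $ i)) \<in> borel_measurable (lebesgue_on U)"
    by (intro borel_measurable_vec_lambda)
       (rule borel_measurable_continuous_on[where f = cnj, OF continuous_on_cnj[OF continuous_on_id] borel_measurable_vec_nth[OF L2D(1)[OF G]]])
  have "(\<lambda>x. \<chi> i. cnj (G x $ i)) \<in> L2 (lebesgue_on U)"
    by (rule L2_dominated(1)[OF m G G, where c = 1 and d = 0]) (simp add: n)
  moreover have "(LINT x|lebesgue_on U. cnj (u x) * partial i \<phi> x) = - (LINT x|lebesgue_on U. (\<chi> i. cnj (G x $ i)) $ i * \<phi> x)"
    if t: "test_fun U \<phi>" for \<phi> i
  proof -
    have s: "smooth \<phi>" by (rule test_funD(1)[OF t])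
    have "(LINT x|lebesgue_on U. cnj (u x) * partial i \<phi> x) = (LINT x|lebesgue_on U. cnj (u x * partial i (\<lambda>x. cnj (\<phi> x)) x))"
      by (simp add: partial_cnj[OF s])
    also have "\<dots> = cnj (LINT x|lebesgue_on U. u x * partial i (\<lambda>x. cnj (\<phi> x)) x)"
      by (rule Bochner_Integration.integral_cnj)
    also have "\<dots> = cnj (- (LINT x|lebesgue_on U. G x $ i * cnj (\<phi> x)))"
      using u test_fun_cnj[OF t] unfolding has_weak_gradient_def by simp
    also have "\<dots> = - (LINT x|lebesgue_on U. cnj (G x $ i * cnj (\<phi> x)))"
      by (simp only: Bochner_Integration.integral_cnj complex_cnj_minus)
    finally show ?thesis by simp
  qed
  ultimately show ?thesis unfolding has_weak_gradient_def by blast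
qed

text \<open>The product with a test function has compact support, so its partial derivatives
  integrate to zero; Leibniz' rule splits this integral.\<close>

lemma weak_gradient_smooth:
  assumes s: "smooth \<phi>" shows "has_weak_gradient U \<phi> (grad \<phi>)"
  unfolding has_weak_gradient_def
proof (intro conjI allI impI)
  show "grad \<phi> \<in> L2 (lebesgue_on U)" by (rule smooth_grad_L2[OF op bd s])
  fix \<psi> i assume t: "test_fun U \<psi>"
  then obtain K where K: "compact K" "K \<subseteq> U" "\<And>x. x \<notin> K \<Longrightarrow> \<psi> x = 0" and s': "smooth \<psi>"
    unfolding test_fun_def by blast
  define F where "F x = \<phi> x * \<psi> x" for x
  have F: "smooth F" unfolding F_def by (rule smooth_mult[OF s s'])
  have pF: "partial i F x = partial i \<phi> x * \<psi> x + \<phi> x * partial i \<psi> x" for x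
    unfolding F_def by (rule partial_mult[OF s s'])
  have "(LINT x|lebesgue_on U. \<phi> x * partial i \<psi> x) + (LINT x|lebesgue_on U. grad \<phi> x $ i * \<psi> x) =
     (LINT x|lebesgue_on U. partial i F x)"
    using weak_gradient_integrable[OF smooth_L2[OF op bd s] smooth_grad_L2[OF op bd s] s', of i]
    by (simp add: pF grad_def add.commute)
  also have "\<dots> = (LINT x|lebesgue_on UNIV. partial i F x)"
    by (rule lebesgue_on_transfer(1)[symmetric])
       (use op K test_funD(2,3)[OF t] in \<open>auto simp: pF\<close>)
  also have "\<dots> = (LINT x|lborel. partial i F x)"
    using borel_measurable_continuous_onI[OF smooth_continuous[OF smooth_partial[OF F]]]
    by (simp add: lebesgue_on_UNIV_eq integral_completion)
  also have "\<dots> = 0"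
    by (rule integral_partial_zero[OF F K(1)]) (simp add: F_def K(3))
  finally show "(LINT x|lebesgue_on U. \<phi> x * partial i \<psi> x) = - (LINT x|lebesgue_on U. grad \<phi> x $ i * \<psi> x)"
    by (simp add: add_eq_0_iff2)
qed

lemma L2_mult_bounded:
  fixes f :: "real ^ 'n \<Rightarrow> complex"
  assumes f: "f \<in> L2 (lebesgue_on U)" and e: "continuous_on UNIV \<eta>"
  shows "(\<lambda>x. \<eta> x * f x) \<in> L2 (lebesgue_on U)"
    "G \<in> L2 (lebesgue_on U) \<Longrightarrow> (\<lambda>x. \<eta> x *s (G x :: complex ^ 'm)) \<in> L2 (lebesgue_on U)"
    "continuous_on UNIV H \<Longrightarrow> (\<lambda>x. f x *s (H x :: complex ^ 'm)) \<in> L2 (lebesgue_on U)"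
proof -
  have bnd: "\<exists>B. \<forall>x\<in>U. norm (h x) \<le> B" if "continuous_on UNIV h" for h :: "real ^ 'n \<Rightarrow> 'b::euclidean_space"
  proof -
    have "compact (h ` closure U)"
      by (rule compact_continuous_image[OF continuous_on_subset[OF that subset_UNIV]]) (use bd in simp)
    from compact_imp_bounded[OF this] obtain B where "\<forall>x\<in>closure U. norm (h x) \<le> B"
      unfolding bounded_iff ball_simps by auto
    then show ?thesis using closure_subset[of U] by (intro exI[of _ B]) auto
  qed
  have em: "\<eta> \<in> borel_measurable (lebesgue_on U)" by (rule continuous_borel_measurable_lebesgue_on[OF e])
  obtain B where B: "\<And>x. x \<in> U \<Longrightarrow> cmod (\<eta> x) \<le> B" using bnd[OF e] by blast
  show "(\<lambda>x. \<eta> x * f x) \<in> L2 (lebesgue_on U)"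
  proof (rule L2_dominated(1)[OF borel_measurable_times[OF em L2D(1)[OF f]] f f, where c = "B\<^sup>2" and d = 0])
    fix x assume "x \<in> space (lebesgue_on U)"
    then have "(cmod (\<eta> x))\<^sup>2 \<le> B\<^sup>2" using B by (intro power_mono) (auto simp: space_restrict_space)
    then show "(norm (\<eta> x * f x))\<^sup>2 \<le> B\<^sup>2 * (norm (f x))\<^sup>2 + 0 * (norm (f x))\<^sup>2"
      by (simp add: norm_mult power_mult_distrib mult_right_mono)
  qed
  show "(\<lambda>x. \<eta> x *s (G x :: complex ^ 'm)) \<in> L2 (lebesgue_on U)" if "G \<in> L2 (lebesgue_on U)"
  proof (rule L2_dominated(1)[OF borel_measurable_vector_scalar_mult[OF em L2D(1)[OF that]] that that, where c = "B\<^sup>2" and d = 0])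
    fix x assume "x \<in> space (lebesgue_on U)"
    then have "(cmod (\<eta> x))\<^sup>2 \<le> B\<^sup>2" using B by (intro power_mono) (auto simp: space_restrict_space)
    then show "(norm (\<eta> x *s G x))\<^sup>2 \<le> B\<^sup>2 * (norm (G x))\<^sup>2 + 0 * (norm (G x))\<^sup>2"
      by (simp add: norm_vector_scalar_mult power_mult_distrib mult_right_mono)
  qed
  show "(\<lambda>x. f x *s (H x :: complex ^ 'm)) \<in> L2 (lebesgue_on U)" if H: "continuous_on UNIV H"
  proof -
    obtain B where B: "\<And>x. x \<in> U \<Longrightarrow> norm (H x) \<le> B" using bnd[OF H] by blast
    show ?thesis
    proof (rule L2_dominated(1)[OF borel_measurable_vector_scalar_mult[OF L2D(1)[OF f] continuous_borel_measurable_lebesgue_on[OF H]] f f,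
          where c = "B\<^sup>2" and d = 0])
      fix x assume "x \<in> space (lebesgue_on U)"
      then have "(norm (H x))\<^sup>2 \<le> B\<^sup>2" using B by (intro power_mono) (auto simp: space_restrict_space)
      then show "(norm (f x *s H x))\<^sup>2 \<le> B\<^sup>2 * (norm (f x))\<^sup>2 + 0 * (norm (f x))\<^sup>2"
        by (simp add: norm_vector_scalar_mult power_mult_distrib mult.commute[of "B\<^sup>2"] mult_left_mono)
    qed
  qed
qed

text \<open>Since \<open>\<eta> * \<phi>\<close> is again a test function, \<open>u\<close> may be
  tested with it; the excess term of the Leibniz rule moves to the other side.\<close>

lemma weak_gradient_mult:
  assumes u: "u \<in> L2 (lebesgue_on U)" "has_weak_gradient U u G" and s: "smooth \<eta>"
  shows "(\<lambda>x. \<eta> x * u x) \<in> L2 (lebesgue_on U)"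
    "has_weak_gradient U (\<lambda>x. \<eta> x * u x) (\<lambda>x. \<eta> x *s G x + u x *s grad \<eta> x)"
proof -
  have G: "G \<in> L2 (lebesgue_on U)" using u by (auto simp: has_weak_gradient_def)
  note c = smooth_continuous[OF s] continuous_on_grad[OF s]
  show "(\<lambda>x. \<eta> x * u x) \<in> L2 (lebesgue_on U)" by (rule L2_mult_bounded(1)[OF u(1) c(1)])
  have W: "(\<lambda>x. \<eta> x *s G x + u x *s grad \<eta> x) \<in> L2 (lebesgue_on U)"
    by (intro L2_add(1) L2_mult_bounded(2)[OF u(1) c(1) G] L2_mult_bounded(3)[OF u(1) c(1) c(2)])
  have "(LINT x|lebesgue_on U. (\<eta> x * u x) * partial i \<phi> x) = - (LINT x|lebesgue_on U. (\<eta> x *s G x + u x *s grad \<eta> x) $ i * \<phi> x)"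
    if t: "test_fun U \<phi>" for \<phi> i
  proof -
    have s': "smooth \<phi>" by (rule test_funD(1)[OF t])
    have t2: "test_fun U (\<lambda>x. \<eta> x * \<phi> x)" by (rule test_fun_mult[OF t s])
    have i1: "integrable (lebesgue_on U) (\<lambda>x. u x * partial i (\<lambda>x. \<eta> x * \<phi> x) x)"
      "integrable (lebesgue_on U) (\<lambda>x. G x $ i * (\<eta> x * \<phi> x))"
      using weak_gradient_integrable[OF u(1) G smooth_mult[OF s s'], of i] by auto
    have i2: "integrable (lebesgue_on U) (\<lambda>x. u x * (partial i \<eta> x * \<phi> x))"
      by (intro L2_mult_integrable u smooth_L2 op bd smooth_mult smooth_partial s s')
    have "(LINT x|lebesgue_on U. (\<eta> x * u x) * partial i \<phi> x) =
      (LINT x|lebesgue_on U. u x * partial i (\<lambda>x. \<eta> x * \<phi> x) x - u x * (partial i \<eta> x * \<phi> x))"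
      by (simp add: partial_mult[OF s s'] algebra_simps)
    also have "\<dots> = (LINT x|lebesgue_on U. u x * partial i (\<lambda>x. \<eta> x * \<phi> x) x) - (LINT x|lebesgue_on U. u x * (partial i \<eta> x * \<phi> x))"
      using i1 i2 by simp
    also have "\<dots> = - ((LINT x|lebesgue_on U. G x $ i * (\<eta> x * \<phi> x)) + (LINT x|lebesgue_on U. u x * (partial i \<eta> x * \<phi> x)))"
      using u(2) t2 unfolding has_weak_gradient_def by simp
    also have "(LINT x|lebesgue_on U. G x $ i * (\<eta> x * \<phi> x)) + (LINT x|lebesgue_on U. u x * (partial i \<eta> x * \<phi> x)) =
       (LINT x|lebesgue_on U. G x $ i * (\<eta> x * \<phi> x) + u x * (partial i \<eta> x * \<phi> x))"
      using i1 i2 by simp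
    also have "\<dots> = (LINT x|lebesgue_on U. (\<eta> x *s G x + u x *s grad \<eta> x) $ i * \<phi> x)"
      by (simp add: algebra_simps grad_def)
    finally show ?thesis .
  qed
  then show "has_weak_gradient U (\<lambda>x. \<eta> x * u x) (\<lambda>x. \<eta> x *s G x + u x *s grad \<eta> x)"
    using W unfolding has_weak_gradient_def by blast
qed

lemma weak_gradient_subset:
  assumes u: "has_weak_gradient U u G" and V: "open V" "V \<subseteq> U"
  shows "has_weak_gradient V u G"
  unfolding has_weak_gradient_def
proof (intro conjI allI impI)
  show "G \<in> L2 (lebesgue_on V)"
    using u L2_subset(1)[OF op V] unfolding has_weak_gradient_def by blast
  fix \<phi> i assume t: "test_fun V \<phi>"
  have "(LINT x|lebesgue_on V. u x * partial i \<phi> x) = (LINT x|lebesgue_on U. u x * partial i \<phi> x)"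
    by (rule lebesgue_on_transfer(1)[OF op V(1) _ V(2), symmetric]) (simp add: test_funD(3)[OF t])
  also have "\<dots> = - (LINT x|lebesgue_on U. G x $ i * \<phi> x)"
    using u test_fun_mono[OF t V(2)] unfolding has_weak_gradient_def by blast
  also have "(LINT x|lebesgue_on U. G x $ i * \<phi> x) = (LINT x|lebesgue_on V. G x $ i * \<phi> x)"
    by (rule lebesgue_on_transfer(1)[OF op V(1) _ V(2)]) (simp add: test_funD(2)[OF t])
  finally show "(LINT x|lebesgue_on V. u x * partial i \<phi> x) = - (LINT x|lebesgue_on V. G x $ i * \<phi> x)" .
qed

end

section \<open>Traces and the mean-zero Poincare inequality\<close>

lemma compact_image_bounded:
  fixes h :: "'a::topological_space \<Rightarrow> 'b::real_normed_vector"
  assumes "compact S" "continuous_on S h"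
  obtains B where "B \<ge> 0" "\<And>x. x \<in> S \<Longrightarrow> norm (h x) \<le> B"
proof -
  from compact_imp_bounded[OF compact_continuous_image[OF assms(2,1)]]
  obtain B where "\<And>x. x \<in> S \<Longrightarrow> norm (h x) \<le> B" unfolding bounded_iff ball_simps by auto
  then show thesis using that[of "max B 0"] by (metis max.cobounded2 max.coboundedI1)
qed

lemma L2_integrable:
  fixes f :: "'m \<Rightarrow> complex"
  assumes "finite_measure M" "f \<in> L2 M" shows "integrable M f"
    "(cmod (LINT x|M. f x))\<^sup>2 \<le> measure M (space M) * (L2_norm M f)\<^sup>2"
proof -
  interpret finite_measure M by fact
  have one: "(\<lambda>x. 1 :: complex) \<in> L2 M" by (simp add: L2_def)
  have n1: "L2_norm M (\<lambda>x. 1 :: complex) = sqrt (measure M (space M))" by (simp add: L2_norm_def)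
  have le: "norm (f x) \<le> 1 * (norm (f x) * norm (1 :: complex))" for x by simp
  show "integrable M f" by (rule L2_pairing(1)[OF L2D(1)[OF assms(2)] assms(2) one _ le]) simp
  have "cmod (LINT x|M. f x) \<le> 1 * (L2_norm M f * L2_norm M (\<lambda>x. 1 :: complex))"
    by (rule L2_pairing(2)[OF L2D(1)[OF assms(2)] assms(2) one _ le]) simp
  then have "(cmod (LINT x|M. f x))\<^sup>2 \<le> (L2_norm M f * sqrt (measure M (space M)))\<^sup>2"
    by (intro power_mono) (simp_all add: n1)
  then show "(cmod (LINT x|M. f x))\<^sup>2 \<le> measure M (space M) * (L2_norm M f)\<^sup>2"
    by (simp add: power_mult_distrib mult.commute)
qed

lemma smooth_L2_surface:
  assumes S: "compact S" and fb: "fborel (surface S)" and \<phi>: "smooth \<phi>"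
  shows "\<phi> \<in> L2 (surface S)"
proof -
  interpret finite_measure "surface S" using fb fborel_def by blast
  obtain B where B: "B \<ge> 0" "\<And>x. x \<in> S \<Longrightarrow> norm (\<phi> x) \<le> B"
    using compact_image_bounded[OF S smooth_continuous[OF \<phi>]] by blast
  have m: "\<phi> \<in> borel_measurable (surface S)" by (rule fborel_smooth[OF fb \<phi>])
  have "integrable (surface S) (\<lambda>x. (norm (\<phi> x))\<^sup>2)"
  proof (rule integrable_const_bound[of _ "B\<^sup>2"])
    show "AE x in surface S. norm ((norm (\<phi> x))\<^sup>2) \<le> B\<^sup>2"
    proof (rule AE_I2)
      fix x assume "x \<in> space (surface S)"
      then have "norm (\<phi> x) \<le> B" using B by (simp add: surface_def space_restrict_space)
      then show "norm ((norm (\<phi> x))\<^sup>2) \<le> B\<^sup>2" using power_mono[of "norm (\<phi> x)" B 2] by simp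
    qed
    show "(\<lambda>x. (norm (\<phi> x))\<^sup>2) \<in> borel_measurable (surface S)" using m by measurable
  qed
  then show ?thesis using m by (simp add: L2_def)
qed

lemma (in bounded_open) weak_gradient_diff:
  assumes "u \<in> L2 (lebesgue_on U)" "has_weak_gradient U u G" "v \<in> L2 (lebesgue_on U)" "has_weak_gradient U v H"
  shows "has_weak_gradient U (\<lambda>x. u x - v x) (\<lambda>x. G x - H x)"
proof -
  have "c *s w = - w" if "c = -1" for w :: "complex ^ 'n" and c using that by (simp add: vec_eq_iff)
  then show ?thesis using weak_gradient_add_scaled[OF assms, of "-1"] by simp
qed

text \<open>\<open>H1_norm\<close> refers to the chosen gradient; here convergence is expressed
  through gradients that are explicitly known.\<close>

lemma (in bounded_open) H1_normI:
  assumes u: "\<And>j. u j \<in> L2 (lebesgue_on U)" "\<And>j. has_weak_gradient U (u j) (G j)"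
  shows "(\<lambda>j. H1_norm U (u j)) \<longlonglongrightarrow> 0 \<longleftrightarrow>
    (\<lambda>j. (L2_norm (lebesgue_on U) (u j))\<^sup>2) \<longlonglongrightarrow> 0 \<and> (\<lambda>j. (L2_norm (lebesgue_on U) (G j))\<^sup>2) \<longlonglongrightarrow> 0"
proof -
  let ?a = "\<lambda>j. (L2_norm (lebesgue_on U) (u j))\<^sup>2" and ?b = "\<lambda>j. (L2_norm (lebesgue_on U) (G j))\<^sup>2"
  have e: "(H1_norm U (u j))\<^sup>2 = ?a j + ?b j" for j by (rule H1_norm_eq[OF u(2)])
  have "(\<lambda>j. H1_norm U (u j)) \<longlonglongrightarrow> 0 \<longleftrightarrow> (\<lambda>j. ?a j + ?b j) \<longlonglongrightarrow> 0"
  proof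
    assume "(\<lambda>j. H1_norm U (u j)) \<longlonglongrightarrow> 0"
    then have "(\<lambda>j. (H1_norm U (u j))\<^sup>2) \<longlonglongrightarrow> 0\<^sup>2" by (rule tendsto_power)
    then show "(\<lambda>j. ?a j + ?b j) \<longlonglongrightarrow> 0" by (simp add: e)
  next
    assume "(\<lambda>j. ?a j + ?b j) \<longlonglongrightarrow> 0"
    then have "(\<lambda>j. sqrt ((H1_norm U (u j))\<^sup>2)) \<longlonglongrightarrow> sqrt 0" by (intro tendsto_real_sqrt) (simp add: e)
    then have "(\<lambda>j. \<bar>H1_norm U (u j)\<bar>) \<longlonglongrightarrow> 0" by simp
    then show "(\<lambda>j. H1_norm U (u j)) \<longlonglongrightarrow> 0" by (rule tendsto_rabs_zero_cancel)
  qed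
  also have "\<dots> \<longleftrightarrow> ?a \<longlonglongrightarrow> 0 \<and> ?b \<longlonglongrightarrow> 0"
  proof
    assume s: "(\<lambda>j. ?a j + ?b j) \<longlonglongrightarrow> 0"
    show "?a \<longlonglongrightarrow> 0 \<and> ?b \<longlonglongrightarrow> 0"
      by (intro conjI; rule tendsto_sandwich[OF _ _ tendsto_const s]) simp_all
  next
    assume "?a \<longlonglongrightarrow> 0 \<and> ?b \<longlonglongrightarrow> 0"
    then show "(\<lambda>j. ?a j + ?b j) \<longlonglongrightarrow> 0" using tendsto_add[of ?a 0 sequentially ?b 0] by simp
  qed
  finally show ?thesis .
qed

lemma (in bounded_open) has_trace_iff:
  "has_trace U S u f \<longleftrightarrow> u \<in> H1 U \<and> f \<in> L2 (surface S) \<and> (\<exists>\<phi>. (\<forall>j. smooth (\<phi> j)) \<and>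
     (\<lambda>j. (L2_norm (lebesgue_on U) (\<lambda>x. u x - \<phi> j x))\<^sup>2) \<longlonglongrightarrow> 0 \<and>
     (\<lambda>j. (L2_norm (lebesgue_on U) (\<lambda>x. wgrad U u x - grad (\<phi> j) x))\<^sup>2) \<longlonglongrightarrow> 0 \<and>
     (\<lambda>j. L2_norm (surface S) (\<lambda>x. f x - \<phi> j x)) \<longlonglongrightarrow> 0)"
proof -
  have "(\<lambda>j. H1_norm U (\<lambda>x. u x - \<phi> j x)) \<longlonglongrightarrow> 0 \<longleftrightarrow>
     (\<lambda>j. (L2_norm (lebesgue_on U) (\<lambda>x. u x - \<phi> j x))\<^sup>2) \<longlonglongrightarrow> 0 \<and>
     (\<lambda>j. (L2_norm (lebesgue_on U) (\<lambda>x. wgrad U u x - grad (\<phi> j) x))\<^sup>2) \<longlonglongrightarrow> 0"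
    if "u \<in> H1 U" "\<forall>j. smooth (\<phi> j)" for \<phi> :: "nat \<Rightarrow> real ^ 'n \<Rightarrow> complex"
    using that H1D[OF that(1)]
    by (intro H1_normI L2_diff(1)[OF _ smooth_L2[OF op bd]] weak_gradient_diff[OF _ _ smooth_L2[OF op bd] weak_gradient_smooth]) auto
  then show ?thesis unfolding has_trace_def by blast
qed

lemma nn_integral_lebesgue_on:
  assumes "U \<in> sets borel"
  shows "nn_integral (lebesgue_on U) g = nn_integral (restrict_space lborel U) g"
  using assms by (simp add: nn_integral_restrict_space nn_integral_completion)

text \<open>Multiplication by \<open>\<sigma>\<^sup>2\<close> keeps the inequality meaningful if the
  boundary measure is zero, which cannot be excluded at this stage.\<close>

lemma smooth_poincare:
  fixes U :: "(real ^ 'n) set"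
  assumes dim: "CARD('n) \<ge> 2" and bd: "bounded U" and U: "lipschitz_domain U"
  defines "\<sigma> \<equiv> measure (surface (frontier U)) (frontier U)"
  obtains C v where "C \<ge> 0" "v \<ge> 0" "\<And>\<phi>. smooth \<phi> \<Longrightarrow> \<sigma>\<^sup>2 * (L2_norm (lebesgue_on U) \<phi>)\<^sup>2 \<le>
     v * (cmod (LINT x|surface (frontier U). \<phi> x))\<^sup>2 + \<sigma> * C * (L2_norm (lebesgue_on U) (grad \<phi>))\<^sup>2"
proof -
  let ?S = "surface (frontier U)" and ?L = "restrict_space lborel U"
  have op: "open U" using U by (simp add: lipschitz_domain_def)
  then have Ub: "U \<in> sets borel" by simp
  note bp = boundary_poincare[OF dim bd U]
  have cf: "compact (frontier U)" by (rule compact_frontier_bounded[OF bd])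
  have spS: "space ?S = frontier U" by (simp add: surface_def space_restrict_space)
  have fL: "fborel ?L" by (rule fborel_restrict_lborel[OF Ub bd])
  interpret S: finite_measure ?S using bp(1) fborel_def by blast
  interpret L: finite_measure ?L using fL fborel_def by blast
  interpret SL: pair_sigma_finite ?S ?L ..
  interpret SL': pair_sigma_finite ?L ?S ..
  obtain C0 where C0: "C0 \<ge> 0" "\<And>\<phi>. smooth \<phi> \<Longrightarrow> (\<integral>\<^sup>+x. \<integral>\<^sup>+y. ennreal ((cmod (\<phi> y - \<phi> x))\<^sup>2) \<partial>?L \<partial>?S) \<le> ennreal C0 * energy U \<phi>"
    using bp(2) unfolding linked_def by blast
  define v where "v = measure ?L U"
  have \<sigma>0: "\<sigma> \<ge> 0" by (simp add: \<sigma>_def)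
  have em\<sigma>: "emeasure ?S (space ?S) = ennreal \<sigma>" by (simp add: spS S.emeasure_eq_measure \<sigma>_def)
  have sq: "\<sigma>\<^sup>2 * (L2_norm (lebesgue_on U) \<phi>)\<^sup>2 \<le>
     (2 * v) * (cmod (LINT x|?S. \<phi> x))\<^sup>2 + \<sigma> * (2 * C0) * (L2_norm (lebesgue_on U) (grad \<phi>))\<^sup>2" if \<phi>: "smooth \<phi>" for \<phi>
  proof -
    have [measurable]: "\<phi> \<in> borel_measurable ?S" "\<phi> \<in> borel_measurable ?L"
      using fborel_smooth bp(1) fL \<phi> by blast+
    define I where "I = (LINT x|?S. \<phi> x)"
    have \<phi>L2: "\<phi> \<in> L2 ?S" by (rule smooth_L2_surface[OF cf bp(1) \<phi>])
    have \<phi>i: "integrable ?S \<phi>" by (rule L2_integrable(1)[OF S.finite_measure_axioms \<phi>L2])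
    \<comment> \<open>The number \<sigma> \<phi>(y) - I is the integral of \<phi>(y) - \<phi>(x)
      over the boundary points x, so Cauchy-Schwarz bounds its square by \<sigma> times the inner
      double integrand.\<close>
    have point: "ennreal (\<sigma>\<^sup>2 * (cmod (\<phi> y))\<^sup>2) \<le> ennreal (2 * (cmod I)\<^sup>2) + ennreal (2 * \<sigma>) * (\<integral>\<^sup>+x. ennreal ((cmod (\<phi> y - \<phi> x))\<^sup>2) \<partial>?S)"
      for y
    proof -
      have d: "(LINT x|?S. \<phi> y - \<phi> x) = of_real \<sigma> * \<phi> y - I"
        using \<phi>i by (simp add: I_def spS \<sigma>_def scaleR_conv_of_real)
      have cL2: "(\<lambda>x. \<phi> y - \<phi> x) \<in> L2 ?S"
        by (rule smooth_L2_surface[OF cf bp(1)]) (intro smooth_diff smooth_const \<phi>)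
      have nn: "(\<integral>\<^sup>+x. ennreal ((cmod (\<phi> y - \<phi> x))\<^sup>2) \<partial>?S) = ennreal ((L2_norm ?S (\<lambda>x. \<phi> y - \<phi> x))\<^sup>2)"
        unfolding L2_norm_sq by (rule nn_integral_eq_integral[OF L2D(2)[OF cL2]]) simp
      have "(cmod (of_real \<sigma> * \<phi> y - I))\<^sup>2 \<le> \<sigma> * (L2_norm ?S (\<lambda>x. \<phi> y - \<phi> x))\<^sup>2"
        using L2_integrable(2)[OF S.finite_measure_axioms cL2] unfolding d spS \<sigma>_def .
      moreover have "(cmod (of_real \<sigma> * \<phi> y))\<^sup>2 \<le> 2 * (cmod I)\<^sup>2 + 2 * (cmod (of_real \<sigma> * \<phi> y - I))\<^sup>2"
        using norm_add_sq_le[of I "of_real \<sigma> * \<phi> y - I"] by simp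
      ultimately have "\<sigma>\<^sup>2 * (cmod (\<phi> y))\<^sup>2 \<le> 2 * (cmod I)\<^sup>2 + 2 * \<sigma> * (L2_norm ?S (\<lambda>x. \<phi> y - \<phi> x))\<^sup>2"
        using \<sigma>0 by (simp add: norm_mult power_mult_distrib)
      moreover have "ennreal (p + q * r) = ennreal p + ennreal q * ennreal r" if "0 \<le> p" "0 \<le> q" "0 \<le> r" for p q r :: real
        using that by (simp add: ennreal_plus ennreal_mult)
      ultimately show ?thesis unfolding nn using \<sigma>0 by (metis (no_types, lifting) ennreal_leI mult_nonneg_nonneg zero_le_numeral zero_le_power2)
    qed
    have E: "energy U \<phi> = ennreal ((L2_norm (lebesgue_on U) (grad \<phi>))\<^sup>2)"
    proof -
      have "energy U \<phi> = nn_integral (lebesgue_on U) (\<lambda>x. ennreal ((norm (grad \<phi> x))\<^sup>2))"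
        using Ub by (simp add: nn_integral_restrict_space nn_integral_completion mult.commute)
      also have "\<dots> = ennreal ((L2_norm (lebesgue_on U) (grad \<phi>))\<^sup>2)"
        unfolding L2_norm_sq by (rule nn_integral_eq_integral[OF L2D(2)[OF smooth_grad_L2[OF op bd \<phi>]]]) simp
      finally show ?thesis .
    qed
    have P: "(\<integral>\<^sup>+y. ennreal (\<sigma>\<^sup>2 * (cmod (\<phi> y))\<^sup>2) \<partial>?L) = ennreal (\<sigma>\<^sup>2 * (L2_norm (lebesgue_on U) \<phi>)\<^sup>2)"
    proof -
      have i: "integrable (lebesgue_on U) (\<lambda>x. \<sigma>\<^sup>2 * (norm (\<phi> x))\<^sup>2)"
        using L2D(2)[OF smooth_L2[OF op bd \<phi>]] by simp
      show ?thesis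
        unfolding nn_integral_lebesgue_on[OF Ub, symmetric] L2_norm_sq
        using nn_integral_eq_integral[OF i] by simp
    qed
    have "ennreal (\<sigma>\<^sup>2 * (L2_norm (lebesgue_on U) \<phi>)\<^sup>2) \<le>
        (\<integral>\<^sup>+y. ennreal (2 * (cmod I)\<^sup>2) + ennreal (2 * \<sigma>) * (\<integral>\<^sup>+x. ennreal ((cmod (\<phi> y - \<phi> x))\<^sup>2) \<partial>?S) \<partial>?L)"
      unfolding P[symmetric] by (intro nn_integral_mono point)
    also have "\<dots> = ennreal (2 * (cmod I)\<^sup>2) * ennreal v + ennreal (2 * \<sigma>) * (\<integral>\<^sup>+y. \<integral>\<^sup>+x. ennreal ((cmod (\<phi> y - \<phi> x))\<^sup>2) \<partial>?S \<partial>?L)"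
      by (simp add: nn_integral_add nn_integral_cmult L.emeasure_eq_measure v_def space_restrict_space)
    also have "(\<integral>\<^sup>+y. \<integral>\<^sup>+x. ennreal ((cmod (\<phi> y - \<phi> x))\<^sup>2) \<partial>?S \<partial>?L) = (\<integral>\<^sup>+x. \<integral>\<^sup>+y. ennreal ((cmod (\<phi> y - \<phi> x))\<^sup>2) \<partial>?L \<partial>?S)"
      by (rule SL.Fubini') measurable
    also have "ennreal (2 * (cmod I)\<^sup>2) * ennreal v + ennreal (2 * \<sigma>) * (\<integral>\<^sup>+x. \<integral>\<^sup>+y. ennreal ((cmod (\<phi> y - \<phi> x))\<^sup>2) \<partial>?L \<partial>?S)
       \<le> ennreal (2 * (cmod I)\<^sup>2) * ennreal v + ennreal (2 * \<sigma>) * (ennreal C0 * ennreal ((L2_norm (lebesgue_on U) (grad \<phi>))\<^sup>2))"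
      by (intro add_left_mono mult_left_mono C0(2)[OF \<phi>, unfolded E]) simp
    also have "\<dots> = ennreal ((2 * v) * (cmod I)\<^sup>2 + \<sigma> * (2 * C0) * (L2_norm (lebesgue_on U) (grad \<phi>))\<^sup>2)"
      using C0(1) \<sigma>0 by (simp add: ennreal_mult[symmetric] ennreal_plus[symmetric] v_def del: ennreal_plus)
    finally have "ennreal (\<sigma>\<^sup>2 * (L2_norm (lebesgue_on U) \<phi>)\<^sup>2) \<le> ennreal ((2 * v) * (cmod I)\<^sup>2 + \<sigma> * (2 * C0) * (L2_norm (lebesgue_on U) (grad \<phi>))\<^sup>2)" .
    moreover have "0 \<le> (2 * v) * (cmod I)\<^sup>2 + \<sigma> * (2 * C0) * (L2_norm (lebesgue_on U) (grad \<phi>))\<^sup>2"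
      using C0(1) \<sigma>0 by (simp add: v_def)
    ultimately show ?thesis unfolding I_def by (simp add: ennreal_le_iff)
  qed
  show thesis using that[of "2 * C0" "2 * v", OF _ _ sq] C0(1) by (simp add: v_def)
qed

text \<open>Both sides are continuous under the convergence that defines a trace, so the bound for
  smooth functions passes to the limit; only then is \<sigma> divided out.\<close>

lemma poincare_mean_zero_trace:
  fixes U :: "(real ^ 'n) set"
  assumes dim: "CARD('n) \<ge> 2" and bd: "bounded U" and U: "lipschitz_domain U"
    and pos: "measure (surface (frontier U)) (frontier U) > 0"
  obtains C where "C \<ge> 0" "\<And>u f. has_trace U (frontier U) u f \<Longrightarrow> (LINT x|surface (frontier U). f x) = 0 \<Longrightarrow>
     (L2_norm (lebesgue_on U) u)\<^sup>2 \<le> C * (L2_norm (lebesgue_on U) (wgrad U u))\<^sup>2"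
proof -
  interpret bounded_open U using U bd by unfold_locales (auto simp: lipschitz_domain_def)
  define \<sigma> where "\<sigma> = measure (surface (frontier U)) (frontier U)"
  let ?S = "surface (frontier U)" and ?L = "lebesgue_on U"
  have fbS: "fborel ?S" by (rule boundary_poincare(1)[OF dim bd U])
  interpret S: finite_measure ?S using fbS fborel_def by blast
  have spS: "space ?S = frontier U" by (simp add: surface_def space_restrict_space)
  have cf: "compact (frontier U)" by (rule compact_frontier_bounded[OF bd])
  obtain C v where C: "C \<ge> 0" "v \<ge> 0" "\<And>\<phi>. smooth \<phi> \<Longrightarrow> \<sigma>\<^sup>2 * (L2_norm ?L \<phi>)\<^sup>2 \<le>
     v * (cmod (LINT x|?S. \<phi> x))\<^sup>2 + \<sigma> * C * (L2_norm ?L (grad \<phi>))\<^sup>2"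
    using smooth_poincare[OF dim bd U] unfolding \<sigma>_def by blast
  have main: "\<sigma>\<^sup>2 * (L2_norm ?L u)\<^sup>2 \<le> 4 * \<sigma> * C * (L2_norm ?L (wgrad U u))\<^sup>2"
    if tr: "has_trace U (frontier U) u f" and mz: "(LINT x|?S. f x) = 0" for u f
  proof -
    obtain \<phi> where u: "u \<in> H1 U" and f: "f \<in> L2 ?S" and \<phi>: "\<And>j. smooth (\<phi> j)"
      and lim: "(\<lambda>j. (L2_norm ?L (\<lambda>x. u x - \<phi> j x))\<^sup>2) \<longlonglongrightarrow> 0"
        "(\<lambda>j. (L2_norm ?L (\<lambda>x. wgrad U u x - grad (\<phi> j) x))\<^sup>2) \<longlonglongrightarrow> 0"
        "(\<lambda>j. L2_norm ?S (\<lambda>x. f x - \<phi> j x)) \<longlonglongrightarrow> 0"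
      using tr unfolding has_trace_iff by blast
    define a b c where "a j = (L2_norm ?L (\<lambda>x. u x - \<phi> j x))\<^sup>2"
      and "b j = (L2_norm ?L (\<lambda>x. wgrad U u x - grad (\<phi> j) x))\<^sup>2"
      and "c j = (L2_norm ?S (\<lambda>x. f x - \<phi> j x))\<^sup>2" for j
    have "\<sigma>\<^sup>2 * (L2_norm ?L u)\<^sup>2 \<le> 2 * \<sigma>\<^sup>2 * a j + 2 * (v * (\<sigma> * c j) + \<sigma> * C * (2 * (L2_norm ?L (wgrad U u))\<^sup>2 + 2 * b j))" for j
    proof -
      note \<phi>L = smooth_L2[OF op bd \<phi>, of j] and gL = smooth_grad_L2[OF op bd \<phi>, of j]
      have 1: "(L2_norm ?L u)\<^sup>2 \<le> 2 * a j + 2 * (L2_norm ?L (\<phi> j))\<^sup>2"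
        using L2_add(2)[OF L2_diff(1)[OF H1D(1)[OF u] \<phi>L] \<phi>L] by (simp add: a_def)
      have 2: "(L2_norm ?L (grad (\<phi> j)))\<^sup>2 \<le> 2 * (L2_norm ?L (wgrad U u))\<^sup>2 + 2 * b j"
        using L2_diff(2)[OF H1D(3)[OF u] L2_diff(1)[OF H1D(3)[OF u] gL]] by (simp add: b_def)
      have d: "(\<lambda>x. f x - \<phi> j x) \<in> L2 ?S" by (rule L2_diff(1)[OF f smooth_L2_surface[OF cf fbS \<phi>]])
      \<comment> \<open>As the mean of \<open>f\<close> vanishes, the boundary integral of
        \<open>\<phi> j\<close> is, up to sign, that of the error \<open>f - \<phi> j\<close>, and
        it tends to zero.\<close>
      have "(LINT x|?S. f x - \<phi> j x) = - (LINT x|?S. \<phi> j x)"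
        using L2_integrable(1)[OF S.finite_measure_axioms] f smooth_L2_surface[OF cf fbS \<phi>] mz by simp
      then have 3: "(cmod (LINT x|?S. \<phi> j x))\<^sup>2 \<le> \<sigma> * c j"
        using L2_integrable(2)[OF S.finite_measure_axioms d] by (simp add: spS \<sigma>_def c_def)
      have "\<sigma>\<^sup>2 * (L2_norm ?L u)\<^sup>2 \<le> \<sigma>\<^sup>2 * (2 * a j + 2 * (L2_norm ?L (\<phi> j))\<^sup>2)"
        by (rule mult_left_mono[OF 1]) simp
      also have "\<dots> = 2 * \<sigma>\<^sup>2 * a j + 2 * (\<sigma>\<^sup>2 * (L2_norm ?L (\<phi> j))\<^sup>2)" by (simp add: algebra_simps)
      also have "\<dots> \<le> 2 * \<sigma>\<^sup>2 * a j + 2 * (v * (cmod (LINT x|?S. \<phi> j x))\<^sup>2 + \<sigma> * C * (L2_norm ?L (grad (\<phi> j)))\<^sup>2)"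
        using C(3)[OF \<phi>[of j]] by simp
      also have "\<dots> \<le> 2 * \<sigma>\<^sup>2 * a j + 2 * (v * (\<sigma> * c j) + \<sigma> * C * (2 * (L2_norm ?L (wgrad U u))\<^sup>2 + 2 * b j))"
        by (intro add_left_mono mult_left_mono add_mono 2 3) (use C in \<open>auto simp: \<sigma>_def\<close>)
      finally show ?thesis .
    qed
    moreover have "(\<lambda>j. 2 * \<sigma>\<^sup>2 * a j + 2 * (v * (\<sigma> * c j) + \<sigma> * C * (2 * (L2_norm ?L (wgrad U u))\<^sup>2 + 2 * b j)))
      \<longlonglongrightarrow> 2 * \<sigma>\<^sup>2 * 0 + 2 * (v * (\<sigma> * 0\<^sup>2) + \<sigma> * C * (2 * (L2_norm ?L (wgrad U u))\<^sup>2 + 2 * 0))"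
      unfolding a_def b_def c_def by (intro tendsto_intros lim)
    ultimately have "\<sigma>\<^sup>2 * (L2_norm ?L u)\<^sup>2 \<le> 2 * \<sigma>\<^sup>2 * 0 + 2 * (v * (\<sigma> * 0\<^sup>2) + \<sigma> * C * (2 * (L2_norm ?L (wgrad U u))\<^sup>2 + 2 * 0))"
      by (intro LIMSEQ_le_const[rotated]) auto
    then show ?thesis by simp
  qed
  have \<sigma>: "\<sigma> > 0" using pos by (simp add: \<sigma>_def)
  show thesis
  proof (rule that[of "4 * C / \<sigma>"])
    show "0 \<le> 4 * C / \<sigma>" using C \<sigma> by simp
    fix u f assume "has_trace U (frontier U) u f" "(LINT x|surface (frontier U). f x) = 0"
    note 1 = main[OF this]
    have "\<sigma> * (\<sigma> * X) = \<sigma>\<^sup>2 * X" "\<sigma> * (4 * C * X) = 4 * \<sigma> * C * X" for X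
      by (simp_all add: power2_eq_square)
    then have "\<sigma> * (\<sigma> * (L2_norm ?L u)\<^sup>2) \<le> \<sigma> * (4 * C * (L2_norm ?L (wgrad U u))\<^sup>2)"
      using 1 by (simp only:)
    then have "\<sigma> * (L2_norm ?L u)\<^sup>2 \<le> 4 * C * (L2_norm ?L (wgrad U u))\<^sup>2" using \<sigma> by (simp only: mult_le_cancel_left_pos)
    then show "(L2_norm ?L u)\<^sup>2 \<le> 4 * C / \<sigma> * (L2_norm ?L (wgrad U u))\<^sup>2"
      using \<sigma> by (simp add: pos_le_divide_eq mult.commute)
  qed
qed

text \<open>A sum of box bumps exceeds some \<delta> on \<open>K\<close> and vanishes off finitely
  many boxes. Composing \<delta> minus this sum with \<open>flat 1\<close> gives zero in a whole
  neighbourhood of \<open>K\<close>, hence also a zero gradient there, and a constant off the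
  boxes.\<close>

lemma smooth_cutoff:
  fixes K U :: "(real ^ 'n) set"
  assumes K: "compact K" "K \<subseteq> U" and U: "open U"
  obtains \<eta> K' where "smooth \<eta>" "compact K'" "K' \<subseteq> U" "\<And>x. x \<notin> K' \<Longrightarrow> \<eta> x = 1"
    "\<And>x. x \<in> K \<Longrightarrow> \<eta> x = 0" "\<And>x. x \<in> K \<Longrightarrow> grad \<eta> x = 0"
proof -
  have "\<exists>a b. x \<in> box a b \<and> cbox a b \<subseteq> U" if "x \<in> K" for x
  proof -
    have "x \<in> U" using K that by blast
    then obtain e where e: "e > 0" "ball x e \<subseteq> U" by (rule openE[OF U])
    have "\<exists>a b. x \<in> box a b \<and> cbox a b \<subseteq> ball x e"
    proof -
      \<comment> \<open>The norm is bounded by the sum of the coordinates, which costs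
        \<open>CARD('n)\<close>; the 2 makes the inequality strict.\<close>
      define d where "d = e / (2 * real CARD('n))"
      have d: "d > 0" using e by (simp add: d_def)
      have "cbox (x - (\<chi> i. d)) (x + (\<chi> i. d)) \<subseteq> ball x e"
      proof
        fix y assume "y \<in> cbox (x - (\<chi> i. d)) (x + (\<chi> i. d))"
        then have "\<bar>(y - x) $ i\<bar> \<le> d" for i by (auto simp: mem_box_cart abs_le_iff algebra_simps)
        then have "norm (y - x) \<le> (\<Sum>i\<in>(UNIV::'n set). d)" by (intro order_trans[OF norm_le_l1_cart] sum_mono)
        also have "\<dots> < e" using e by (simp add: d_def)
        finally show "y \<in> ball x e" by (simp add: dist_norm norm_minus_commute)
      qed
      moreover have "x \<in> box (x - (\<chi> i. d)) (x + (\<chi> i. d))" using d by (simp add: mem_box_cart)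
      ultimately show ?thesis by blast
    qed
    then show ?thesis using e by blast
  qed
  then obtain a b where ab: "\<And>x. x \<in> K \<Longrightarrow> x \<in> box (a x) (b x)" "\<And>x. x \<in> K \<Longrightarrow> cbox (a x) (b x) \<subseteq> U" by metis
  obtain I where I: "I \<subseteq> K" "finite I" "K \<subseteq> (\<Union>x\<in>I. box (a x) (b x))"
    by (rule compactE_image[OF K(1), of K "\<lambda>x. box (a x) (b x)"]) (use ab in auto)
  define \<psi> where "\<psi> x = (\<Sum>p\<in>I. box_bump (a p) (b p) 1 x)" for x
  have sm: "smooth (\<lambda>x. complex_of_real (\<psi> x))"
    unfolding \<psi>_def of_real_sum by (intro smooth_sum I smooth_box_bump)
  have \<psi>c: "continuous_on S \<psi>" for S using continuous_on_Re[OF smooth_continuous[OF sm, of S]] by simp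
  have \<psi>pos: "\<psi> x > 0" if x: "x \<in> K" for x
  proof -
    obtain p where p: "p \<in> I" "x \<in> box (a p) (b p)" using I x by blast
    show ?thesis unfolding \<psi>_def
      by (rule sum_pos2[OF I(2) p(1)]) (use p box_bump_pos[of 1 "a p" "b p" x] box_bump_bounds in auto)
  qed
  \<comment> \<open>Half the minimum over the compact set \<open>K\<close>, which makes the
    inequality strict.\<close>
  obtain \<delta> where \<delta>: "\<delta> > 0" "\<And>x. x \<in> K \<Longrightarrow> \<psi> x > \<delta>"
  proof (cases "K = {}")
    case True then show ?thesis using that[of 1] by simp
  next
    case False
    then obtain x0 where "x0 \<in> K" "\<And>x. x \<in> K \<Longrightarrow> \<psi> x0 \<le> \<psi> x"
      using continuous_attains_inf[OF K(1) _ \<psi>c] by blast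
    then show ?thesis using that[of "\<psi> x0 / 2"] \<psi>pos[of x0] by fastforce
  qed
  \<comment> \<open>Dividing by \<open>flat 1 \<delta>\<close> normalises the value off the boxes to
    1.\<close>
  define \<eta> where "\<eta> x = complex_of_real (flat 1 (\<delta> - \<psi> x)) * complex_of_real (1 / flat 1 \<delta>)" for x
  have f\<delta>: "flat 1 \<delta> > 0" using flat1_pos \<delta> by blast
  have s\<eta>: "smooth \<eta>" unfolding \<eta>_def
    by (intro smooth_mult smooth_flat smooth_const) (unfold of_real_diff, intro smooth_diff smooth_const sm)
  have zero: "\<eta> x = 0" if "x \<notin> {x. \<psi> x \<le> \<delta>}" for x using that by (simp add: \<eta>_def flat1)
  have cl: "closed {x. \<psi> x \<le> \<delta>}" by (intro closed_Collect_le \<psi>c continuous_on_const)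
  show thesis
  proof (rule that[OF s\<eta>, of "\<Union>p\<in>I. cbox (a p) (b p)"])
    show "compact (\<Union>p\<in>I. cbox (a p) (b p))" using I by auto
    show "(\<Union>p\<in>I. cbox (a p) (b p)) \<subseteq> U" using I ab by blast
    show "\<eta> x = 1" if "x \<notin> (\<Union>p\<in>I. cbox (a p) (b p))" for x
    proof -
      have "x \<notin> box (a p) (b p)" if "p \<in> I" for p using that \<open>x \<notin> _\<close> box_subset_cbox by blast
      then have "\<psi> x = 0" unfolding \<psi>_def by (intro sum.neutral) (simp add: box_bump_zero)
      then show ?thesis using f\<delta> by (simp add: \<eta>_def flip: of_real_mult)
    qed
    fix x assume "x \<in> K"
    then have nx: "x \<notin> {x. \<psi> x \<le> \<delta>}" using \<delta> by fastforce
    then show "\<eta> x = 0" by (rule zero)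
    show "grad \<eta> x = 0" using partial_zero_outside[of "{x. \<psi> x \<le> \<delta>}" \<eta> x, OF cl zero nx] by (simp add: grad_def vec_eq_iff)
  qed
qed

section \<open>The weak formulation\<close>

text \<open>\<open>has_normal_derivative\<close> asks for a trace on the whole boundary of
  \<open>\<Omega> - closure D\<close>, extended by zero from its outer part; this supplies the
  extension.\<close>

lemma surface_extend:
  fixes f :: "real ^ 'n \<Rightarrow> complex"
  assumes S: "closed S" and F: "closed F" and f: "f \<in> L2 (surface S)"
  shows "(\<lambda>x. if x \<in> S then f x else 0) \<in> L2 (surface F)"
    "L2_norm (surface F) (\<lambda>x. if x \<in> S then f x else 0) \<le> L2_norm (surface S) f"
proof -
  let ?H = "hausdorff_measure (CARD('n) - 1) :: (real ^ 'n) measure"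
  let ?g = "\<lambda>x. if x \<in> S then f x else 0"
  have SH: "S \<inter> space ?H \<in> sets ?H" "S \<in> sets ?H" and FH: "F \<inter> space ?H \<in> sets ?H" "F \<in> sets ?H" using S F by auto
  have e: "?g = (\<lambda>x. indicator S x *\<^sub>R f x)" by (auto simp: indicator_def)
  have e2: "(\<lambda>x. (norm (?g x))\<^sup>2) = (\<lambda>x. indicator S x *\<^sub>R (norm (f x))\<^sup>2)" by (auto simp: indicator_def)
  have "f \<in> borel_measurable (restrict_space ?H S)" using L2D(1)[OF f] by (simp add: surface_def)
  then have m: "?g \<in> borel_measurable ?H"
    unfolding e by (rule iffD1[OF borel_measurable_restrict_space_iff[OF SH(1)]])
  have i: "integrable ?H (\<lambda>x. (norm (?g x))\<^sup>2)"
    unfolding e2 by (rule iffD1[OF integrable_restrict_space[OF SH(1)] L2D(2)[OF f, unfolded surface_def]])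
  have iF: "integrable ?H (\<lambda>x. indicator F x *\<^sub>R (norm (?g x))\<^sup>2)"
    by (rule integrable_mult_indicator[OF FH(2) i])
  show "?g \<in> L2 (surface F)"
    unfolding L2_def surface_def
    by (intro CollectI conjI measurable_restrict_space1[OF m] iffD2[OF integrable_restrict_space[OF FH(1)] iF])
  have "(LINT x|surface F. (norm (?g x))\<^sup>2) = (LINT x|?H. indicator F x *\<^sub>R (norm (?g x))\<^sup>2)"
    unfolding surface_def by (rule integral_restrict_space[OF FH(1)])
  also have "\<dots> \<le> (LINT x|?H. (norm (?g x))\<^sup>2)"
    by (rule integral_mono[OF iF i]) (simp add: indicator_def)
  also have "\<dots> = (LINT x|surface S. (norm (f x))\<^sup>2)"
    unfolding surface_def e2 by (rule integral_restrict_space[OF SH(1), symmetric])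
  finally show "L2_norm (surface F) ?g \<le> L2_norm (surface S) f"
    unfolding L2_norm_def by (rule real_sqrt_le_mono)
qed

lemma cdot_add_right: "cdot v (w + w') = cdot v w + cdot v w'"
  by (simp add: cdot_def algebra_simps sum.distrib)

lemma cdot_zero_right: "cdot v 0 = 0"
  by (simp add: cdot_def)

lemma cdot_cnj_self: "cdot v (\<chi> i. cnj (v $ i)) = of_real ((norm v)\<^sup>2)"
proof -
  have "cdot v (\<chi> i. cnj (v $ i)) = (\<Sum>i\<in>UNIV. of_real ((norm (v $ i))\<^sup>2))"
    unfolding cdot_def vec_lambda_beta complex_norm_square ..
  also have "\<dots> = of_real (\<Sum>i\<in>UNIV. (norm (v $ i))\<^sup>2)" by simp
  also have "(\<Sum>i\<in>UNIV. (norm (v $ i))\<^sup>2) = (norm v)\<^sup>2"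
    by (simp add: norm_vec_def L2_set_def sum_nonneg)
  finally show ?thesis .
qed

text \<open>If \<open>H\<close> is the gradient of \<open>h\<close>, the second field is that of
  \<open>\<eta> * h\<close>; thus multiplication by a smooth function is continuous for the norm of
  \<open>H1\<close>.\<close>

lemma (in bounded_open) cutoff_field_bound:
  assumes s: "smooth \<eta>"
  obtains B where "B \<ge> 0"
    "\<And>h. h \<in> L2 (lebesgue_on U) \<Longrightarrow> (L2_norm (lebesgue_on U) (\<lambda>x. \<eta> x * h x))\<^sup>2 \<le> B * (L2_norm (lebesgue_on U) h)\<^sup>2"
    "\<And>h H. h \<in> L2 (lebesgue_on U) \<Longrightarrow> H \<in> L2 (lebesgue_on U) \<Longrightarrow>
      (\<lambda>x. \<eta> x *s H x + h x *s grad \<eta> x) \<in> L2 (lebesgue_on U) \<and>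
      (L2_norm (lebesgue_on U) (\<lambda>x. \<eta> x *s H x + h x *s grad \<eta> x))\<^sup>2
        \<le> B * (L2_norm (lebesgue_on U) h)\<^sup>2 + B * (L2_norm (lebesgue_on U) H)\<^sup>2"
proof -
  have cU: "compact (closure U)" using bd by simp
  obtain B1 where B1: "B1 \<ge> 0" "\<And>x. x \<in> closure U \<Longrightarrow> norm (\<eta> x) \<le> B1"
    using compact_image_bounded[OF cU smooth_continuous[OF s]] by blast
  obtain B2 where B2: "B2 \<ge> 0" "\<And>x. x \<in> closure U \<Longrightarrow> norm (grad \<eta> x) \<le> B2"
    using compact_image_bounded[OF cU continuous_on_grad[OF s]] by blast
  define B where "B = 2 * (B1\<^sup>2 + B2\<^sup>2)"
  have B: "B1\<^sup>2 \<le> B" "2 * B1\<^sup>2 \<le> B" "2 * B2\<^sup>2 \<le> B" "B \<ge> 0" by (auto simp: B_def)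
  have sp: "x \<in> closure U" if "x \<in> space (lebesgue_on U)" for x
    using that closure_subset[of U] by (auto simp: space_restrict_space)
  note c = smooth_continuous[OF s, of UNIV] continuous_on_grad[OF s, of UNIV]
  show thesis
  proof (rule that[OF B(4)])
    fix h :: "real ^ 'n \<Rightarrow> complex" assume h: "h \<in> L2 (lebesgue_on U)"
    have "(norm (\<eta> x * h x))\<^sup>2 \<le> B * (norm (h x))\<^sup>2 + 0 * (norm (h x))\<^sup>2" if "x \<in> space (lebesgue_on U)" for x
    proof -
      have "(norm (\<eta> x))\<^sup>2 \<le> B" using power_mono[OF B1(2)[OF sp[OF that]], of 2] B by simp
      then show ?thesis by (simp add: norm_mult power_mult_distrib mult_right_mono)
    qed
    then show "(L2_norm (lebesgue_on U) (\<lambda>x. \<eta> x * h x))\<^sup>2 \<le> B * (L2_norm (lebesgue_on U) h)\<^sup>2"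
      using L2_dominated(2)[OF L2D(1)[OF L2_mult_bounded(1)[OF h c(1)]] h h, where c = B and d = 0] by simp
    fix H :: "real ^ 'n \<Rightarrow> complex ^ 'n" assume H: "H \<in> L2 (lebesgue_on U)"
    have W: "(\<lambda>x. \<eta> x *s H x + h x *s grad \<eta> x) \<in> L2 (lebesgue_on U)"
      by (intro L2_add(1) L2_mult_bounded(2)[OF h c(1) H] L2_mult_bounded(3)[OF h c(1) c(2)])
    have le: "(norm (\<eta> x *s H x + h x *s grad \<eta> x))\<^sup>2 \<le> B * (norm (h x))\<^sup>2 + B * (norm (H x))\<^sup>2" if "x \<in> space (lebesgue_on U)" for x
    proof -
      have "2 * (norm (\<eta> x))\<^sup>2 \<le> B" "2 * (norm (grad \<eta> x))\<^sup>2 \<le> B"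
        using power_mono[OF B1(2)[OF sp[OF that]], of 2] power_mono[OF B2(2)[OF sp[OF that]], of 2] B by simp_all
      then have "2 * (norm (\<eta> x))\<^sup>2 * (norm (H x))\<^sup>2 \<le> B * (norm (H x))\<^sup>2" "2 * (norm (grad \<eta> x))\<^sup>2 * (norm (h x))\<^sup>2 \<le> B * (norm (h x))\<^sup>2"
        by (simp_all add: mult_right_mono)
      then show ?thesis using norm_add_sq_le[of "\<eta> x *s H x" "h x *s grad \<eta> x"]
        by (simp add: norm_vector_scalar_mult power_mult_distrib mult.commute mult.left_commute)
    qed
    show "(\<lambda>x. \<eta> x *s H x + h x *s grad \<eta> x) \<in> L2 (lebesgue_on U) \<and>
      (L2_norm (lebesgue_on U) (\<lambda>x. \<eta> x *s H x + h x *s grad \<eta> x))\<^sup>2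
        \<le> B * (L2_norm (lebesgue_on U) h)\<^sup>2 + B * (L2_norm (lebesgue_on U) H)\<^sup>2"
      using W L2_dominated(2)[OF L2D(1)[OF W] h H le] by blast
  qed
qed

lemma conductivity_bound: "cmod (conductivity \<Omega> D k x) \<le> 1 + cmod k"
proof -
  have "cmod (conductivity \<Omega> D k x) \<le> cmod (indicator (\<Omega> - D) x) + cmod k * cmod (indicator D x)"
    unfolding conductivity_def by (metis norm_mult norm_triangle_ineq)
  also have "\<dots> \<le> 1 + cmod k * 1" by (intro add_mono mult_left_mono) (auto simp: indicator_def)
  finally show ?thesis by simp
qed

lemma borel_measurable_conductivity:
  assumes "open \<Omega>" "open D"
  shows "conductivity \<Omega> D k \<in> borel_measurable (lebesgue_on U)"
proof -
  have [measurable]: "\<Omega> - D \<in> sets borel" "D \<in> sets borel" using assms by auto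
  have "(\<lambda>x. indicator (\<Omega> - D) x + k * indicator D x) \<in> borel_measurable lborel" by measurable
  then have "conductivity \<Omega> D k \<in> borel_measurable lborel" by (simp add: conductivity_def[abs_def])
  then show ?thesis by (intro measurable_restrict_space1 measurable_completion)
qed

text \<open>
  The weak formulation tests against all of \<open>H\<^sup>1\<close>: a cutoff splits the test function into a part
  vanishing near the inclusion, seen by the normal derivative, and a part that is a limit of
  test functions, seen by the divergence equation.
\<close>

lemma weak_formulation:
  fixes \<Omega> D :: "(real ^ 'n) set"
  assumes op: "open \<Omega>" and bd: "bounded \<Omega>" and D: "open D" "closure D \<subseteq> \<Omega>"
    and fb: "fborel (surface (frontier \<Omega>))"
    and u: "u \<in> H1 \<Omega>" and eq: "divergence_equation \<Omega> (conductivity \<Omega> D k) u"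
    and nd: "has_normal_derivative (\<Omega> - closure D) (frontier \<Omega>) u g"
    and tr: "has_trace \<Omega> (frontier \<Omega>) v f"
  shows "g f = (LINT x|lebesgue_on \<Omega>. conductivity \<Omega> D k x * cdot (wgrad \<Omega> u x) (wgrad \<Omega> v x))"
proof -
  let ?L = "lebesgue_on \<Omega>" and ?\<gamma> = "conductivity \<Omega> D k"
  let ?V = "\<Omega> - closure D"
  interpret O: bounded_open \<Omega> using op bd by unfold_locales
  have V: "open ?V" "?V \<subseteq> \<Omega>" using op by auto
  interpret V: bounded_open ?V using V(1) bounded_subset[OF bd V(2)] by unfold_locales
  have cD: "compact (closure D)"
    using bounded_subset[OF bd, of "closure D"] D bounded_closure closure_closed by (simp add: compact_eq_bounded_closed)
  \<comment> \<open>With this \<eta>, the product \<eta> v keeps the trace of v on the outer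
    boundary and vanishes on \<open>closure D\<close>, while (1 - \<eta>) \<phi> is supported in
    \<open>K'\<close> for every smooth \<phi>.\<close>
  obtain \<eta> K' where \<eta>: "smooth \<eta>" "compact K'" "K' \<subseteq> \<Omega>" "\<And>x. x \<notin> K' \<Longrightarrow> \<eta> x = 1"
    "\<And>x. x \<in> closure D \<Longrightarrow> \<eta> x = 0" "\<And>x. x \<in> closure D \<Longrightarrow> grad \<eta> x = 0"
    by (rule smooth_cutoff[OF cD D(2) op that])
  obtain B where B: "B \<ge> 0"
    "\<And>h. h \<in> L2 ?L \<Longrightarrow> (L2_norm ?L (\<lambda>x. \<eta> x * h x))\<^sup>2 \<le> B * (L2_norm ?L h)\<^sup>2"
    "\<And>h H. h \<in> L2 ?L \<Longrightarrow> H \<in> L2 ?L \<Longrightarrow> (\<lambda>x. \<eta> x *s H x + h x *s grad \<eta> x) \<in> L2 ?L \<and>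
      (L2_norm ?L (\<lambda>x. \<eta> x *s H x + h x *s grad \<eta> x))\<^sup>2 \<le> B * (L2_norm ?L h)\<^sup>2 + B * (L2_norm ?L H)\<^sup>2"
    by (rule O.cutoff_field_bound[OF \<eta>(1) that])
  obtain \<phi> where v: "v \<in> H1 \<Omega>" and f: "f \<in> L2 (surface (frontier \<Omega>))" and \<phi>: "\<And>j. smooth (\<phi> j)"
    and lim: "(\<lambda>j. (L2_norm ?L (\<lambda>x. v x - \<phi> j x))\<^sup>2) \<longlonglongrightarrow> 0"
      "(\<lambda>j. (L2_norm ?L (\<lambda>x. wgrad \<Omega> v x - grad (\<phi> j) x))\<^sup>2) \<longlonglongrightarrow> 0"
      "(\<lambda>j. L2_norm (surface (frontier \<Omega>)) (\<lambda>x. f x - \<phi> j x)) \<longlonglongrightarrow> 0"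
    using tr unfolding O.has_trace_iff by blast
  define h H where "h j x = v x - \<phi> j x" and "H j x = wgrad \<Omega> v x - grad (\<phi> j) x" for j x
  have hL: "h j \<in> L2 ?L" and HL: "H j \<in> L2 ?L" for j
    unfolding h_def H_def
    by (intro L2_diff(1)[OF O.H1D(1)[OF v] smooth_L2[OF op bd \<phi>]] L2_diff(1)[OF O.H1D(3)[OF v] smooth_grad_L2[OF op bd \<phi>]])+
  have hw: "has_weak_gradient \<Omega> (h j) (H j)" for j
    unfolding h_def H_def
    by (intro O.weak_gradient_diff O.H1D[OF v] smooth_L2[OF op bd \<phi>] O.weak_gradient_smooth \<phi>)
  define W where "W x = \<eta> x *s wgrad \<Omega> v x + v x *s grad \<eta> x" for x
  have WL: "W \<in> L2 ?L" unfolding W_def using B(3)[OF O.H1D(1,3)[OF v]] by blast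
  have Ww: "(\<lambda>x. \<eta> x * v x) \<in> L2 ?L" "has_weak_gradient \<Omega> (\<lambda>x. \<eta> x * v x) W"
    unfolding W_def using O.weak_gradient_mult[OF O.H1D(1,2)[OF v] \<eta>(1)] by auto
  let ?fx = "\<lambda>x. if x \<in> frontier \<Omega> then f x else 0"
  have trV: "has_trace ?V (frontier ?V) (\<lambda>x. \<eta> x * v x) ?fx"
    unfolding has_trace_def
  proof (intro conjI exI[of _ "\<lambda>j x. \<eta> x * \<phi> j x"] allI)
    show "(\<lambda>x. \<eta> x * v x) \<in> H1 ?V"
      unfolding H1_def using L2_subset(1)[OF op V Ww(1)] O.weak_gradient_subset[OF Ww(2) V] by blast
    show "?fx \<in> L2 (surface (frontier ?V))" by (rule surface_extend(1)[OF _ _ f]) auto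
    show "smooth (\<lambda>x. \<eta> x * \<phi> j x)" for j by (rule smooth_mult[OF \<eta>(1) \<phi>])
    have e: "(\<lambda>x. \<eta> x * v x - \<eta> x * \<phi> j x) = (\<lambda>x. \<eta> x * h j x)" for j
      by (simp add: h_def algebra_simps)
    let ?G = "\<lambda>j x. \<eta> x *s H j x + h j x *s grad \<eta> x"
    note wm = O.weak_gradient_mult[OF hL hw \<eta>(1)]
    have s1: "(L2_norm (lebesgue_on ?V) (\<lambda>x. \<eta> x * h j x))\<^sup>2 \<le> B * (L2_norm ?L (h j))\<^sup>2" for j
      by (rule order_trans[OF power_mono[OF L2_subset(2)[OF op V wm(1)] L2_norm_nonneg] B(2)[OF hL]])
    have s2: "(L2_norm (lebesgue_on ?V) (?G j))\<^sup>2 \<le> B * (L2_norm ?L (h j))\<^sup>2 + B * (L2_norm ?L (H j))\<^sup>2" for j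
      by (rule order_trans[OF power_mono[OF L2_subset(2)[OF op V conjunct1[OF B(3)[OF hL HL]]] L2_norm_nonneg]
            conjunct2[OF B(3)[OF hL HL]]])
    show "(\<lambda>j. H1_norm ?V (\<lambda>x. \<eta> x * v x - \<eta> x * \<phi> j x)) \<longlonglongrightarrow> 0"
      unfolding e
    proof (subst V.H1_normI)
      show "(\<lambda>x. \<eta> x * h j x) \<in> L2 (lebesgue_on ?V)" for j by (rule L2_subset(1)[OF op V wm(1)])
      show "has_weak_gradient ?V (\<lambda>x. \<eta> x * h j x) (?G j)" for j by (rule O.weak_gradient_subset[OF wm(2) V])
      have "(\<lambda>j. B * (L2_norm ?L (h j))\<^sup>2) \<longlonglongrightarrow> B * 0"
        "(\<lambda>j. B * (L2_norm ?L (h j))\<^sup>2 + B * (L2_norm ?L (H j))\<^sup>2) \<longlonglongrightarrow> B * 0 + B * 0"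
        unfolding h_def H_def by (intro tendsto_intros lim)+
      then have t: "(\<lambda>j. B * (L2_norm ?L (h j))\<^sup>2) \<longlonglongrightarrow> 0"
        "(\<lambda>j. B * (L2_norm ?L (h j))\<^sup>2 + B * (L2_norm ?L (H j))\<^sup>2) \<longlonglongrightarrow> 0" by simp_all
      have "(\<lambda>j. (L2_norm (lebesgue_on ?V) (\<lambda>x. \<eta> x * h j x))\<^sup>2) \<longlonglongrightarrow> 0"
        by (rule tendsto_sandwich[OF always_eventually always_eventually tendsto_const t(1)]) (simp_all add: s1)
      moreover have "(\<lambda>j. (L2_norm (lebesgue_on ?V) (?G j))\<^sup>2) \<longlonglongrightarrow> 0"
        by (rule tendsto_sandwich[OF always_eventually always_eventually tendsto_const t(2)]) (simp_all add: s2)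
      ultimately show "(\<lambda>j. (L2_norm (lebesgue_on ?V) (\<lambda>x. \<eta> x * h j x))\<^sup>2) \<longlonglongrightarrow> 0 \<and>
          (\<lambda>j. (L2_norm (lebesgue_on ?V) (?G j))\<^sup>2) \<longlonglongrightarrow> 0" ..
    qed
    \<comment> \<open>On the outer boundary \<eta> is 1. All other frontier points of
      \<open>\<Omega> - closure D\<close> lie in \<open>closure D\<close>, where \<eta> and the zero
      extension both vanish.\<close>
    have ef: "L2_norm (surface (frontier ?V)) (\<lambda>x. ?fx x - \<eta> x * \<phi> j x) =
       L2_norm (surface (frontier ?V)) (\<lambda>x. if x \<in> frontier \<Omega> then f x - \<phi> j x else 0)" for j
    proof -
      have "?fx x - \<eta> x * \<phi> j x = (if x \<in> frontier \<Omega> then f x - \<phi> j x else 0)" if x: "x \<in> frontier ?V" for x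
      proof (cases "x \<in> frontier \<Omega>")
        case True
        then have "x \<notin> K'" using \<eta>(3) op by (auto simp: frontier_def interior_open)
        then show ?thesis using True \<eta>(4) by simp
      next
        case False
        have "x \<in> closure \<Omega>" using x closure_mono[of ?V \<Omega>] by (auto simp: frontier_def)
        then have "x \<in> \<Omega>" using False op by (auto simp: frontier_def interior_open)
        moreover have "x \<notin> ?V" using x V(1) by (auto simp: frontier_def interior_open)
        ultimately show ?thesis using False \<eta>(5) by auto
      qed
      then show ?thesis unfolding L2_norm_def surface_def
        by (intro arg_cong[of _ _ sqrt] Bochner_Integration.integral_cong) (auto simp: space_restrict_space)
    qed
    have "f - \<phi> j \<in> L2 (surface (frontier \<Omega>))" for j
      using L2_diff(1)[OF f smooth_L2_surface[OF compact_frontier_bounded[OF bd] fb \<phi>]] by (simp add: fun_diff_def)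
    then have "L2_norm (surface (frontier ?V)) (\<lambda>x. ?fx x - \<eta> x * \<phi> j x) \<le> L2_norm (surface (frontier \<Omega>)) (\<lambda>x. f x - \<phi> j x)" for j
      unfolding ef using surface_extend(2)[of "frontier \<Omega>" "frontier ?V" "\<lambda>x. f x - \<phi> j x"] by (simp add: fun_diff_def)
    then show "(\<lambda>j. L2_norm (surface (frontier ?V)) (\<lambda>x. ?fx x - \<eta> x * \<phi> j x)) \<longlonglongrightarrow> 0"
      by (intro tendsto_sandwich[OF always_eventually always_eventually tendsto_const lim(3)]) (auto simp: L2_norm_nonneg)
  qed
  have gu: "wgrad \<Omega> u \<in> L2 ?L" and gv: "wgrad \<Omega> v \<in> L2 ?L" by (rule O.H1D(3)[OF u], rule O.H1D(3)[OF v])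
  have \<gamma>m: "?\<gamma> \<in> borel_measurable ?L" by (rule borel_measurable_conductivity[OF op D(1)])
  have pair: "integrable ?L (\<lambda>x. ?\<gamma> x * cdot (wgrad \<Omega> u x) (Z x))"
    "cmod (LINT x|?L. ?\<gamma> x * cdot (wgrad \<Omega> u x) (Z x)) \<le> (1 + cmod k) * (L2_norm ?L (wgrad \<Omega> u) * L2_norm ?L Z)"
    if Z: "Z \<in> L2 ?L" for Z :: "real ^ 'n \<Rightarrow> complex ^ 'n"
  proof -
    have m: "(\<lambda>x. ?\<gamma> x * cdot (wgrad \<Omega> u x) (Z x)) \<in> borel_measurable ?L"
      by (intro borel_measurable_times \<gamma>m borel_measurable_cdot L2D(1)[OF gu] L2D(1)[OF Z])
    have le: "cmod (?\<gamma> x * cdot (wgrad \<Omega> u x) (Z x)) \<le> (1 + cmod k) * (norm (wgrad \<Omega> u x) * norm (Z x))" for x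
      unfolding norm_mult by (intro mult_mono conductivity_bound norm_cdot_le) auto
    show "integrable ?L (\<lambda>x. ?\<gamma> x * cdot (wgrad \<Omega> u x) (Z x))"
      by (rule L2_pairing(1)[OF m gu Z _ le]) simp
    show "cmod (LINT x|?L. ?\<gamma> x * cdot (wgrad \<Omega> u x) (Z x)) \<le> (1 + cmod k) * (L2_norm ?L (wgrad \<Omega> u) * L2_norm ?L Z)"
      by (rule L2_pairing(2)[OF m gu Z _ le]) simp
  qed
  \<comment> \<open>\<open>W\<close> vanishes on \<open>closure D\<close> and the conductivity is 1
    elsewhere in \<Omega>, so Green's formula on the exterior part is already the weighted integral
    over \<Omega>.\<close>
  have outer: "g f = (LINT x|?L. ?\<gamma> x * cdot (wgrad \<Omega> u x) (W x))"
  proof -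
    have uV: "has_weak_gradient ?V u (wgrad \<Omega> u)" by (rule O.weak_gradient_subset[OF O.H1D(2)[OF u] V])
    have wV: "has_weak_gradient ?V (\<lambda>x. \<eta> x * v x) W" by (rule O.weak_gradient_subset[OF Ww(2) V])
    have "g f = (LINT x|lebesgue_on ?V. cdot (wgrad ?V u x) (wgrad ?V (\<lambda>x. \<eta> x * v x) x))"
      using nd trV unfolding has_normal_derivative_def by blast
    also have "\<dots> = (LINT x|lebesgue_on ?V. cdot (wgrad \<Omega> u x) (W x))"
    proof (rule integral_cong_AE)
      show "AE x in lebesgue_on ?V. cdot (wgrad ?V u x) (wgrad ?V (\<lambda>x. \<eta> x * v x) x) = cdot (wgrad \<Omega> u x) (W x)"
        using V.wgrad_AE[OF uV] V.wgrad_AE[OF wV] by eventually_elim simp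
      show "(\<lambda>x. cdot (wgrad ?V u x) (wgrad ?V (\<lambda>x. \<eta> x * v x) x)) \<in> borel_measurable (lebesgue_on ?V)"
        using V.has_weak_gradient_wgrad[OF uV] V.has_weak_gradient_wgrad[OF wV]
        by (intro borel_measurable_cdot L2D(1)) (auto simp: has_weak_gradient_def)
      show "(\<lambda>x. cdot (wgrad \<Omega> u x) (W x)) \<in> borel_measurable (lebesgue_on ?V)"
        using uV wV by (intro borel_measurable_cdot L2D(1)) (auto simp: has_weak_gradient_def)
    qed
    also have "\<dots> = (LINT x|?L. cdot (wgrad \<Omega> u x) (W x))"
      by (rule lebesgue_on_transfer(1)[OF op V(1) _ V(2), symmetric]) (simp add: W_def \<eta>(5,6) cdot_zero_right)
    also have "\<dots> = (LINT x|?L. ?\<gamma> x * cdot (wgrad \<Omega> u x) (W x))"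
    proof (rule Bochner_Integration.integral_cong)
      fix x assume "x \<in> space ?L"
      then have x: "x \<in> \<Omega>" by (simp add: space_restrict_space)
      show "cdot (wgrad \<Omega> u x) (W x) = ?\<gamma> x * cdot (wgrad \<Omega> u x) (W x)"
      proof (cases "x \<in> D")
        case True
        then have "x \<in> closure D" using closure_subset by blast
        then show ?thesis by (simp add: W_def \<eta>(5,6) cdot_zero_right)
      next
        case False then show ?thesis using x by (simp add: conductivity_def)
      qed
    qed simp
    finally show ?thesis .
  qed
  \<comment> \<open>A weak gradient of (1 - \<eta>) v.\<close>
  define Y where "Y x = wgrad \<Omega> v x - W x" for x
  have YL: "Y \<in> L2 ?L" unfolding Y_def by (rule L2_diff(1)[OF gv WL])
  have inner: "(LINT x|?L. ?\<gamma> x * cdot (wgrad \<Omega> u x) (Y x)) = 0"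
  proof -
    define Z R where "Z j = grad (\<lambda>x. (1 - \<eta> x) * \<phi> j x)" and "R j x = H j x - (\<eta> x *s H j x + h j x *s grad \<eta> x)" for j x
    have s1: "smooth (\<lambda>x. 1 - \<eta> x)" by (intro smooth_diff smooth_const \<eta>)
    have ZL: "Z j \<in> L2 ?L" for j unfolding Z_def by (intro smooth_grad_L2 op bd smooth_mult s1 \<phi>)
    have RL: "R j \<in> L2 ?L" and Rn: "(L2_norm ?L (R j))\<^sup>2 \<le> 2 * (L2_norm ?L (H j))\<^sup>2 + 2 * (B * (L2_norm ?L (h j))\<^sup>2 + B * (L2_norm ?L (H j))\<^sup>2)" for j
    proof -
      have b: "(\<lambda>x. \<eta> x *s H j x + h j x *s grad \<eta> x) \<in> L2 ?L"
        "(L2_norm ?L (\<lambda>x. \<eta> x *s H j x + h j x *s grad \<eta> x))\<^sup>2 \<le> B * (L2_norm ?L (h j))\<^sup>2 + B * (L2_norm ?L (H j))\<^sup>2"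
        using B(3)[OF hL HL] by auto
      show "R j \<in> L2 ?L" unfolding R_def by (rule L2_diff(1)[OF HL b(1)])
      show "(L2_norm ?L (R j))\<^sup>2 \<le> 2 * (L2_norm ?L (H j))\<^sup>2 + 2 * (B * (L2_norm ?L (h j))\<^sup>2 + B * (L2_norm ?L (H j))\<^sup>2)"
        unfolding R_def
        by (rule order_trans[OF L2_diff(2)[OF HL b(1)]]) (intro add_left_mono mult_left_mono b(2), simp)
    qed
    \<comment> \<open>\<open>Z j\<close> is the gradient of the test function (1 - \<eta>) \<phi> j,
      which the divergence equation annihilates; the remainder \<open>R j\<close> tends to zero in
      \<open>L2\<close>.\<close>
    have YZR: "Y x = Z j x + R j x" for j x
    proof -
      have "partial i (\<lambda>x. (1 - \<eta> x) * \<phi> j x) x = - partial i \<eta> x * \<phi> j x + (1 - \<eta> x) * partial i (\<phi> j) x" for i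
      proof -
        have "partial i (\<lambda>x. 1 + (- 1) * \<eta> x) x = - partial i \<eta> x"
          using partial_add[OF smooth_const smooth_mult[OF smooth_const \<eta>(1)], of i 1 "-1" x]
            partial_mult[OF smooth_const \<eta>(1), of i "-1" x] by (simp add: partial_const)
        then have "partial i (\<lambda>x. 1 - \<eta> x) x = - partial i \<eta> x" by simp
        then show ?thesis using partial_mult[OF s1 \<phi>, of i j x] by simp
      qed
      then show ?thesis
        by (simp add: Y_def W_def Z_def R_def H_def h_def grad_def vec_eq_iff algebra_simps)
    qed
    have Z0: "(LINT x|?L. ?\<gamma> x * cdot (wgrad \<Omega> u x) (Z j x)) = 0" for j
    proof -
      have "test_fun \<Omega> (\<lambda>x. (1 - \<eta> x) * \<phi> j x)"
        unfolding test_fun_def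
        by (intro conjI exI[of _ K'] smooth_mult s1 \<phi> \<eta>(2,3)) (simp add: \<eta>(4))
      then show ?thesis using eq unfolding divergence_equation_def Z_def grad_def by blast
    qed
    have "(LINT x|?L. ?\<gamma> x * cdot (wgrad \<Omega> u x) (Y x)) = (LINT x|?L. ?\<gamma> x * cdot (wgrad \<Omega> u x) (R j x))" for j
    proof -
      have "(LINT x|?L. ?\<gamma> x * cdot (wgrad \<Omega> u x) (Y x)) =
         (LINT x|?L. ?\<gamma> x * cdot (wgrad \<Omega> u x) (Z j x) + ?\<gamma> x * cdot (wgrad \<Omega> u x) (R j x))"
        by (simp add: YZR[of _ j] cdot_add_right algebra_simps)
      also have "\<dots> = (LINT x|?L. ?\<gamma> x * cdot (wgrad \<Omega> u x) (Z j x)) + (LINT x|?L. ?\<gamma> x * cdot (wgrad \<Omega> u x) (R j x))"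
        by (rule Bochner_Integration.integral_add[OF pair(1)[OF ZL] pair(1)[OF RL]])
      finally show ?thesis by (simp add: Z0)
    qed
    then have le: "cmod (LINT x|?L. ?\<gamma> x * cdot (wgrad \<Omega> u x) (Y x)) \<le> (1 + cmod k) * (L2_norm ?L (wgrad \<Omega> u) * L2_norm ?L (R j))" for j
      using pair(2)[OF RL] by simp
    have "(\<lambda>j. (L2_norm ?L (R j))\<^sup>2) \<longlonglongrightarrow> 0"
    proof (rule tendsto_sandwich[OF _ _ tendsto_const])
      have "(\<lambda>j. 2 * (L2_norm ?L (H j))\<^sup>2 + 2 * (B * (L2_norm ?L (h j))\<^sup>2 + B * (L2_norm ?L (H j))\<^sup>2)) \<longlonglongrightarrow> 2 * 0 + 2 * (B * 0 + B * 0)"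
        unfolding h_def H_def by (intro tendsto_intros lim)
      then show "(\<lambda>j. 2 * (L2_norm ?L (H j))\<^sup>2 + 2 * (B * (L2_norm ?L (h j))\<^sup>2 + B * (L2_norm ?L (H j))\<^sup>2)) \<longlonglongrightarrow> 0" by simp
    qed (use Rn in auto)
    then have "(\<lambda>j. sqrt ((L2_norm ?L (R j))\<^sup>2)) \<longlonglongrightarrow> sqrt 0" by (rule tendsto_real_sqrt)
    then have "(\<lambda>j. L2_norm ?L (R j)) \<longlonglongrightarrow> 0" by (simp add: L2_norm_nonneg)
    then have "(\<lambda>j. (1 + cmod k) * (L2_norm ?L (wgrad \<Omega> u) * L2_norm ?L (R j))) \<longlonglongrightarrow> (1 + cmod k) * (L2_norm ?L (wgrad \<Omega> u) * 0)"
      by (intro tendsto_intros)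
    then have "cmod (LINT x|?L. ?\<gamma> x * cdot (wgrad \<Omega> u x) (Y x)) \<le> (1 + cmod k) * (L2_norm ?L (wgrad \<Omega> u) * 0)"
      by (rule LIMSEQ_le_const) (use le in auto)
    then show ?thesis by simp
  qed
  have "(LINT x|?L. ?\<gamma> x * cdot (wgrad \<Omega> u x) (wgrad \<Omega> v x)) =
     (LINT x|?L. ?\<gamma> x * cdot (wgrad \<Omega> u x) (W x) + ?\<gamma> x * cdot (wgrad \<Omega> u x) (Y x))"
    by (simp add: Y_def distrib_left[symmetric] cdot_add_right[symmetric])
  also have "\<dots> = (LINT x|?L. ?\<gamma> x * cdot (wgrad \<Omega> u x) (W x)) + (LINT x|?L. ?\<gamma> x * cdot (wgrad \<Omega> u x) (Y x))"
    by (rule Bochner_Integration.integral_add[OF pair(1)[OF WL] pair(1)[OF YL]])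
  finally show ?thesis using outer inner by simp
qed

section \<open>The uniform estimate\<close>

text \<open>As an equivalence this makes the two choice predicates equal, so that
  \<open>wgrad\<close> is literally unchanged by adding a constant and not only almost
  everywhere.\<close>

lemma (in bounded_open) weak_gradient_add_const_iff:
  assumes u: "u \<in> L2 (lebesgue_on U)"
  shows "has_weak_gradient U (\<lambda>x. u x + c) G \<longleftrightarrow> has_weak_gradient U u G"
proof -
  have g: "grad (\<lambda>_. d) x = (0 :: complex ^ 'n)" for d x by (simp add: grad_def vec_eq_iff partial_const)
  have c: "(\<lambda>_. d) \<in> L2 (lebesgue_on U)" "has_weak_gradient U (\<lambda>_. d) (\<lambda>_. 0)" for d :: complex
    using smooth_L2[OF op bd smooth_const] weak_gradient_smooth[OF smooth_const, of d] by (simp_all add: g[abs_def])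
  have *: "has_weak_gradient U (\<lambda>x. w x + d) G"
    if "w \<in> L2 (lebesgue_on U)" "has_weak_gradient U w G" for w d
    using weak_gradient_add_scaled[OF that c, of 1 d] by simp
  have "has_weak_gradient U u G" if "has_weak_gradient U (\<lambda>x. u x + c) G"
    using *[OF L2_add(1)[OF u c(1)] that, of "- c"] by simp
  then show ?thesis using *[OF u] by blast
qed

lemma (in bounded_open) wgrad_add_const:
  "u \<in> L2 (lebesgue_on U) \<Longrightarrow> wgrad U (\<lambda>x. u x + c) = wgrad U u"
  unfolding wgrad_def by (intro arg_cong[of _ _ Eps] ext weak_gradient_add_const_iff)

lemma (in bounded_open) H1_add_const:
  assumes "u \<in> H1 U" shows "(\<lambda>x. u x + c) \<in> H1 U"
  using H1D[OF assms] L2_add(1)[OF H1D(1)[OF assms] smooth_L2[OF op bd smooth_const]]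
  unfolding H1_def by (auto simp: weak_gradient_add_const_iff)

lemma (in bounded_open) has_trace_add_const:
  assumes "has_trace U S u f" "(\<lambda>_. c) \<in> L2 (surface S)"
  shows "has_trace U S (\<lambda>x. u x + c) (\<lambda>x. f x + c)"
proof -
  obtain \<phi> where "u \<in> H1 U" "f \<in> L2 (surface S)" "\<And>j. smooth (\<phi> j)"
    "(\<lambda>j. H1_norm U (\<lambda>x. u x - \<phi> j x)) \<longlonglongrightarrow> 0" "(\<lambda>j. L2_norm (surface S) (\<lambda>x. f x - \<phi> j x)) \<longlonglongrightarrow> 0"
    using assms(1) unfolding has_trace_def by blast
  then show ?thesis unfolding has_trace_def
    by (intro conjI exI[of _ "\<lambda>j x. \<phi> j x + c"] H1_add_const L2_add(1) assms(2) allI smooth_add smooth_const) simp_all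
qed

text \<open>Both functions have the same derivatives at each point, so the choice inside
  \<open>frechet_derivative\<close> agrees even where none exists.\<close>

lemma partial_add_const: "partial i (\<lambda>x. h x + c) = partial i h"
proof -
  have "((\<lambda>x. h x + c) has_derivative D) (at x) \<longleftrightarrow> (h has_derivative D) (at x)" for x D
  proof
    assume "((\<lambda>x. h x + c) has_derivative D) (at x)"
    from has_derivative_add[OF this has_derivative_const[of "- c"]] show "(h has_derivative D) (at x)" by simp
  next
    assume "(h has_derivative D) (at x)"
    from has_derivative_add[OF this has_derivative_const[of c]] show "((\<lambda>x. h x + c) has_derivative D) (at x)" by simp
  qed
  then show ?thesis by (simp add: partial_def[abs_def] frechet_derivative_def)
qed

lemma harmonic_add_const: "harmonic U u \<Longrightarrow> harmonic U (\<lambda>x. u x + c)"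
proof -
  assume "harmonic U u"
  then obtain h where h: "AE x in lebesgue_on U. u x = h x" "C_on 2 U h"
    "\<forall>x \<in> U. (\<Sum>i\<in>UNIV. partial i (partial i h) x) = 0"
    unfolding harmonic_def by blast
  have "AE x in lebesgue_on U. u x + c = h x + c" using h(1) by eventually_elim simp
  then show ?thesis unfolding harmonic_def
    using h C_on_add[OF h(2) C_on_const]
    by (intro exI[of _ "\<lambda>x. h x + c"]) (simp add: partial_add_const)
qed

text \<open>
  If the boundary measure vanished, the normalisation of the mean would be void and solutions
  would only be unique up to constants.
\<close>

lemma is_solution_add_const:
  fixes \<Omega> D :: "(real ^ 'n) set"
  assumes dim: "CARD('n) \<ge> 2" and bd: "bounded \<Omega>" and lip: "lipschitz_domain \<Omega>" "lipschitz_domain D"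
    and D: "closure D \<subseteq> \<Omega>" and null: "measure (surface (frontier \<Omega>)) (frontier \<Omega>) = 0"
    and sol: "is_solution \<Omega> D k g u"
  shows "is_solution \<Omega> D k g (\<lambda>x. u x + c)"
proof -
  let ?V = "\<Omega> - closure D"
  have op: "open \<Omega>" "open D" using lip by (auto simp: lipschitz_domain_def)
  have DO: "D \<subseteq> \<Omega>" using D closure_subset by blast
  have bdD: "bounded D" by (rule bounded_subset[OF bd DO])
  interpret O: bounded_open \<Omega> using op bd by unfold_locales
  interpret D: bounded_open D using op bdD by unfold_locales
  interpret V: bounded_open ?V using op bounded_subset[OF bd, of ?V] by unfold_locales auto
  have cL2: "(\<lambda>_. c) \<in> L2 (surface (frontier \<Omega>))" "(\<lambda>_. c) \<in> L2 (surface (frontier D))"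
    by (intro smooth_L2_surface compact_frontier_bounded boundary_poincare dim bd bdD lip smooth_const)+
  have sp: "space (surface (frontier \<Omega>)) = frontier \<Omega>" by (simp add: surface_def space_restrict_space)
  interpret S: finite_measure "surface (frontier \<Omega>)"
    using boundary_poincare(1)[OF dim bd lip(1)] fborel_def by blast
  \<comment> \<open>With zero total mass every integral over the boundary vanishes, so adding a
    constant keeps the normalisation.\<close>
  have mean0: "(LINT x|surface (frontier \<Omega>). F x) = 0" for F :: "real ^ 'n \<Rightarrow> complex"
  proof (rule integral_eq_zero_AE)
    have "emeasure (surface (frontier \<Omega>)) (space (surface (frontier \<Omega>))) = 0"
      using null by (simp add: sp S.emeasure_eq_measure)
    then have "space (surface (frontier \<Omega>)) \<in> null_sets (surface (frontier \<Omega>))" by (intro null_setsI) auto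
    then show "AE x in surface (frontier \<Omega>). F x = 0" by (rule AE_I') auto
  qed
  have u: "u \<in> H1 \<Omega>" "divergence_equation \<Omega> (conductivity \<Omega> D k) u" "harmonic D u" "harmonic ?V u"
    "transmission \<Omega> D k u" "has_normal_derivative ?V (frontier \<Omega>) u g"
    using sol unfolding is_solution_def by auto
  obtain f where f: "has_trace \<Omega> (frontier \<Omega>) u f" using sol unfolding is_solution_def by blast
  obtain f' where f': "has_trace ?V (frontier D) u f'" "has_trace D (frontier D) u f'"
    using u(5) unfolding transmission_def by blast
  have uV: "u \<in> H1 ?V" and uD: "u \<in> H1 D" using f' by (auto simp: has_trace_def)
  have nd: "has_normal_derivative ?V S (\<lambda>x. u x + c) q \<longleftrightarrow> has_normal_derivative ?V S u q"
    "has_normal_derivative D S (\<lambda>x. u x + c) q \<longleftrightarrow> has_normal_derivative D S u q" for S q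
    unfolding has_normal_derivative_def V.wgrad_add_const[OF V.H1D(1)[OF uV]] D.wgrad_add_const[OF D.H1D(1)[OF uD]]
    by (rule refl)+
  have "transmission \<Omega> D k (\<lambda>x. u x + c)"
    unfolding transmission_def nd
    using u(5) V.has_trace_add_const[OF f'(1) cL2(2)] D.has_trace_add_const[OF f'(2) cL2(2)]
    unfolding transmission_def by blast
  moreover have "divergence_equation \<Omega> (conductivity \<Omega> D k) (\<lambda>x. u x + c)"
    using u(2) unfolding divergence_equation_def O.wgrad_add_const[OF O.H1D(1)[OF u(1)]] .
  ultimately show ?thesis
    unfolding is_solution_def nd
    using O.H1_add_const[OF u(1)] harmonic_add_const[OF u(3)] harmonic_add_const[OF u(4)] u(6)
      O.has_trace_add_const[OF f cL2(1)] mean0 by blast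
qed

section \<open>Scaling and conjugation in the Sobolev and trace spaces\<close>

lemma (in bounded_open) weak_gradient_scale:
  assumes "u \<in> H1 U" shows "has_weak_gradient U (\<lambda>x. c * u x) (\<lambda>x. c *s wgrad U u x)" "(\<lambda>x. c * u x) \<in> L2 (lebesgue_on U)"
proof -
  have g: "grad (\<lambda>_. c) x = (0 :: complex ^ 'n)" for x by (simp add: grad_def vec_eq_iff partial_const)
  show "has_weak_gradient U (\<lambda>x. c * u x) (\<lambda>x. c *s wgrad U u x)" "(\<lambda>x. c * u x) \<in> L2 (lebesgue_on U)"
    using weak_gradient_mult[OF H1D(1,2)[OF assms] smooth_const, of c] by (simp_all add: g)
qed

lemma L2_norm_scale:
  "L2_norm M (\<lambda>x. c * f x) = cmod c * L2_norm M f"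
  "L2_norm M (\<lambda>x. c *s (G x :: complex ^ 'n)) = cmod c * L2_norm M G"
  by (simp_all add: L2_norm_def norm_mult norm_vector_scalar_mult power_mult_distrib real_sqrt_mult)

lemma (in bounded_open) H1_norm_scale:
  assumes "u \<in> H1 U" shows "H1_norm U (\<lambda>x. c * u x) = cmod c * H1_norm U u"
proof -
  have "(H1_norm U (\<lambda>x. c * u x))\<^sup>2 = (cmod c * H1_norm U u)\<^sup>2"
    unfolding H1_norm_eq[OF weak_gradient_scale(1)[OF assms]] power_mult_distrib H1_norm_eq[OF H1D(2)[OF assms]] L2_norm_scale
    by (simp add: algebra_simps)
  then show ?thesis by (rule power2_eq_imp_eq) (simp_all add: H1_norm_def)
qed

lemma (in bounded_open) has_trace_scale:
  assumes "has_trace U S u f" shows "has_trace U S (\<lambda>x. c * u x) (\<lambda>x. c * f x)"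
proof -
  obtain \<phi> where u: "u \<in> H1 U" and f: "f \<in> L2 (surface S)" and \<phi>: "\<And>j. smooth (\<phi> j)"
    and lim: "(\<lambda>j. H1_norm U (\<lambda>x. u x - \<phi> j x)) \<longlonglongrightarrow> 0" "(\<lambda>j. L2_norm (surface S) (\<lambda>x. f x - \<phi> j x)) \<longlonglongrightarrow> 0"
    using assms unfolding has_trace_def by blast
  have d: "(\<lambda>x. u x - \<phi> j x) \<in> H1 U" for j
    using L2_diff(1)[OF H1D(1)[OF u] smooth_L2[OF op bd \<phi>]]
      weak_gradient_diff[OF H1D(1,2)[OF u] smooth_L2[OF op bd \<phi>] weak_gradient_smooth[OF \<phi>]]
    unfolding H1_def by blast
  have e: "c * a - c * b = c * (a - b)" for a b :: complex by (simp add: algebra_simps)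
  have "(\<lambda>j. H1_norm U (\<lambda>x. c * u x - c * \<phi> j x)) \<longlonglongrightarrow> 0"
    unfolding e H1_norm_scale[OF d] using tendsto_mult_right_zero[OF lim(1)] .
  moreover have "(\<lambda>j. L2_norm (surface S) (\<lambda>x. c * f x - c * \<phi> j x)) \<longlonglongrightarrow> 0"
    unfolding e L2_norm_scale using tendsto_mult_right_zero[OF lim(2)] .
  moreover have "(\<lambda>x. c * u x) \<in> H1 U" unfolding H1_def using weak_gradient_scale[OF u] by blast
  moreover have "(\<lambda>x. c * f x) \<in> L2 (surface S)"
    by (rule L2_dominated(1)[OF borel_measurable_times[OF borel_measurable_const L2D(1)[OF f]] f f, where c = "(cmod c)\<^sup>2" and d = 0])
       (simp add: norm_mult power_mult_distrib)
  ultimately show ?thesis unfolding has_trace_def using smooth_mult[OF smooth_const \<phi>]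
    by (intro conjI exI[of _ "\<lambda>j x. c * \<phi> j x"]) auto
qed

lemma (in bounded_open) has_trace_cnj:
  assumes "has_trace U S u f" shows "has_trace U S (\<lambda>x. cnj (u x)) (\<lambda>x. cnj (f x))"
    "H1_norm U (\<lambda>x. cnj (u x)) = H1_norm U u"
proof -
  obtain \<phi> where u: "u \<in> H1 U" and f: "f \<in> L2 (surface S)" and \<phi>: "\<And>j. smooth (\<phi> j)"
    and lim: "(\<lambda>j. H1_norm U (\<lambda>x. u x - \<phi> j x)) \<longlonglongrightarrow> 0" "(\<lambda>j. L2_norm (surface S) (\<lambda>x. f x - \<phi> j x)) \<longlonglongrightarrow> 0"
    using assms unfolding has_trace_def by blast
  have cnjL2: "(\<lambda>x. cnj (q x)) \<in> L2 M" if q: "q \<in> L2 M" for q :: "'m \<Rightarrow> complex" and M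
    by (rule L2_dominated(1)[OF borel_measurable_continuous_on[where f = cnj, OF continuous_on_cnj[OF continuous_on_id] L2D(1)[OF q]] q q,
          where c = 1 and d = 0]) simp
  have nc: "H1_norm U (\<lambda>x. cnj (w x)) = H1_norm U w" if w: "w \<in> H1 U" for w
  proof -
    have n: "norm ((\<chi> i. cnj (v $ i)) :: complex ^ 'n) = norm v" for v :: "complex ^ 'n"
      by (simp add: norm_vec_def)
    have "(H1_norm U (\<lambda>x. cnj (w x)))\<^sup>2 = (H1_norm U w)\<^sup>2"
      unfolding H1_norm_eq[OF weak_gradient_cnj[OF H1D(2)[OF w]]] H1_norm_eq[OF H1D(2)[OF w]]
      by (simp add: L2_norm_def n)
    then show ?thesis by (rule power2_eq_imp_eq) (simp_all add: H1_norm_def)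
  qed
  show "H1_norm U (\<lambda>x. cnj (u x)) = H1_norm U u" by (rule nc[OF u])
  have d: "(\<lambda>x. u x - \<phi> j x) \<in> H1 U" for j
    using L2_diff(1)[OF H1D(1)[OF u] smooth_L2[OF op bd \<phi>]]
      weak_gradient_diff[OF H1D(1,2)[OF u] smooth_L2[OF op bd \<phi>] weak_gradient_smooth[OF \<phi>]]
    unfolding H1_def by blast
  have "(\<lambda>j. H1_norm U (\<lambda>x. cnj (u x) - cnj (\<phi> j x))) \<longlonglongrightarrow> 0"
    unfolding complex_cnj_diff[symmetric] nc[OF d] by (rule lim(1))
  moreover have "(\<lambda>j. L2_norm (surface S) (\<lambda>x. cnj (f x) - cnj (\<phi> j x))) \<longlonglongrightarrow> 0"
    using lim(2) unfolding L2_norm_def complex_cnj_diff[symmetric] complex_mod_cnj .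
  moreover have "(\<lambda>x. cnj (u x)) \<in> H1 U"
    unfolding H1_def using cnjL2[OF H1D(1)[OF u]] weak_gradient_cnj[OF H1D(2)[OF u]] by blast
  ultimately show "has_trace U S (\<lambda>x. cnj (u x)) (\<lambda>x. cnj (f x))"
    unfolding has_trace_def using cnjL2[OF f] smooth_cnj[OF \<phi>]
    by (intro conjI exI[of _ "\<lambda>j x. cnj (\<phi> j x)"]) auto
qed

lemma H1_norm_nonneg: "0 \<le> H1_norm U u"
  by (simp add: H1_norm_def)

text \<open>The trace is scaled by the reciprocal norm of \<open>v\<close> to land in the unit ball
  over which the dual norm is taken. If that norm is zero, boundedness of \<open>g\<close> forces
  \<open>g f = 0\<close>. The supremum is over real numbers, so its set must be shown bounded and
  nonempty.\<close>

lemma (in bounded_open) H_mhalf_bound: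
  assumes g: "g \<in> H_mhalf U" and tr: "has_trace U (frontier U) v f"
  shows "cmod (g f) \<le> H_mhalf_norm U g * H1_norm U v" "0 \<le> H_mhalf_norm U g"
proof -
  have half: "0 \<le> H_half_norm U q \<and> H_half_norm U q \<le> H1_norm U w" if "has_trace U (frontier U) w q" for w q
  proof
    have ne: "{H1_norm U v |v. has_trace U (frontier U) v q} \<noteq> {}" using that by blast
    show "0 \<le> H_half_norm U q" unfolding H_half_norm_def
      by (rule cInf_greatest[OF ne]) (auto simp: H1_norm_nonneg)
    have "bdd_below {H1_norm U v |v. has_trace U (frontier U) v q}"
      by (rule bdd_belowI[of _ 0]) (auto simp: H1_norm_nonneg)
    then show "H_half_norm U q \<le> H1_norm U w" unfolding H_half_norm_def
      using that by (intro cInf_lower) blast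
  qed
  obtain M where M: "\<And>q. q \<in> H_half U \<Longrightarrow> cmod (g q) \<le> M * H_half_norm U q"
    using g unfolding H_mhalf_def by blast
  have lin: "g (\<lambda>x. c * q x) = c * g q" if "q \<in> H_half U" for c q
    using g that unfolding H_mhalf_def by blast
  have bdd: "bdd_above {cmod (g f) |f. f \<in> H_half U \<and> H_half_norm U f \<le> 1}"
  proof (rule bdd_aboveI[of _ "\<bar>M\<bar>"])
    fix y assume "y \<in> {cmod (g f) |f. f \<in> H_half U \<and> H_half_norm U f \<le> 1}"
    then obtain q where q: "y = cmod (g q)" "q \<in> H_half U" "H_half_norm U q \<le> 1" by blast
    have "0 \<le> H_half_norm U q" using half q(2) unfolding H_half_def by blast
    then have "M * H_half_norm U q \<le> \<bar>M\<bar> * 1" using q(3) by (intro mult_mono) auto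
    then show "y \<le> \<bar>M\<bar>" using M[OF q(2)] q(1) by simp
  qed
  have sup: "cmod (g q) \<le> H_mhalf_norm U g" if "has_trace U (frontier U) w q" "H1_norm U w \<le> 1" for w q
    unfolding H_mhalf_norm_def
  proof (rule cSup_upper[OF _ bdd])
    have "q \<in> H_half U" using that(1) unfolding H_half_def by blast
    moreover have "H_half_norm U q \<le> 1" using half[OF that(1)] that(2) by linarith
    ultimately show "cmod (g q) \<in> {cmod (g f) |f. f \<in> H_half U \<and> H_half_norm U f \<le> 1}" by blast
  qed
  have v: "v \<in> H1 U" and fH: "f \<in> H_half U" using tr unfolding has_trace_def H_half_def by blast+
  \<comment> \<open>The zero multiple of the given trace is a member of the set, whence its supremum
    is nonnegative.\<close>
  have s0: "cmod (g (\<lambda>x. 0 * f x)) \<le> H_mhalf_norm U g"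
    by (rule sup[OF has_trace_scale[OF tr]]) (simp add: H1_norm_scale[OF v, of 0, simplified])
  show nn: "0 \<le> H_mhalf_norm U g"
    using s0 norm_ge_zero order_trans by blast
  show "cmod (g f) \<le> H_mhalf_norm U g * H1_norm U v"
  proof (cases "H1_norm U v = 0")
    case True
    then have "H_half_norm U f = 0" using half[OF tr] by linarith
    then have "cmod (g f) \<le> 0" using M[OF fH] by simp
    then show ?thesis using True by simp
  next
    case False
    then have p: "H1_norm U v > 0" using H1_norm_nonneg[of U v] by linarith
    define c where "c = complex_of_real (1 / H1_norm U v)"
    have cc: "cmod c = 1 / H1_norm U v" unfolding c_def norm_of_real using p by simp
    have "cmod (g (\<lambda>x. c * f x)) \<le> H_mhalf_norm U g"
      by (rule sup[OF has_trace_scale[OF tr]]) (use p in \<open>simp add: H1_norm_scale[OF v] cc\<close>)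
    then have "cmod (g f) / H1_norm U v \<le> H_mhalf_norm U g"
      by (simp add: lin[OF fH] norm_mult cc)
    then show ?thesis using p by (simp add: pos_divide_le_eq)
  qed
qed

text \<open>For large |Im k| the imaginary part of s + k t controls t; for Re k >= 0 the two terms
  do not cancel and |s + k t| >= |k| t. Then s is recovered by the triangle inequality, which costs
  the factor |k|.\<close>

lemma norm_add_scaled_ge:
  fixes k :: complex and s t :: real
  assumes st: "0 \<le> s" "0 \<le> t" and \<delta>: "0 < \<delta>" and k: "\<delta> \<le> Re k \<or> \<delta> \<le> \<bar>Im k\<bar> \<or> (0 \<le> Re k \<and> \<delta> \<le> cmod k)"
  shows "s + t \<le> (1 + (1 + cmod k) / \<delta>) * cmod (of_real s + k * of_real t)"
proof -
  let ?z = "of_real s + k * of_real t"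
  have re: "Re ?z = s + Re k * t" and im: "Im ?z = Im k * t" by simp_all
  have "\<delta> * t \<le> cmod ?z"
  proof -
    \<comment> \<open>The alternative \<delta> \<le> Re k is a special case of the second one
      here.\<close>
    consider "\<delta> \<le> \<bar>Im k\<bar>" | "0 \<le> Re k" "\<delta> \<le> cmod k" using k \<delta> abs_Re_le_cmod[of k] by fastforce
    then show ?thesis
    proof cases
      case 1
      then have "\<delta> * t \<le> \<bar>Im ?z\<bar>" unfolding im abs_mult using st by (simp add: mult_right_mono)
      then show ?thesis using abs_Im_le_cmod order_trans by blast
    next
      case 2
      have "(cmod k * t)\<^sup>2 \<le> (cmod ?z)\<^sup>2"
      proof -
        have "(Re k * t)\<^sup>2 \<le> (s + Re k * t)\<^sup>2" using 2 st by (intro power_mono) auto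
        then show ?thesis unfolding cmod_power2 power_mult_distrib re im by (simp add: algebra_simps power_mult_distrib)
      qed
      then have "cmod k * t \<le> cmod ?z" by (rule power2_le_imp_le) simp
      moreover have "\<delta> * t \<le> cmod k * t" using 2 st by (simp add: mult_right_mono)
      ultimately show ?thesis by linarith
    qed
  qed
  then have t: "t \<le> cmod ?z / \<delta>" using \<delta> by (simp add: pos_le_divide_eq mult.commute)
  have "s = cmod (?z - k * of_real t)" using st by simp
  also have "\<dots> \<le> cmod ?z + cmod k * t" using norm_triangle_ineq4[of ?z "k * of_real t"] st by (simp add: norm_mult)
  also have "\<dots> \<le> cmod ?z + cmod k * (cmod ?z / \<delta>)" using mult_left_mono[OF t, of "cmod k"] by simp
  finally have "s + t \<le> cmod ?z + cmod k * (cmod ?z / \<delta>) + cmod ?z / \<delta>" using t by linarith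
  also have "\<dots> = (1 + (1 + cmod k) / \<delta>) * cmod ?z" using \<delta> by (simp add: field_simps)
  finally show ?thesis .
qed

text \<open>In the annulus the point -|k| belongs to [a, b], so k is farther than \<epsilon> from
  it. For Re k < 0 that distance is comparable to |Im k|.\<close>

lemma Q_set_annulus:
  assumes ab: "a < b" "b < 0" and \<epsilon>: "0 < \<epsilon>" and k: "k \<in> Q_set a b \<epsilon>" and mod: "cmod k \<le> - a" "- b \<le> cmod k"
  shows "\<epsilon> / 2 \<le> \<bar>Im k\<bar> \<or> (0 \<le> Re k \<and> - b \<le> cmod k)"
proof (cases "0 \<le> Re k")
  case False
  define r where "r = cmod k"
  have r: "r > 0" unfolding r_def using mod(2) ab by linarith
  have "complex_of_real (- r) \<in> complex_of_real ` {a..b}" using mod by (auto simp: r_def)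
  then have "infdist k (complex_of_real ` {a..b}) \<le> dist k (complex_of_real (- r))" by (rule infdist_le)
  then have "\<epsilon> < cmod (k + of_real r)" using k by (simp add: Q_set_def dist_norm)
  then have e: "\<epsilon>\<^sup>2 < (cmod (k + of_real r))\<^sup>2" using \<epsilon> by (intro power_strict_mono) auto
  have rr: "r\<^sup>2 = (Re k)\<^sup>2 + (Im k)\<^sup>2" by (simp add: r_def cmod_power2)
  have s: "0 \<le> r + Re k" using abs_Re_le_cmod[of k] by (simp add: r_def abs_le_iff)
  \<comment> \<open>The product (r + Re k) (r - Re k) equals (Im k)^2, and Re k < 0 makes the first
    factor the smaller one.\<close>
  have "(r + Re k)\<^sup>2 \<le> (r + Re k) * (r - Re k)"
    unfolding power2_eq_square using s False by (intro mult_left_mono) auto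
  also have "\<dots> = (Im k)\<^sup>2" using rr by (simp add: algebra_simps power2_eq_square)
  finally have "(cmod (k + of_real r))\<^sup>2 \<le> 2 * (Im k)\<^sup>2" by (simp add: cmod_power2 add.commute)
  also have "\<dots> \<le> (2 * \<bar>Im k\<bar>)\<^sup>2" by (simp add: power_mult_distrib)
  finally have "\<epsilon>\<^sup>2 \<le> (2 * \<bar>Im k\<bar>)\<^sup>2" using e by linarith
  then have "\<epsilon> \<le> 2 * \<bar>Im k\<bar>" by (rule power2_le_imp_le) simp
  then show ?thesis by simp
qed (use mod in simp)

text \<open>The square of the norm of u is bounded by the functional at the conjugate trace, which
  is only linear in that norm, so one power cancels. The dependence on k and \<delta> stays explicit
  because k ranges over the whole annulus later.\<close>

lemma energy_estimate:
  fixes \<Omega> D :: "(real ^ 'n) set"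
  assumes dim: "CARD('n) \<ge> 2" and bd: "bounded \<Omega>" and lip: "lipschitz_domain \<Omega>" "lipschitz_domain D"
    and D: "closure D \<subseteq> \<Omega>" and pos: "measure (surface (frontier \<Omega>)) (frontier \<Omega>) > 0"
  obtains C where "C \<ge> 0" "\<And>k g u \<delta>. 0 < \<delta> \<Longrightarrow> \<delta> \<le> \<bar>Im k\<bar> \<or> (0 \<le> Re k \<and> \<delta> \<le> cmod k) \<Longrightarrow> g \<in> H_mhalf \<Omega> \<Longrightarrow>
     is_solution \<Omega> D k g u \<Longrightarrow> H1_norm \<Omega> u \<le> C * (1 + (1 + cmod k) / \<delta>) * H_mhalf_norm \<Omega> g"
proof -
  have op: "open \<Omega>" "open D" using lip by (auto simp: lipschitz_domain_def)
  interpret O: bounded_open \<Omega> using op bd by unfold_locales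
  obtain C where C: "C \<ge> 0" "\<And>u f. has_trace \<Omega> (frontier \<Omega>) u f \<Longrightarrow> (LINT x|surface (frontier \<Omega>). f x) = 0 \<Longrightarrow>
     (L2_norm (lebesgue_on \<Omega>) u)\<^sup>2 \<le> C * (L2_norm (lebesgue_on \<Omega>) (wgrad \<Omega> u))\<^sup>2"
    by (rule poincare_mean_zero_trace[OF dim bd lip(1) pos that])
  have "H1_norm \<Omega> u \<le> (1 + C) * (1 + (1 + cmod k) / \<delta>) * H_mhalf_norm \<Omega> g"
    if \<delta>: "0 < \<delta>" and k: "\<delta> \<le> \<bar>Im k\<bar> \<or> (0 \<le> Re k \<and> \<delta> \<le> cmod k)" and g: "g \<in> H_mhalf \<Omega>"
      and sol: "is_solution \<Omega> D k g u" for k g u \<delta>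
  proof -
    let ?L = "lebesgue_on \<Omega>"
    have u: "u \<in> H1 \<Omega>" "divergence_equation \<Omega> (conductivity \<Omega> D k) u"
      "has_normal_derivative (\<Omega> - closure D) (frontier \<Omega>) u g"
      using sol unfolding is_solution_def by auto
    obtain f where f: "has_trace \<Omega> (frontier \<Omega>) u f" "(LINT x|surface (frontier \<Omega>). f x) = 0"
      using sol unfolding is_solution_def by blast
    note tr = O.has_trace_cnj[OF f(1)]
    define G where "G = wgrad \<Omega> u"
    have GL: "G \<in> L2 ?L" unfolding G_def by (rule O.H1D(3)[OF u(1)])
    have Gi: "integrable ?L (\<lambda>x. (norm (G x))\<^sup>2)" by (rule L2D(2)[OF GL])
    \<comment> \<open>\<open>s\<close> and \<open>t\<close> are the energies of \<open>u\<close>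
      outside and inside the inclusion.\<close>
    define s where "s = (LINT x|?L. indicator (\<Omega> - D) x *\<^sub>R (norm (G x))\<^sup>2)"
    define t where "t = (LINT x|?L. indicator D x *\<^sub>R (norm (G x))\<^sup>2)"
    \<comment> \<open>Measurable sets of \<open>?L\<close> are subsets of \<Omega>; the
      intersections make this evident and are dropped again below.\<close>
    have Dm: "D \<inter> \<Omega> \<in> sets ?L" "(\<Omega> - D) \<inter> \<Omega> \<in> sets ?L"
      using op by (auto simp: sets_restrict_space_iff)
    have ii: "integrable ?L (\<lambda>x. indicator (D \<inter> \<Omega>) x *\<^sub>R (norm (G x))\<^sup>2)" "integrable ?L (\<lambda>x. indicator ((\<Omega> - D) \<inter> \<Omega>) x *\<^sub>R (norm (G x))\<^sup>2)"
      by (rule integrable_mult_indicator[OF Dm(1) Gi], rule integrable_mult_indicator[OF Dm(2) Gi])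
    have "integrable ?L (\<lambda>x. indicator (D \<inter> \<Omega>) x *\<^sub>R (norm (G x))\<^sup>2) = integrable ?L (\<lambda>x. indicator D x *\<^sub>R (norm (G x))\<^sup>2)"
      "integrable ?L (\<lambda>x. indicator ((\<Omega> - D) \<inter> \<Omega>) x *\<^sub>R (norm (G x))\<^sup>2) = integrable ?L (\<lambda>x. indicator (\<Omega> - D) x *\<^sub>R (norm (G x))\<^sup>2)"
      by (rule Bochner_Integration.integrable_cong; auto simp: space_restrict_space indicator_def)+
    then have i: "integrable ?L (\<lambda>x. indicator D x *\<^sub>R (norm (G x))\<^sup>2)" "integrable ?L (\<lambda>x. indicator (\<Omega> - D) x *\<^sub>R (norm (G x))\<^sup>2)"
      using ii by blast+
    have st0: "0 \<le> s" "0 \<le> t" unfolding s_def t_def by (simp_all add: integral_nonneg)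
    have E: "s + t = (L2_norm ?L G)\<^sup>2"
    proof -
      have "s + t = (LINT x|?L. indicator (\<Omega> - D) x *\<^sub>R (norm (G x))\<^sup>2 + indicator D x *\<^sub>R (norm (G x))\<^sup>2)"
        unfolding s_def t_def by (rule Bochner_Integration.integral_add[OF i(2,1), symmetric])
      also have "\<dots> = (LINT x|?L. (norm (G x))\<^sup>2)"
        by (rule Bochner_Integration.integral_cong) (auto simp: space_restrict_space indicator_def)
      finally show ?thesis by (simp add: L2_norm_sq)
    qed
    have cG: "AE x in ?L. wgrad \<Omega> (\<lambda>x. cnj (u x)) x = (\<chi> i. cnj (G x $ i))"
      unfolding G_def by (rule O.wgrad_AE[OF O.weak_gradient_cnj[OF O.H1D(2)[OF u(1)]]])
    \<comment> \<open>Neither the pairing nor \<open>cdot\<close> contains a conjugate, so the test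
      function carries it; the product of the gradients becomes |G|^2.\<close>
    have "g (\<lambda>x. cnj (f x)) = (LINT x|?L. conductivity \<Omega> D k x * cdot (G x) (wgrad \<Omega> (\<lambda>x. cnj (u x)) x))"
      unfolding G_def
      by (rule weak_formulation[OF op(1) bd op(2) D boundary_poincare(1)[OF dim bd lip(1)] u tr(1)])
    also have "\<dots> = (LINT x|?L. of_real (indicator (\<Omega> - D) x *\<^sub>R (norm (G x))\<^sup>2) + k * of_real (indicator D x *\<^sub>R (norm (G x))\<^sup>2))"
    proof (rule integral_cong_AE)
      show "(\<lambda>x. conductivity \<Omega> D k x * cdot (G x) (wgrad \<Omega> (\<lambda>x. cnj (u x)) x)) \<in> borel_measurable ?L"
      proof -
        have "(\<lambda>x. cnj (u x)) \<in> H1 \<Omega>" using tr(1) unfolding has_trace_def by blast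
        then show ?thesis
          by (intro borel_measurable_times borel_measurable_conductivity op borel_measurable_cdot L2D(1)[OF GL] L2D(1)[OF O.H1D(3)])
      qed
      show "(\<lambda>x. of_real (indicator (\<Omega> - D) x *\<^sub>R (norm (G x))\<^sup>2) + k * of_real (indicator D x *\<^sub>R (norm (G x))\<^sup>2)) \<in> borel_measurable ?L"
        using i by (intro borel_measurable_integrable Bochner_Integration.integrable_add integrable_mult_right integrable_of_real)
      show "AE x in ?L. conductivity \<Omega> D k x * cdot (G x) (wgrad \<Omega> (\<lambda>x. cnj (u x)) x) =
          of_real (indicator (\<Omega> - D) x *\<^sub>R (norm (G x))\<^sup>2) + k * of_real (indicator D x *\<^sub>R (norm (G x))\<^sup>2)"
        using cG by eventually_elim (simp add: cdot_cnj_self conductivity_def indicator_def)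
    qed
    also have "\<dots> = of_real s + k * of_real t"
      unfolding s_def t_def
      by (subst Bochner_Integration.integral_add) (use i in \<open>auto simp: integral_of_real simp del: of_real_mult real_scaleR_def\<close>)
    finally have gf: "g (\<lambda>x. cnj (f x)) = of_real s + k * of_real t" .
    have nn: "0 \<le> H_mhalf_norm \<Omega> g" by (rule O.H_mhalf_bound(2)[OF g f(1)])
    define A where "A = (1 + C) * (1 + (1 + cmod k) / \<delta>)"
    have A: "A \<ge> 0" unfolding A_def using C(1) \<delta> by (intro mult_nonneg_nonneg add_nonneg_nonneg divide_nonneg_pos) auto
    have "(H1_norm \<Omega> u)\<^sup>2 \<le> (1 + C) * (L2_norm ?L G)\<^sup>2"
      using C(2)[OF f] by (simp add: O.H1_norm_eq[OF O.H1D(2)[OF u(1)]] G_def algebra_simps)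
    also have "\<dots> \<le> (1 + C) * ((1 + (1 + cmod k) / \<delta>) * cmod (of_real s + k * of_real t))"
      unfolding E[symmetric] by (intro mult_left_mono norm_add_scaled_ge st0 \<delta>) (use C(1) k in auto)
    also have "\<dots> = A * cmod (g (\<lambda>x. cnj (f x)))" by (simp add: A_def gf)
    also have "\<dots> \<le> A * (H_mhalf_norm \<Omega> g * H1_norm \<Omega> u)"
      using O.H_mhalf_bound(1)[OF g tr(1)] A unfolding tr(2) by (rule mult_left_mono)
    \<comment> \<open>One factor is cancelled if it is positive; if it is zero, the claim only says
      that the right side is nonnegative.\<close>
    finally have sq: "H1_norm \<Omega> u * H1_norm \<Omega> u \<le> (A * H_mhalf_norm \<Omega> g) * H1_norm \<Omega> u"
      by (simp add: power2_eq_square mult.assoc)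
    show ?thesis
    proof (cases "H1_norm \<Omega> u = 0")
      case True
      then show ?thesis using A nn unfolding A_def[symmetric] by simp
    next
      case False
      then have "H1_norm \<Omega> u > 0" using H1_norm_nonneg[of \<Omega> u] by linarith
      then show ?thesis using sq unfolding A_def[symmetric] by (rule mult_right_le_imp_le[rotated])
    qed
  qed
  then show thesis using that[of "1 + C"] C(1) by simp
qed

theorem theorem4p6:
  fixes \<Omega> D :: "(real ^ 'n) set" and a b :: real
  assumes dim: "CARD('n) \<ge> 2"
    and Omega: "bounded \<Omega>" "simply_connected \<Omega>" "lipschitz_domain \<Omega>"
    and D: "simply_connected D" "lipschitz_domain D" "closure D \<subseteq> \<Omega>"
    and ab: "a < b" "b < 0"
    and well_posed: "\<forall>k. k \<notin> complex_of_real ` {a..b} \<longrightarrow>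
      (\<forall>g \<in> H_mhalf0 \<Omega>. \<exists>u. is_solution \<Omega> D k g u \<and>
         (\<forall>v. is_solution \<Omega> D k g v \<longrightarrow> (AE x in lebesgue_on \<Omega>. v x = u x))) \<and>
      (\<exists>C. \<forall>g \<in> H_mhalf0 \<Omega>. \<forall>u. is_solution \<Omega> D k g u \<longrightarrow>
         H1_norm \<Omega> u \<le> C * H_mhalf_norm \<Omega> g)"
    and uniform: "\<exists>C. \<forall>k. cmod k > - a \<or> cmod k < - b \<longrightarrow>
      (\<forall>g \<in> H_mhalf0 \<Omega>. \<forall>u. is_solution \<Omega> D k g u \<longrightarrow>
         H1_norm \<Omega> u \<le> C * H_mhalf_norm \<Omega> g)"
  shows "\<forall>\<epsilon>>0. \<exists>C. \<forall>k \<in> Q_set a b \<epsilon>. \<forall>g \<in> H_mhalf0 \<Omega>. \<forall>u. is_solution \<Omega> D k g u \<longrightarrow>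
           H1_norm \<Omega> u \<le> C * H_mhalf_norm \<Omega> g"
proof (intro allI impI)
  fix \<epsilon> :: real assume \<epsilon>: "0 < \<epsilon>"
  have op: "open \<Omega>" "\<Omega> \<noteq> {}" using Omega by (auto simp: lipschitz_domain_def)
  interpret O: bounded_open \<Omega> using op Omega by unfold_locales
  \<comment> \<open>The value k = 1 is admissible as b < 0. If the boundary measure were zero,
    adding 1 to the solution for zero data would give another solution, so uniqueness would give u +
    1 = u almost everywhere and make the nonempty open set \<Omega> null.\<close>
  have pos: "measure (surface (frontier \<Omega>)) (frontier \<Omega>) > 0"
  proof (rule ccontr)
    assume "\<not> ?thesis"
    then have null: "measure (surface (frontier \<Omega>)) (frontier \<Omega>) = 0"
      using measure_nonneg[of "surface (frontier \<Omega>)" "frontier \<Omega>"] by linarith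
    have "1 \<notin> complex_of_real ` {a..b}"
    proof
      assume "1 \<in> complex_of_real ` {a..b}"
      then obtain r where "r \<le> b" "complex_of_real r = 1" by auto
      then show False using ab(2) by simp
    qed
    moreover have "(\<lambda>f. 0) \<in> H_mhalf0 \<Omega>"
      unfolding H_mhalf0_def H_mhalf_def by (auto intro!: exI[of _ 0])
    ultimately obtain u where u: "is_solution \<Omega> D 1 (\<lambda>f. 0) u"
      "\<And>v. is_solution \<Omega> D 1 (\<lambda>f. 0) v \<Longrightarrow> AE x in lebesgue_on \<Omega>. v x = u x"
      using well_posed by blast
    have "AE x in lebesgue_on \<Omega>. u x + 1 = u x"
      by (rule u(2)[OF is_solution_add_const[OF dim Omega(1,3) D(2,3) null u(1)]])
    then have "AE x in lebesgue_on \<Omega>. False" by eventually_elim simp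
    then have "emeasure (lebesgue_on \<Omega>) (space (lebesgue_on \<Omega>)) = 0"
      using AE_iff_measurable[of "space (lebesgue_on \<Omega>)" "lebesgue_on \<Omega>" "\<lambda>_. False"] by simp
    then have "emeasure lborel \<Omega> = 0" using op by (simp add: emeasure_restrict_space space_restrict_space)
    then have "negligible \<Omega>" using op by (simp add: negligible_iff_null_sets null_sets_def)
    then show False using open_not_negligible[OF op] by blast
  qed
  obtain C1 where C1: "C1 \<ge> 0" "\<And>k g u \<delta>. 0 < \<delta> \<Longrightarrow> \<delta> \<le> \<bar>Im k\<bar> \<or> (0 \<le> Re k \<and> \<delta> \<le> cmod k) \<Longrightarrow> g \<in> H_mhalf \<Omega> \<Longrightarrow>
     is_solution \<Omega> D k g u \<Longrightarrow> H1_norm \<Omega> u \<le> C1 * (1 + (1 + cmod k) / \<delta>) * H_mhalf_norm \<Omega> g"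
    by (rule energy_estimate[OF dim Omega(1,3) D(2,3) pos that])
  obtain C2 where C2: "\<And>k g u. cmod k > - a \<or> cmod k < - b \<Longrightarrow> g \<in> H_mhalf0 \<Omega> \<Longrightarrow> is_solution \<Omega> D k g u \<Longrightarrow>
      H1_norm \<Omega> u \<le> C2 * H_mhalf_norm \<Omega> g"
    using uniform by blast
  \<comment> \<open>The two entries match the two alternatives of
    \<open>Q_set_annulus\<close>.\<close>
  define \<delta> where "\<delta> = min (\<epsilon> / 2) (- b)"
  have \<delta>: "0 < \<delta>" using \<epsilon> ab by (simp add: \<delta>_def)
  \<comment> \<open>In the annulus |k| \<le> - a, so 1 + |k| is at most \<open>1 - a\<close>;
    \<open>C2\<close> serves outside of it.\<close>
  define C where "C = max C2 (C1 * (1 + (1 - a) / \<delta>))"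
  have "H1_norm \<Omega> u \<le> C * H_mhalf_norm \<Omega> g"
    if k: "k \<in> Q_set a b \<epsilon>" and g: "g \<in> H_mhalf0 \<Omega>" and sol: "is_solution \<Omega> D k g u" for k g u
  proof -
    have gm: "g \<in> H_mhalf \<Omega>" using g by (simp add: H_mhalf0_def)
    obtain f where f: "has_trace \<Omega> (frontier \<Omega>) u f" using sol unfolding is_solution_def by blast
    have nn: "0 \<le> H_mhalf_norm \<Omega> g" by (rule O.H_mhalf_bound(2)[OF gm f])
    \<comment> \<open>Any smaller constant suffices because the norm of \<open>g\<close> is
      nonnegative.\<close>
    have "\<exists>C'\<le>C. H1_norm \<Omega> u \<le> C' * H_mhalf_norm \<Omega> g"
    proof (cases "cmod k > - a \<or> cmod k < - b")
      case True
      then show ?thesis using C2[OF True g sol] by (intro exI[of _ C2]) (simp add: C_def)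
    next
      case False
      then have m: "cmod k \<le> - a" "- b \<le> cmod k" by auto
      have "\<delta> \<le> \<bar>Im k\<bar> \<or> (0 \<le> Re k \<and> \<delta> \<le> cmod k)"
        using Q_set_annulus[OF ab \<epsilon> k m] by (auto simp: \<delta>_def)
      then have "H1_norm \<Omega> u \<le> C1 * (1 + (1 + cmod k) / \<delta>) * H_mhalf_norm \<Omega> g"
        by (rule C1(2)[OF \<delta> _ gm sol])
      moreover have "C1 * (1 + (1 + cmod k) / \<delta>) \<le> C1 * (1 + (1 - a) / \<delta>)"
        using C1(1) \<delta> m by (intro mult_left_mono add_left_mono divide_right_mono) auto
      ultimately show ?thesis by (intro exI[of _ "C1 * (1 + (1 + cmod k) / \<delta>)"]) (simp add: C_def)
    qed
    then show ?thesis using nn mult_right_mono order_trans by blast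
  qed
  then show "\<exists>C. \<forall>k \<in> Q_set a b \<epsilon>. \<forall>g \<in> H_mhalf0 \<Omega>. \<forall>u. is_solution \<Omega> D k g u \<longrightarrow>
           H1_norm \<Omega> u \<le> C * H_mhalf_norm \<Omega> g" by blast
qed

end
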